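(* Assume (H1)–(H3) of the context, with $\varsigma\in(0,1)$ the Hölder exponent in (H3). Then there exists a solution $(u,\rho)\in\mathscr C^{2,\varsigma}(\Gamma)\times\mathbb R$ to $$\begin{cases}-\mu_\alpha\partial^2u(x)+H(x,\partial u(x))+\rho=F(x)&\text{for all }x\in\Gamma_\alpha\setminus\mathcal V,\ \alpha\in\mathcal A,\\ u_{|\Gamma_\alpha}(v)=u_{|\Gamma_\beta}(v)&\text{for all }\alpha,\beta\in\mathcal A_v,\ v\in\mathcal V,\\ \sum_{\alpha\in\mathcal A_v}\mu_\alpha\gamma_{v,\alpha}\,\partial_\alpha u(v)=\eta_v(\theta_v-\rho)&\text{for all }v\in\mathcal V\setminus\partial\mathcal V,\\ \partial_\alpha u(v)=0&\text{for all }v\in\partial\mathcal V,\ \alpha\in\mathcal A_v.\end{cases}$$ Furthermore, this solution is unique up to translation of $u$ by a constant. Finally, there exists $\hat C>0$, depending only on $\|F\|_{L^\infty}$, $(|\theta_v|)_{v\in\mathcal V\setminus\partial\mathcal V}$, $\|H(\cdot,0)\|_{L^\infty}$, $C_H$, $\boldsymbol\gamma=\{\gamma_{v,\alpha}\}$, $\Gamma$ and $q$, such that $$\|\partial u\|_{L^q(\Gamma)}+\|u\|_{W^{2,1}(\Gamma)}\le\hat C .$$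
   Context: Network. $\mathcal V\subset\mathbb R^d$ is a finite set of vertices; $P\subset\mathcal V\times\mathcal V$ contains no pair $(v,v)$, and every vertex occurs in at least one pair of $P$. The edges are the segments joining the two points of a pair in $P$, indexed as $\Gamma_\alpha$, $\alpha\in\mathcal A$ ($\mathcal A$ finite); for $\alpha\ne\beta$, $\Gamma_\alpha\cap\Gamma_\beta=\{v\}$ if both edges contain the vertex $v$, and $\Gamma_\alpha\cap\Gamma_\beta=\varnothing$ otherwise. The network $\Gamma=\bigcup_{\alpha}\Gamma_\alpha$ is assumed connected and carries its geodesic distance. $\mathcal A_v=\{\alpha\in\mathcal A: v\in\Gamma_\alpha\}$; $\partial\mathcal V$ is the set of boundary vertices, i.e. those $v$ for which there is a unique $\bar v\in\mathcal V$ with $(v,\bar v)\in P$ or $(\bar v,v)\in P$. An edge $\Gamma_\alpha$ with vertices $v_i,v_j$ and length $L_\alpha$ is parametrized by $\pi_\alpha(s)=v_i+s\,e_\alpha$, $e_\alpha=(v_j-v_i)/L_\alpha$, $s\in[0,L_\alpha]$. For $u:\Gamma\to\mathbb R$, $u_\alpha=u\circ\pi_\alpha$ on $(0,L_\alpha)$, and $u_{|\Gamma_\alpha}(v)$ is the limit of $u_\alpha$ at the endpoint corresponding to $v\in\Gamma_\alpha$. $\partial u$, $\partial^2u$ inside $\Gamma_\alpha$ are derivatives of $u_\alpha$ with respect to $s$. At a vertex $v\in\Gamma_\alpha$, $\partial_\alpha u(v)$ is the outward derivative: $-u_\alpha'(0)$ if $v=\pi_\alpha(0)$, $u_\alpha'(L_\alpha)$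 if $v=\pi_\alpha(L_\alpha)$. Spaces. $\mathscr C^k(\Gamma)$: continuous functions on $\Gamma$ with $u_\alpha\in C^k([0,L_\alpha])$ for all $\alpha$; $\mathscr C^{k,\varsigma}(\Gamma)$: those for which moreover each $\partial^ku_\alpha$ is $\varsigma$-Hölder on $[0,L_\alpha]$. $PC(\Gamma)$: functions with each $u_\alpha$ continuous on $(0,L_\alpha)$ with finite limits at the endpoints, identified if they agree on the interior of every edge; $PC^\varsigma(\Gamma)$: those $u\in PC(\Gamma)$ with each $u_\alpha$ (extended) $\varsigma$-Hölder on $[0,L_\alpha]$. $\|f\|_{L^q(\Gamma)}=(\sum_\alpha\|f_\alpha\|_{L^q(0,L_\alpha)}^q)^{1/q}$ and $\|u\|_{W^{2,1}(\Gamma)}=\|u\|_{L^1}+\|\partial u\|_{L^1}+\|\partial^2u\|_{L^1}$. (H1) $\lambda>0$ (a discount parameter that does not appear in the problem above); for each $v\in\mathcal V\setminus\partial\mathcal V$ and $\alpha\in\mathcal A_v$: $\gamma_{v,\alpha}>0$, $\eta_v\ge0$, $\theta_v\in\mathbb R$; $\mu_\alpha>0$ for all $\alpha\in\mathcal A$; and $\sum_{\alpha\in\mathcal A_v}\mu_\alpha\gamma_{v,\alpha}=1$ for all $v\in\mathcal V\setminus\partial\mathcal V$. (H2) For each $\alpha\in\mathcal A$, the map $H_\alpha:\Gamma_\alpha\times\mathbb R\to\mathbb R$, $H_\alpha(x,p)=H(x,p)$ for $x\in\Gamma_\alpha\setminus\mathcal V$ and $H_\alpha(x,p)=\lim_{y\to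 x,\,y\in\Gamma_\alpha\setminus\mathcal V}H(y,p)$ for $x\in\mathcal V$, is well defined and continuous; for each $x\in\Gamma_\alpha\setminus\mathcal V$, $p\mapsto H_\alpha(x,p)$ is continuously differentiable and $\partial_pH_\alpha$ extends to a continuous map on $\Gamma_\alpha\times\mathbb R$. There exist $C_H>0$ and $q\in(1,2]$ such that for all $(x,p)\in\Gamma_\alpha\times\mathbb R$: $|H_\alpha(x,p)|\le C_H(1+|p|^q)$, $|\partial_pH_\alpha(x,p)|\le C_H(1+|p|^{q-1})$, $H_\alpha(x,p)\ge C_H^{-1}|p|^q-C_H$. (H3) $F\in PC^\varsigma(\Gamma)$ for some $\varsigma\in(0,1)$.
   Formalization: Existence is in C², and in C^{2,ς} if H is ς-Hölder in x locally uniformly in p; Ĉ may also depend on μ and η; the estimate is for u−u(x₀), any x₀∈Γ. The literal claims fail, e.g. for H=p²+h(x) with h not ς-Hölder, or as μ→0 or η→∞. *)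

theory Defs
  imports "HOL-Analysis.Analysis"
begin

section \<open>Networks\<close>

text \<open>
  The edge with index \<open>a\<close> is the segment from \<open>src N a\<close> to \<open>tgt N a\<close>; the orientation is
  arbitrary.
\<close>

record ('d, 'e) network =
  verts :: "(real ^ 'd) set"
  pairs :: "((real ^ 'd) \<times> (real ^ 'd)) set"
  edges :: "'e set"
  src :: "'e \<Rightarrow> real ^ 'd"
  tgt :: "'e \<Rightarrow> real ^ 'd"

definition edge_ends :: "('d::finite, 'e) network \<Rightarrow> 'e \<Rightarrow> (real ^ 'd) set" where
  "edge_ends N a = {src N a, tgt N a}"

definition edge_set :: "('d::finite, 'e) network \<Rightarrow> 'e \<Rightarrow> (real ^ 'd) set" where
  "edge_set N a = closed_segment (src N a) (tgt N a)"

definition net_set :: "('d::finite, 'e) network \<Rightarrow> (real ^ 'd) set" where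
  "net_set N = (\<Union>a\<in>edges N. edge_set N a)"

definition edge_len :: "('d::finite, 'e) network \<Rightarrow> 'e \<Rightarrow> real" where
  "edge_len N a = dist (src N a) (tgt N a)"

definition edge_param :: "('d::finite, 'e) network \<Rightarrow> 'e \<Rightarrow> real \<Rightarrow> real ^ 'd" where
  "edge_param N a s = src N a + s *\<^sub>R ((tgt N a - src N a) /\<^sub>R edge_len N a)"

text \<open>
  An edge contains a vertex as one of its end points only: in the two intersection conditions
  ``contains the vertex'' refers to \<open>edge_ends\<close>, which rules out vertices in the interior of an
  edge. The set \<open>verts N\<close> is nonempty because a connected space is nonempty; for the empty
  network, uniqueness of the constant \<open>\<rho>\<close> below would fail.
\<close>

definition network :: "('d::finite, 'e) network \<Rightarrow> bool" where
  "network N \<longleftrightarrow>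
     finite (verts N) \<and> verts N \<noteq> {} \<and>
     pairs N \<subseteq> verts N \<times> verts N \<and> (\<forall>v. (v, v) \<notin> pairs N) \<and>
     (\<forall>v\<in>verts N. \<exists>w. (v, w) \<in> pairs N \<or> (w, v) \<in> pairs N) \<and>
     finite (edges N) \<and>
     (\<forall>a\<in>edges N. (src N a, tgt N a) \<in> pairs N \<or> (tgt N a, src N a) \<in> pairs N) \<and>
     (\<forall>(v, w)\<in>pairs N. \<exists>a\<in>edges N. edge_ends N a = {v, w}) \<and>
     (\<forall>a\<in>edges N. \<forall>b\<in>edges N. a \<noteq> b \<longrightarrow>
        (\<forall>v\<in>edge_ends N a \<inter> edge_ends N b. edge_set N a \<inter> edge_set N b = {v}) \<and>
        (edge_ends N a \<inter> edge_ends N b = {} \<longrightarrow> edge_set N a \<inter> edge_set N b = {})) \<and>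
     connected (net_set N)"

definition incident :: "('d::finite, 'e) network \<Rightarrow> real ^ 'd \<Rightarrow> 'e set" where
  "incident N v = {a \<in> edges N. v \<in> edge_set N a}"

definition bdry_verts :: "('d::finite, 'e) network \<Rightarrow> (real ^ 'd) set" where
  "bdry_verts N = {v \<in> verts N. \<exists>!w. w \<in> verts N \<and> ((v, w) \<in> pairs N \<or> (w, v) \<in> pairs N)}"

abbreviation inner_verts :: "('d::finite, 'e) network \<Rightarrow> (real ^ 'd) set" where
  "inner_verts N \<equiv> verts N - bdry_verts N"

section \<open>Functions on a network\<close>

text \<open>
  Functions on the network are total functions on the ambient space of which only the values on
  \<open>net_set N\<close> matter.
\<close>

definition on_edge :: "('d::finite, 'e) network \<Rightarrow> (real ^ 'd \<Rightarrow> real) \<Rightarrow> 'e \<Rightarrow> real \<Rightarrow> real" where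
  "on_edge N u a = (\<lambda>s. u (edge_param N a s))"

text \<open>Derivative on \<open>[0, L]\<close>, one-sided at the end points.\<close>

definition deriv_Icc :: "real \<Rightarrow> (real \<Rightarrow> real) \<Rightarrow> real \<Rightarrow> real" where
  "deriv_Icc L f = (\<lambda>s. vector_derivative f (at s within {0..L}))"

definition edge_deriv ::
    "('d::finite, 'e) network \<Rightarrow> nat \<Rightarrow> (real ^ 'd \<Rightarrow> real) \<Rightarrow> 'e \<Rightarrow> real \<Rightarrow> real" where
  "edge_deriv N k u a = (deriv_Icc (edge_len N a) ^^ k) (on_edge N u a)"

definition Ck_Icc :: "nat \<Rightarrow> real \<Rightarrow> (real \<Rightarrow> real) \<Rightarrow> bool" where
  "Ck_Icc k L f \<longleftrightarrow>
     (\<forall>j<k. (deriv_Icc L ^^ j) f differentiable_on {0..L}) \<and>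
     (\<forall>j\<le>k. continuous_on {0..L} ((deriv_Icc L ^^ j) f))"

definition hoelder_on :: "real \<Rightarrow> real set \<Rightarrow> (real \<Rightarrow> real) \<Rightarrow> bool" where
  "hoelder_on \<sigma> S f \<longleftrightarrow> (\<exists>K. \<forall>s\<in>S. \<forall>t\<in>S. \<bar>f s - f t\<bar> \<le> K * \<bar>s - t\<bar> powr \<sigma>)"

text \<open>
  Continuity is with respect to the Euclidean topology of \<open>net_set N\<close>, which on a finite network
  of segments is the topology of the geodesic distance.
\<close>

definition Ck_net :: "('d::finite, 'e) network \<Rightarrow> nat \<Rightarrow> (real ^ 'd \<Rightarrow> real) \<Rightarrow> bool" where
  "Ck_net N k u \<longleftrightarrow>
     continuous_on (net_set N) u \<and>
     (\<forall>a\<in>edges N. Ck_Icc k (edge_len N a) (on_edge N u a))"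

definition Ck_hoelder_net ::
    "('d::finite, 'e) network \<Rightarrow> nat \<Rightarrow> real \<Rightarrow> (real ^ 'd \<Rightarrow> real) \<Rightarrow> bool" where
  "Ck_hoelder_net N k \<sigma> u \<longleftrightarrow>
     Ck_net N k u \<and> (\<forall>a\<in>edges N. hoelder_on \<sigma> {0..edge_len N a} (edge_deriv N k u a))"

text \<open>The limit of \<open>u\<close> along the edge \<open>a\<close> at the parameter \<open>s0\<close>.\<close>

definition edge_lim ::
    "('d::finite, 'e) network \<Rightarrow> (real ^ 'd \<Rightarrow> real) \<Rightarrow> 'e \<Rightarrow> real \<Rightarrow> real" where
  "edge_lim N u a s0 = Lim (at s0 within {0<..<edge_len N a}) (on_edge N u a)"

definition end_param :: "('d::finite, 'e) network \<Rightarrow> 'e \<Rightarrow> real ^ 'd \<Rightarrow> real" where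
  "end_param N a v = (if v = src N a then 0 else edge_len N a)"

definition edge_trace ::
    "('d::finite, 'e) network \<Rightarrow> (real ^ 'd \<Rightarrow> real) \<Rightarrow> 'e \<Rightarrow> real ^ 'd \<Rightarrow> real" where
  "edge_trace N u a v = edge_lim N u a (end_param N a v)"

definition PC_net :: "('d::finite, 'e) network \<Rightarrow> (real ^ 'd \<Rightarrow> real) \<Rightarrow> bool" where
  "PC_net N u \<longleftrightarrow> (\<forall>a\<in>edges N.
     continuous_on {0<..<edge_len N a} (on_edge N u a) \<and>
     (\<forall>s0\<in>{0, edge_len N a}.
        \<exists>l. (on_edge N u a \<longlongrightarrow> l) (at s0 within {0<..<edge_len N a})))"

definition edge_ext ::
    "('d::finite, 'e) network \<Rightarrow> (real ^ 'd \<Rightarrow> real) \<Rightarrow> 'e \<Rightarrow> real \<Rightarrow> real" where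
  "edge_ext N u a s =
     (if s \<in> {0<..<edge_len N a} then on_edge N u a s else edge_lim N u a s)"

definition PC_hoelder_net ::
    "('d::finite, 'e) network \<Rightarrow> real \<Rightarrow> (real ^ 'd \<Rightarrow> real) \<Rightarrow> bool" where
  "PC_hoelder_net N \<sigma> u \<longleftrightarrow>
     PC_net N u \<and> (\<forall>a\<in>edges N. hoelder_on \<sigma> {0..edge_len N a} (edge_ext N u a))"

definition outward_deriv ::
    "('d::finite, 'e) network \<Rightarrow> (real ^ 'd \<Rightarrow> real) \<Rightarrow> 'e \<Rightarrow> real ^ 'd \<Rightarrow> real" where
  "outward_deriv N u a v =
     (if v = src N a then - edge_deriv N 1 u a 0 else edge_deriv N 1 u a (edge_len N a))"

text \<open>
  The norms take a family of functions of arc length, one for each edge, so that they apply to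
  \<open>\<partial>u\<close> and \<open>\<partial>\<^sup>2u\<close> as well.
\<close>

definition Lq_norm ::
    "('d::finite, 'e) network \<Rightarrow> real \<Rightarrow> ('e \<Rightarrow> real \<Rightarrow> real) \<Rightarrow> real" where
  "Lq_norm N q f =
     (\<Sum>a\<in>edges N. LINT s:{0<..<edge_len N a}|lborel. \<bar>f a s\<bar> powr q) powr (1 / q)"

definition Linf_norm :: "('d::finite, 'e) network \<Rightarrow> ('e \<Rightarrow> real \<Rightarrow> real) \<Rightarrow> real" where
  "Linf_norm N f =
     Inf {M. 0 \<le> M \<and>
       (\<forall>a\<in>edges N. AE s in lborel. s \<in> {0<..<edge_len N a} \<longrightarrow> \<bar>f a s\<bar> \<le> M)}"

definition W21_norm :: "('d::finite, 'e) network \<Rightarrow> (real ^ 'd \<Rightarrow> real) \<Rightarrow> real" where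
  "W21_norm N u =
     Lq_norm N 1 (on_edge N u) + Lq_norm N 1 (edge_deriv N 1 u) + Lq_norm N 1 (edge_deriv N 2 u)"

section \<open>Assumptions on the data\<close>

definition coeff_assms ::
    "('d::finite, 'e) network \<Rightarrow> real \<Rightarrow> ('e \<Rightarrow> real) \<Rightarrow> (real ^ 'd \<Rightarrow> 'e \<Rightarrow> real) \<Rightarrow>
      (real ^ 'd \<Rightarrow> real) \<Rightarrow> bool" where
  "coeff_assms N lam \<mu> \<gamma> \<eta> \<longleftrightarrow>
     0 < lam \<and>
     (\<forall>a\<in>edges N. 0 < \<mu> a) \<and>
     (\<forall>v\<in>inner_verts N. 0 \<le> \<eta> v \<and> (\<forall>a\<in>incident N v. 0 < \<gamma> v a) \<and>
        (\<Sum>a\<in>incident N v. \<mu> a * \<gamma> v a) = 1)"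

definition edge_ham ::
    "('d::finite, 'e) network \<Rightarrow> (real ^ 'd \<Rightarrow> real \<Rightarrow> real) \<Rightarrow> 'e \<Rightarrow> real ^ 'd \<Rightarrow> real \<Rightarrow> real" where
  "edge_ham N H a x p =
     (if x \<in> verts N then Lim (at x within (edge_set N a - verts N)) (\<lambda>y. H y p) else H x p)"

text \<open>\<open>dH\<close> is the continuous extension of the derivative in \<open>p\<close> to the closed edge.\<close>

definition ham_assms ::
    "('d::finite, 'e) network \<Rightarrow> (real ^ 'd \<Rightarrow> real \<Rightarrow> real) \<Rightarrow> real \<Rightarrow> real \<Rightarrow> bool" where
  "ham_assms N H CH q \<longleftrightarrow>
     0 < CH \<and> 1 < q \<and> q \<le> 2 \<and>
     (\<forall>a\<in>edges N.
        (\<forall>v\<in>edge_set N a \<inter> verts N. \<forall>p. \<exists>l.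
           ((\<lambda>y. H y p) \<longlongrightarrow> l) (at v within (edge_set N a - verts N))) \<and>
        continuous_on (edge_set N a \<times> UNIV) (\<lambda>(x, p). edge_ham N H a x p) \<and>
        (\<exists>dH :: real ^ 'd \<Rightarrow> real \<Rightarrow> real.
           continuous_on (edge_set N a \<times> UNIV) (\<lambda>(x, p). dH x p) \<and>
           (\<forall>x\<in>edge_set N a - verts N. \<forall>p.
              (edge_ham N H a x has_real_derivative dH x p) (at p)) \<and>
           (\<forall>x\<in>edge_set N a. \<forall>p. \<bar>dH x p\<bar> \<le> CH * (1 + \<bar>p\<bar> powr (q - 1)))) \<and>
        (\<forall>x\<in>edge_set N a. \<forall>p.
           \<bar>edge_ham N H a x p\<bar> \<le> CH * (1 + \<bar>p\<bar> powr q) \<and>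
           edge_ham N H a x p \<ge> (1 / CH) * \<bar>p\<bar> powr q - CH))"

text \<open>
  \<open>H\<close> is Hoelder in \<open>x\<close>, locally uniformly in \<open>p\<close>. This does not follow from \<open>ham_assms\<close>, which
  gives mere continuity in \<open>x\<close>, and second derivatives of solutions inherit it: on a single edge
  \<open>[0, L]\<close> with \<open>\<mu> = 1\<close>, \<open>F = 0\<close> and \<open>H(x, p) = p\<^sup>2 + h(x)\<close>, any \<open>C\<^sup>2\<close> solution satisfies
  \<open>h = u'' - u'\<^sup>2 - \<rho>\<close> with \<open>u'\<^sup>2\<close> Lipschitz, so \<open>u''\<close> is Hoelder only if \<open>h\<close> is.
\<close>

definition ham_hoelder ::
    "('d::finite, 'e) network \<Rightarrow> (real ^ 'd \<Rightarrow> real \<Rightarrow> real) \<Rightarrow> real \<Rightarrow> bool" where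
  "ham_hoelder N H \<sigma> \<longleftrightarrow>
     (\<forall>a\<in>edges N. \<forall>R. \<exists>K. \<forall>p. \<bar>p\<bar> \<le> R \<longrightarrow>
        (\<forall>s\<in>{0<..<edge_len N a}. \<forall>t\<in>{0<..<edge_len N a}.
           \<bar>H (edge_param N a s) p - H (edge_param N a t) p\<bar> \<le> K * \<bar>s - t\<bar> powr \<sigma>))"

section \<open>The ergodic problem\<close>

text \<open>The points of the edge \<open>a\<close> outside \<open>verts N\<close> are those with parameter in \<open>(0, L)\<close>.\<close>

definition ergodic_sol ::
    "('d::finite, 'e) network \<Rightarrow> ('e \<Rightarrow> real) \<Rightarrow> (real ^ 'd \<Rightarrow> 'e \<Rightarrow> real) \<Rightarrow> (real ^ 'd \<Rightarrow> real) \<Rightarrow>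
      (real ^ 'd \<Rightarrow> real) \<Rightarrow> (real ^ 'd \<Rightarrow> real \<Rightarrow> real) \<Rightarrow> (real ^ 'd \<Rightarrow> real) \<Rightarrow>
      (real ^ 'd \<Rightarrow> real) \<Rightarrow> real \<Rightarrow> bool" where
  "ergodic_sol N \<mu> \<gamma> \<eta> \<theta> H F u \<rho> \<longleftrightarrow>
     (\<forall>a\<in>edges N. \<forall>s\<in>{0<..<edge_len N a}.
        - \<mu> a * edge_deriv N 2 u a s + H (edge_param N a s) (edge_deriv N 1 u a s) + \<rho>
          = F (edge_param N a s)) \<and>
     (\<forall>v\<in>verts N. \<forall>a\<in>incident N v. \<forall>b\<in>incident N v. edge_trace N u a v = edge_trace N u b v) \<and>
     (\<forall>v\<in>inner_verts N.
        (\<Sum>a\<in>incident N v. \<mu> a * \<gamma> v a * outward_deriv N u a v) = \<eta> v * (\<theta> v - \<rho>)) \<and>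
     (\<forall>v\<in>bdry_verts N. \<forall>a\<in>incident N v. outward_deriv N u a v = 0)"

end

theory Submission
  imports Defs
begin

text \<open>
  Since the network is one-dimensional, the problem is one about first order equations. On an edge
  the derivative \<open>w = \<partial>u\<close> solves the scalar equation \<open>w' = (H(s, w) - F(s) + \<rho>) / \<mu>\<close>, and \<open>u\<close> is
  recovered from a potential on the vertices whose increment along each edge is the integral of
  \<open>w\<close>. What remains is a system of flux inequalities on a finite graph.

  Everything rests on a Hopf lemma for scalar differential inequalities: if
  \<open>w' \<ge> \<delta> - K |w|\<close> with \<open>\<delta> \<ge> 0\<close> and \<open>w\<close> has nonnegative integral, then \<open>w \<ge> 0\<close> at the right end
  point, with equality only in the trivial case (\<open>end_value_of_nonneg_integral\<close>). At a vertex
  where the potential is maximal, it gives a sign to all outward derivatives; hence the strong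
  maximum principle on the graph (\<open>strong_maximum_principle\<close>). Applied to the difference of two
  solutions this is uniqueness, and applied to one solution it bounds \<open>|\<rho>|\<close>.

  The a priori bound comes from the superlinear growth of \<open>H\<close>: a solution that is large and positive
  at the left end point blows up before the right one (\<open>coercive_start_bound\<close>). So each outward
  derivative is bounded below by a constant that depends on the data through their bounds only.
  The Kirchhoff conditions then bound the outward derivatives above, and integrating
  \<open>w' \<ge> - C\<close> from both ends bounds \<open>w\<close> inside the edges (\<open>net_bound_imp_bounded\<close>).

  For existence, let a subsolution be a family of solutions on the edges that has a potential and
  satisfies the flux conditions with \<open>\<le>\<close> in place of equality. The constant \<open>\<rho>\<close> of the problem is
  the largest one that admits a subsolution. The maximum is attained because the a priori bound
  already holds for subsolutions, and solutions of the edge equations depend continuously on their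
  data. If a subsolution for the maximal \<open>\<rho>\<close> were strict at some vertex, raising the potential
  there a little would make it strict at the neighbours as well (\<open>strictness_spreads\<close>). Iterating
  this on the connected graph would make it strict everywhere, and then \<open>\<rho>\<close> could be increased. No
  boundary value problem on an edge has to be solved for this: small changes of the potential and
  of \<open>\<rho>\<close> are all that is needed, and these are provided by \<open>ode_sol_perturb\<close>.
\<close>

section \<open>Scalar differential inequalities\<close>

lemma has_real_derivative_within_imp_continuous_on:
  fixes z :: "real \<Rightarrow> real"
  assumes "\<And>s. s \<in> S \<Longrightarrow> (z has_real_derivative z' s) (at s within S)"
  shows "continuous_on S z"
  using assms by (auto simp: continuous_on_eq_continuous_within intro!: DERIV_continuous)

lemma continuous_on_Icc_bounded:
  fixes z :: "real \<Rightarrow> real"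
  assumes "continuous_on {a..b} z"
  obtains R where "\<And>s. s \<in> {a..b} \<Longrightarrow> \<bar>z s\<bar> \<le> R"
proof -
  have "bounded (z ` {a..b})"
    by (intro compact_imp_bounded compact_continuous_image assms compact_Icc)
  then show ?thesis
    using that unfolding bounded_iff by (metis image_eqI real_norm_def)
qed

lemma Icc_deriv_nonneg_imp_le:
  fixes z :: "real \<Rightarrow> real"
  assumes ab: "a \<le> b" "{a..b} \<subseteq> S"
    and D: "\<And>s. s \<in> S \<Longrightarrow> (z has_real_derivative z' s) (at s within S)"
    and pos: "\<And>s. a < s \<Longrightarrow> s < b \<Longrightarrow> 0 \<le> z' s"
  shows "z a \<le> z b"
proof (rule DERIV_nonneg_imp_increasing_open[OF ab(1)])
  fix x assume x: "a < x" "x < b"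
  have "(z has_real_derivative z' x) (at x within {a..b})"
    using x ab(2) by (intro DERIV_subset[OF D]) auto
  then show "\<exists>y. DERIV z x :> y \<and> 0 \<le> y"
    using pos[OF x] x by (auto simp: at_within_Icc_at)
next
  show "continuous_on {a..b} z"
    using has_real_derivative_within_imp_continuous_on[OF D] ab(2) continuous_on_subset by blast
qed

lemma compact_superlevel_Icc:
  fixes z :: "real \<Rightarrow> real"
  assumes "continuous_on {a..b} z"
  shows "compact {s \<in> {a..b}. 0 \<le> z s}"
proof -
  have "closed ({a..b} \<inter> z -` {0..})"
    by (rule continuous_closed_preimage[OF assms]) auto
  moreover have "{a..b} \<inter> z -` {0..} = {s \<in> {a..b}. 0 \<le> z s}"
    by auto
  moreover have "bounded {s \<in> {a..b}. 0 \<le> z s}"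
    by (rule bounded_subset[of "{a..b}"]) auto
  ultimately show ?thesis
    by (simp add: compact_eq_bounded_closed)
qed

text \<open>
  Past the last point at which \<open>z\<close> is nonnegative, \<open>exp (- K s) z(s)\<close> would be nondecreasing and
  hence could not become negative.
\<close>

lemma nonneg_barrier:
  fixes z z' :: "real \<Rightarrow> real"
  assumes D: "\<And>s. s \<in> {a..b} \<Longrightarrow> (z has_real_derivative z' s) (at s within {a..b})"
    and init: "0 \<le> z a"
    and ineq: "\<And>s. s \<in> {a..b} \<Longrightarrow> z s < 0 \<Longrightarrow> K * z s \<le> z' s"
    and t: "t \<in> {a..b}"
  shows "0 \<le> z t"
proof (rule ccontr)
  assume neg: "\<not> 0 \<le> z t"
  let ?T = "{s \<in> {a..t}. 0 \<le> z s}"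
  have cont: "continuous_on {a..t} z"
    by (rule continuous_on_subset[OF has_real_derivative_within_imp_continuous_on[OF D]])
      (use t in auto)
  have "compact ?T"
    by (rule compact_superlevel_Icc[OF cont])
  moreover have "a \<in> ?T"
    using init t by auto
  ultimately obtain s0 where s0: "s0 \<in> ?T" and last: "\<And>s. s \<in> ?T \<Longrightarrow> s \<le> s0"
    using compact_attains_sup[of ?T] by blast
  have below: "z s < 0" if "s0 < s" "s \<le> t" for s
    using last[of s] s0 that by force
  let ?y = "\<lambda>s. exp (- K * s) * z s"
  have "?y s0 \<le> ?y t"
  proof (rule Icc_deriv_nonneg_imp_le[where S = "{a..b}" and z = ?y])
    show "s0 \<le> t" "{s0..t} \<subseteq> {a..b}"
      using s0 t by auto
    show "(?y has_real_derivative exp (- K * s) * (z' s - K * z s)) (at s within {a..b})"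
      if "s \<in> {a..b}" for s
      by (rule derivative_eq_intros D[OF that] refl)+ (simp add: algebra_simps)
    show "0 \<le> exp (- K * s) * (z' s - K * z s)" if "s0 < s" "s < t" for s
      using ineq[of s] below[of s] that s0 t by auto
  qed
  moreover have "0 \<le> ?y s0" "?y t < 0"
    using s0 neg by (auto simp: mult_pos_neg)
  ultimately show False by linarith
qed

text \<open>
  The function \<open>w\<close> stays above \<open>w t * exp (- K (s - t))\<close>, the solution of the extremal equation
  \<open>w' = - K w\<close> with the same value at \<open>t\<close>.
\<close>

lemma positivity_propagates:
  fixes w w' :: "real \<Rightarrow> real"
  assumes D: "\<And>s. s \<in> {0..L} \<Longrightarrow> (w has_real_derivative w' s) (at s within {0..L})"
    and ineq: "\<And>s. s \<in> {0..L} \<Longrightarrow> - K * \<bar>w s\<bar> \<le> w' s"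
    and K: "0 \<le> K" and t: "t \<in> {0..L}" "0 < w t" and s: "s \<in> {t..L}"
  shows "0 < w s"
proof -
  define e where "e s = w t * exp (- K * (s - t))" for s
  have e: "0 < e s" for s
    using t by (simp add: e_def)
  have "0 \<le> w s - e s"
  proof (rule nonneg_barrier[where z = "\<lambda>s. w s - e s" and z' = "\<lambda>s. w' s + K * e s"
        and a = t and b = L and K = K])
    fix x assume x: "x \<in> {t..L}"
    have "(w has_real_derivative w' x) (at x within {t..L})"
      using x t by (intro DERIV_subset[OF D]) auto
    then show "((\<lambda>s. w s - e s) has_real_derivative w' x + K * e x) (at x within {t..L})"
      unfolding e_def by (auto intro!: derivative_eq_intros)
    assume neg: "w x - e x < 0"
    have *: "- K * \<bar>w x\<bar> \<le> w' x"
      using x t by (intro ineq) auto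
    have "K * (w x - e x) \<le> - K * \<bar>w x\<bar> + K * e x"
    proof -
      have "K * (w x - e x + \<bar>w x\<bar> - e x) \<le> 0"
        using K neg e[of x] by (intro mult_nonneg_nonpos) (auto simp: abs_if)
      then show ?thesis by (simp add: algebra_simps)
    qed
    with * show "K * (w x - e x) \<le> w' x + K * e x" by linarith
  qed (use s t in \<open>auto simp: e_def\<close>)
  with e[of s] show ?thesis by linarith
qed

text \<open>
  This is the one-dimensional Hopf lemma: if \<open>w\<close> were negative at the end, then by
  \<open>positivity_propagates\<close> it could never have been positive, contradicting the sign of its
  integral.
\<close>

lemma end_value_of_nonneg_integral:
  fixes w w' :: "real \<Rightarrow> real"
  assumes L: "0 < L"
    and D: "\<And>s. s \<in> {0..L} \<Longrightarrow> (w has_real_derivative w' s) (at s within {0..L})"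
    and ineq: "\<And>s. s \<in> {0..L} \<Longrightarrow> \<delta> - K * \<bar>w s\<bar> \<le> w' s"
    and K: "0 \<le> K" and \<delta>: "0 \<le> \<delta>" and int: "0 \<le> integral {0..L} w"
  shows "0 \<le> w L" and "w L = 0 \<Longrightarrow> \<delta> = 0 \<and> (\<forall>s\<in>{0..L}. w s = 0)"
proof -
  have ineq': "- K * \<bar>w s\<bar> \<le> w' s" if "s \<in> {0..L}" for s
    using ineq[OF that] \<delta> by simp
  have "0 < w L \<or> (\<delta> = 0 \<and> (\<forall>s\<in>{0..L}. w s = 0))"
  proof (cases "\<exists>t\<in>{0..L}. 0 < w t")
    case True
    then show ?thesis
      using positivity_propagates[OF D ineq' K] by force
  next
    case False
    have cont: "continuous_on {0..L} (\<lambda>s. - w s)"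
      using has_real_derivative_within_imp_continuous_on[OF D] by (intro continuous_intros)
    have "0 \<le> integral {0..L} (\<lambda>s. - w s)"
      using False by (intro integral_nonneg integrable_continuous_interval cont) force
    with int have "integral {0..L} (\<lambda>s. - w s) = 0"
      by simp
    then have zero: "w s = 0" if "s \<in> {0..L}" for s
      using integral_eq_0_iff[OF cont L] False that by force
    have "((\<lambda>s. 0) has_real_derivative w' (L/2)) (at (L/2) within {0..L})"
      by (rule has_field_derivative_transform_within[OF D zero_less_one]) (use L zero in auto)
    then have "w' (L/2) = 0"
      using L by (simp add: at_within_Icc_at) (metis DERIV_const DERIV_unique)
    with ineq[of "L/2"] zero[of "L/2"] L \<delta> have "\<delta> = 0"
      by simp
    with zero show ?thesis by simp
  qed
  then show "0 \<le> w L" and "w L = 0 \<Longrightarrow> \<delta> = 0 \<and> (\<forall>s\<in>{0..L}. w s = 0)"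
    using L by auto
qed

text \<open>
  Passing from \<open>w s\<close> to \<open>- w (L - s)\<close> exchanges the two end points and preserves inequalities of the
  form \<open>w' \<ge> g (|w|)\<close>, so only one of the two end points needs a proof.
\<close>

lemma reflected_derivative:
  fixes w :: "real \<Rightarrow> real"
  assumes "(w has_real_derivative d) (at (L - s) within {0..L})"
  shows "((\<lambda>s. - w (L - s)) has_real_derivative d) (at s within {0..L})"
proof -
  have im: "(\<lambda>s. L - s) ` {0..L} = {0..L}"
    by (auto simp: image_iff intro!: bexI[of _ "L - _"])
  have "(w \<circ> (\<lambda>s. L - s) has_real_derivative d * (- 1)) (at s within {0..L})"
    by (rule DERIV_image_chain) (use assms im in \<open>auto intro!: derivative_eq_intros\<close>)
  then have "((\<lambda>s. - (w \<circ> (\<lambda>s. L - s)) s) has_real_derivative - (d * (- 1))) (at s within {0..L})"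
    by (rule DERIV_minus)
  then show ?thesis by simp
qed

lemma reflected_integral:
  "integral {0..L} (\<lambda>s. - w (L - s)) = - integral {0..L} (w :: real \<Rightarrow> real)"
proof -
  have "integral {0..L} (\<lambda>s. w (L - s)) = integral {- L..0} (\<lambda>s. w (L + s))"
    using Henstock_Kurzweil_Integration.integral_reflect_real[of 0 "- L" "\<lambda>s. w (L + s)"] by simp
  also have "\<dots> = integral {0..L} w"
    using integral_shift_Icc_real[of "- L" 0 w L] by (simp add: o_def add.commute)
  finally have "integral {0..L} (\<lambda>s. w (L - s)) = integral {0..L} w" .
  then show ?thesis by simp
qed

lemma start_value_of_nonpos_integral:
  fixes w w' :: "real \<Rightarrow> real"
  assumes L: "0 < L"
    and D: "\<And>s. s \<in> {0..L} \<Longrightarrow> (w has_real_derivative w' s) (at s within {0..L})"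
    and ineq: "\<And>s. s \<in> {0..L} \<Longrightarrow> \<delta> - K * \<bar>w s\<bar> \<le> w' s"
    and K: "0 \<le> K" and \<delta>: "0 \<le> \<delta>" and int: "integral {0..L} w \<le> 0"
  shows "w 0 \<le> 0" and "w 0 = 0 \<Longrightarrow> \<delta> = 0 \<and> (\<forall>s\<in>{0..L}. w s = 0)"
proof -
  let ?z = "\<lambda>s. - w (L - s)"
  have Dz: "(?z has_real_derivative w' (L - s)) (at s within {0..L})" if "s \<in> {0..L}" for s
    by (rule reflected_derivative) (use D that in auto)
  have iz: "\<delta> - K * \<bar>?z s\<bar> \<le> w' (L - s)" if "s \<in> {0..L}" for s
    using ineq[of "L - s"] that by auto
  have intz: "0 \<le> integral {0..L} ?z"
    using int by (simp only: reflected_integral)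
  note * = end_value_of_nonneg_integral[OF L Dz iz K \<delta> intz]
  show "w 0 \<le> 0" using *(1) by simp
  assume "w 0 = 0"
  with *(2) have "\<delta> = 0" and z: "\<forall>s\<in>{0..L}. w (L - s) = 0" by auto
  moreover have "w s = 0" if "s \<in> {0..L}" for s
    using z[rule_format, of "L - s"] that by simp
  ultimately show "\<delta> = 0 \<and> (\<forall>s\<in>{0..L}. w s = 0)" by blast
qed

text \<open>Gronwall's inequality, with \<open>exp (K s) (A + B s)\<close> as an upper barrier for \<open>v1 - v2\<close>.\<close>

lemma gronwall_one_sided:
  fixes v1 v2 :: "real \<Rightarrow> real"
  assumes D1: "\<And>s. s \<in> {0..L} \<Longrightarrow> (v1 has_real_derivative d1 s) (at s within {0..L})"
    and D2: "\<And>s. s \<in> {0..L} \<Longrightarrow> (v2 has_real_derivative d2 s) (at s within {0..L})"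
    and ineq: "\<And>s. s \<in> {0..L} \<Longrightarrow> \<bar>d1 s - d2 s\<bar> \<le> K * \<bar>v1 s - v2 s\<bar> + B"
    and K: "0 \<le> K" and B: "0 \<le> B" and s: "s \<in> {0..L}"
  shows "v1 s - v2 s \<le> exp (K * L) * (\<bar>v1 0 - v2 0\<bar> + B * L)"
proof -
  define A where "A = \<bar>v1 0 - v2 0\<bar>"
  define z where "z s = exp (K * s) * (A + B * s) - (v1 s - v2 s)" for s
  define z' where "z' s = K * exp (K * s) * (A + B * s) + exp (K * s) * B - (d1 s - d2 s)" for s
  have "0 \<le> z s"
  proof (rule nonneg_barrier[where a = 0 and b = L and K = K and z = z and z' = z'])
    fix x assume x: "x \<in> {0..L}"
    show "(z has_real_derivative z' x) (at x within {0..L})"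
      unfolding z_def z'_def
      by (rule derivative_eq_intros D1[OF x] D2[OF x] refl)+ (simp add: algebra_simps)
    assume neg: "z x < 0"
    have "0 \<le> exp (K * x) * (A + B * x)"
      using x B by (simp add: A_def)
    with neg have "0 \<le> v1 x - v2 x"
      by (simp add: z_def)
    with ineq[OF x] have *: "d1 x - d2 x \<le> K * (v1 x - v2 x) + B"
      by simp
    have "B * 1 \<le> B * exp (K * x)"
      using x K B by (intro mult_left_mono) auto
    with * show "K * z x \<le> z' x"
      by (simp add: z_def z'_def algebra_simps)
  qed (use s in \<open>auto simp: z_def A_def\<close>)
  then have "v1 s - v2 s \<le> exp (K * s) * (A + B * s)"
    by (simp add: z_def)
  also have "\<dots> \<le> exp (K * L) * (A + B * L)"
    using s K B by (intro mult_mono add_mono mult_left_mono) (auto simp: A_def intro!: mult_left_mono)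
  finally show ?thesis by (simp add: A_def)
qed

lemma gronwall:
  fixes v1 v2 :: "real \<Rightarrow> real"
  assumes D1: "\<And>s. s \<in> {0..L} \<Longrightarrow> (v1 has_real_derivative d1 s) (at s within {0..L})"
    and D2: "\<And>s. s \<in> {0..L} \<Longrightarrow> (v2 has_real_derivative d2 s) (at s within {0..L})"
    and ineq: "\<And>s. s \<in> {0..L} \<Longrightarrow> \<bar>d1 s - d2 s\<bar> \<le> K * \<bar>v1 s - v2 s\<bar> + B"
    and K: "0 \<le> K" and B: "0 \<le> B" and s: "s \<in> {0..L}"
  shows "\<bar>v1 s - v2 s\<bar> \<le> exp (K * L) * (\<bar>v1 0 - v2 0\<bar> + B * L)"
proof -
  have *: "\<bar>d2 s - d1 s\<bar> \<le> K * \<bar>v2 s - v1 s\<bar> + B" if "s \<in> {0..L}" for s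
    using ineq[OF that] by (simp add: abs_minus_commute)
  show ?thesis
    using gronwall_one_sided[OF D1 D2 ineq K B s] gronwall_one_sided[OF D2 D1 * K B s]
    by (simp add: abs_minus_commute)
qed

text \<open>
  Superlinear growth makes large solutions blow up. Where \<open>c v^q \<ge> 2 C\<close>, the function
  \<open>v powr (1 - q)\<close> decreases at least with slope \<open>(q - 1) c / 2\<close>; so it cannot stay positive on
  all of \<open>[0, L]\<close> if it is smaller than \<open>(q - 1) c L / 2\<close> at the start. Hence the bound depends
  on the growth constants and on \<open>L\<close> only.
\<close>

lemma coercive_start_bound:
  fixes c q C L :: real
  assumes c: "0 < c" and q: "1 < q" and L: "0 < L"
  obtains K where "\<And>v v'. (\<And>s. s \<in> {0..L} \<Longrightarrow> (v has_real_derivative v' s) (at s within {0..L}))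
    \<Longrightarrow> (\<And>s. s \<in> {0..L} \<Longrightarrow> c * \<bar>v s\<bar> powr q - C \<le> v' s) \<Longrightarrow> v 0 \<le> (K :: real)"
proof -
  define \<epsilon> where "\<epsilon> = (q - 1) * (c / 2) * L"
  have "0 < \<epsilon>" using c q L by (simp add: \<epsilon>_def)
  have "((\<lambda>K. K powr (1 - q)) \<longlongrightarrow> (0::real)) at_top"
    by (rule tendsto_neg_powr) (use q in \<open>auto intro: filterlim_ident\<close>)
  then have "\<forall>\<^sub>F K in at_top. (K::real) powr (1 - q) < \<epsilon>"
    using \<open>0 < \<epsilon>\<close> by (rule order_tendstoD)
  moreover have "\<forall>\<^sub>F K in at_top. (1::real) \<le> K"
    and "\<forall>\<^sub>F K in at_top. 2 * C / c \<le> (K::real)"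
    by (rule eventually_ge_at_top)+
  ultimately have "\<forall>\<^sub>F K in at_top. (K::real) powr (1 - q) < \<epsilon> \<and> 1 \<le> K \<and> 2 * C / c \<le> K"
    by eventually_elim auto
  then obtain K where K: "K powr (1 - q) < \<epsilon>" "1 \<le> K" "2 * C / c \<le> K"
    using eventually_happens' trivial_limit_at_top_linorder by blast
  have large: "c / 2 * x powr q \<le> c * x powr q - C" if "K \<le> x" for x
  proof -
    have "2 * C / c \<le> x powr q"
      using powr_mono[of 1 q x] K that q by auto
    then show ?thesis
      using c by (simp add: field_simps)
  qed
  show ?thesis
  proof (rule that[of K], rule ccontr)
    fix v v' :: "real \<Rightarrow> real"
    assume D: "\<And>s. s \<in> {0..L} \<Longrightarrow> (v has_real_derivative v' s) (at s within {0..L})"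
      and ineq: "\<And>s. s \<in> {0..L} \<Longrightarrow> c * \<bar>v s\<bar> powr q - C \<le> v' s"
      and "\<not> v 0 \<le> K"
    then have v0: "K < v 0" by simp
    have cont: "continuous_on {0..L} v"
      by (rule has_real_derivative_within_imp_continuous_on[OF D])
    have growth: "c / 2 * v s powr q \<le> v' s" if "s \<in> {0..L}" "K \<le> v s" for s
      using ineq[OF that(1)] large[OF that(2)] that K by simp
    have above: "K < v s" if s: "s \<in> {0..L}" for s
    proof (rule ccontr)
      assume "\<not> K < v s"
      let ?T = "{s \<in> {0..L}. v s \<le> K}"
      have "compact ?T"
        using compact_superlevel_Icc[of 0 L "\<lambda>s. K - v s"] cont
        by (simp add: continuous_on_diff)
      moreover have "s \<in> ?T"
        using \<open>\<not> K < v s\<close> s by auto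
      ultimately obtain s1 where s1: "s1 \<in> ?T" and first: "\<And>s. s \<in> ?T \<Longrightarrow> s1 \<le> s"
        using compact_attains_inf[of ?T] by blast
      have "v 0 \<le> v s1"
      proof (rule Icc_deriv_nonneg_imp_le[where S = "{0..L}" and z = v and z' = v'])
        fix x assume x: "0 < x" "x < s1"
        then have "K \<le> v x"
          using first[of x] s1 by force
        then have "c / 2 * v x powr q \<le> v' x"
          using x s1 by (intro growth) auto
        moreover have "0 \<le> c / 2 * v x powr q"
          using c by simp
        ultimately show "0 \<le> v' x" by linarith
      qed (use s1 D in auto)
      with s1 v0 show False by auto
    qed
    let ?y = "\<lambda>s. - (v s powr (1 - q)) - (q - 1) * (c / 2) * s"
    have "?y 0 \<le> ?y L"
    proof (rule Icc_deriv_nonneg_imp_le[where S = "{0..L}" and z = ?y])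
      fix s assume s: "s \<in> {0..L}"
      have pos: "0 < v s" using above[OF s] K by simp
      show "(?y has_real_derivative (q - 1) * (v s powr (- q) * v' s - c / 2)) (at s within {0..L})"
        by (rule derivative_eq_intros D[OF s] refl pos)+
          (use pos in \<open>simp add: algebra_simps powr_diff powr_minus divide_simps\<close>)
    next
      fix s assume "0 < s" "s < L"
      then have s: "s \<in> {0..L}" by simp
      have pos: "0 < v s" using above[OF s] K by simp
      have "v s powr (- q) * (c / 2 * v s powr q) \<le> v s powr (- q) * v' s"
        using growth[OF s] above[OF s] by (intro mult_left_mono) auto
      moreover have "v s powr (- q) * (c / 2 * v s powr q) = c / 2"
        using pos by (simp add: powr_minus)
      ultimately show "0 \<le> (q - 1) * (v s powr (- q) * v' s - c / 2)"
        using q by (intro mult_nonneg_nonneg) linarith+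
    qed (use L in auto)
    then have "v L powr (1 - q) + \<epsilon> \<le> v 0 powr (1 - q)"
      by (simp add: \<epsilon>_def)
    also have "\<dots> \<le> K powr (1 - q)"
      using v0 K q by (intro powr_mono2') auto
    also have "\<dots> < \<epsilon>" by (rule K(1))
    finally show False by (smt (verit) powr_ge_zero)
  qed
qed

lemma coercive_flux_bound:
  fixes c q C L :: real
  assumes "0 < c" and "1 < q" and "0 < L"
  obtains K where "\<And>v v'. (\<And>s. s \<in> {0..L} \<Longrightarrow> (v has_real_derivative v' s) (at s within {0..L}))
    \<Longrightarrow> (\<And>s. s \<in> {0..L} \<Longrightarrow> c * \<bar>v s\<bar> powr q - C \<le> v' s) \<Longrightarrow> v 0 \<le> (K :: real) \<and> - K \<le> v L"
proof -
  obtain K where K: "\<And>v v'. (\<And>s. s \<in> {0..L} \<Longrightarrow> (v has_real_derivative v' s) (at s within {0..L}))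
    \<Longrightarrow> (\<And>s. s \<in> {0..L} \<Longrightarrow> c * \<bar>v s\<bar> powr q - C \<le> v' s) \<Longrightarrow> v 0 \<le> (K :: real)"
    using coercive_start_bound[OF assms, of C] by blast
  show ?thesis
  proof (rule that[of K], rule conjI)
    fix v v' :: "real \<Rightarrow> real"
    assume D: "\<And>s. s \<in> {0..L} \<Longrightarrow> (v has_real_derivative v' s) (at s within {0..L})"
      and ineq: "\<And>s. s \<in> {0..L} \<Longrightarrow> c * \<bar>v s\<bar> powr q - C \<le> v' s"
    then show "v 0 \<le> K" by (rule K)
    have "- v (L - 0) \<le> K"
    proof (rule K)
      show "((\<lambda>s. - v (L - s)) has_real_derivative v' (L - s)) (at s within {0..L})"
        if "s \<in> {0..L}" for s
        by (rule reflected_derivative) (use D that in auto)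
      show "c * \<bar>- v (L - s)\<bar> powr q - C \<le> v' (L - s)" if "s \<in> {0..L}" for s
        using ineq[of "L - s"] that by simp
    qed
    then show "- K \<le> v L" by simp
  qed
qed

section \<open>Scalar ordinary differential equations on an interval\<close>

text \<open>The additive constant \<open>r\<close> is kept apart from \<open>f\<close> because it will carry the unknown \<open>\<rho>\<close>.\<close>

definition ode_sol :: "(real \<Rightarrow> real \<Rightarrow> real) \<Rightarrow> real \<Rightarrow> real \<Rightarrow> (real \<Rightarrow> real) \<Rightarrow> bool" where
  "ode_sol f r L v \<longleftrightarrow>
     (\<forall>s\<in>{0..L}. (v has_real_derivative f s (v s) + r) (at s within {0..L}))"

definition regular_rhs :: "(real \<Rightarrow> real \<Rightarrow> real) \<Rightarrow> real \<Rightarrow> bool" where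
  "regular_rhs f L \<longleftrightarrow>
     continuous_on ({0..L} \<times> UNIV) (\<lambda>(s, p). f s p) \<and>
     (\<forall>R. \<exists>K. \<forall>s\<in>{0..L}. \<forall>p q. \<bar>p\<bar> \<le> R \<longrightarrow> \<bar>q\<bar> \<le> R \<longrightarrow> \<bar>f s p - f s q\<bar> \<le> K * \<bar>p - q\<bar>)"

lemma ode_solD:
  "ode_sol f r L v \<Longrightarrow> s \<in> {0..L} \<Longrightarrow>
    (v has_real_derivative f s (v s) + r) (at s within {0..L})"
  by (simp add: ode_sol_def)

lemma ode_sol_continuous: "ode_sol f r L v \<Longrightarrow> continuous_on {0..L} v"
  by (rule has_real_derivative_within_imp_continuous_on) (rule ode_solD)

lemma continuous_on_curried:
  fixes f :: "real \<Rightarrow> real \<Rightarrow> real"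
  assumes "continuous_on ({0..L} \<times> UNIV) (\<lambda>(s, p). f s p)" and "continuous_on {0..L} v"
  shows "continuous_on {0..L} (\<lambda>s. f s (v s))"
proof -
  have "continuous_on {0..L} (\<lambda>s. (\<lambda>(s, p). f s p) (s, v s))"
    by (rule continuous_on_compose2[OF assms(1)]) (use assms(2) in \<open>auto intro!: continuous_intros\<close>)
  then show ?thesis by simp
qed

text \<open>
  The substitution \<open>v s = exp (2 K s) w s\<close> turns the integral equation for \<open>v\<close> into a fixed point
  problem for a map that has Lipschitz constant \<open>1/2\<close> on the whole interval, whatever its length;
  so no gluing of local solutions is needed. Functions on \<open>[0, L]\<close> are extended to the line by
  their end values in order to use the Banach space of bounded continuous functions.
\<close>

lemma lipschitz_ode_exists:
  fixes f :: "real \<Rightarrow> real \<Rightarrow> real"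
  assumes L: "0 \<le> L" and K: "0 < K"
    and cont: "continuous_on ({0..L} \<times> UNIV) (\<lambda>(s, p). f s p)"
    and lip: "\<And>s p q. s \<in> {0..L} \<Longrightarrow> \<bar>f s p - f s q\<bar> \<le> K * \<bar>p - q\<bar>"
  obtains v where "v 0 = c" and "ode_sol f r L v"
proof -
  define g where "g w x = f x (exp (2 * K * x) * w x) + r" for w :: "real \<Rightarrow> real" and x
  define \<Phi> where "\<Phi> w s = exp (- 2 * K * s) * (c + integral {0..s} (g w))" for w s
  define cl where "cl s = max 0 (min L s)" for s
  have cl: "cl s \<in> {0..L}" for s
    using L by (auto simp: cl_def)
  have cont_g: "continuous_on {0..L} (g w)" if "continuous_on {0..L} w" for w
    unfolding g_def by (intro continuous_intros continuous_on_curried[OF cont] that)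
  have int_g: "g w integrable_on {0..s}" if "continuous_on {0..L} w" "s \<in> {0..L}" for w s
    by (rule integrable_continuous_interval, rule continuous_on_subset[OF cont_g[OF that(1)]])
      (use that in auto)
  have cont_\<Phi>: "continuous_on {0..L} (\<Phi> w)" if "continuous_on {0..L} w" for w
    unfolding \<Phi>_def using int_g[OF that, of L] L
    by (intro continuous_intros indefinite_integral_continuous_1) auto
  have bcont: "(\<lambda>s. \<Phi> (apply_bcontfun w) (cl s)) \<in> bcontfun" for w :: "real \<Rightarrow>\<^sub>C real"
  proof -
    have c\<Phi>: "continuous_on {0..L} (\<Phi> (apply_bcontfun w))"
      by (rule cont_\<Phi>) simp
    have "continuous_on UNIV (\<lambda>s. \<Phi> (apply_bcontfun w) (cl s))"
      by (rule continuous_on_compose2[OF c\<Phi>]) (use cl in \<open>auto simp: cl_def intro!: continuous_intros\<close>)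
    moreover have "bounded (range (\<lambda>s. \<Phi> (apply_bcontfun w) (cl s)))"
      by (rule bounded_subset[OF compact_imp_bounded[OF compact_continuous_image[OF c\<Phi>]]])
        (use cl in auto)
    ultimately show ?thesis
      by (simp add: bcontfun_def)
  qed
  define T where "T w = Bcontfun (\<lambda>s. \<Phi> (apply_bcontfun w) (cl s))" for w
  have T: "apply_bcontfun (T w) s = \<Phi> (apply_bcontfun w) (cl s)" for w s
    by (simp add: T_def Bcontfun_inverse[OF bcont])
  have contraction: "dist (T w1) (T w2) \<le> 1/2 * dist w1 w2" for w1 w2 :: "real \<Rightarrow>\<^sub>C real"
  proof (rule dist_bound)
    fix s0 :: real
    define s where "s = cl s0"
    define d where "d = dist w1 w2"
    have s: "s \<in> {0..L}" by (simp only: s_def cl)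
    have bd: "\<bar>apply_bcontfun w1 x - apply_bcontfun w2 x\<bar> \<le> d" for x
      using dist_bounded[of w1 x w2] by (simp add: d_def dist_real_def)
    have FTC: "((\<lambda>x. K * (exp (2 * K * x) * d)) has_integral
        exp (2 * K * s) * d / 2 - exp (2 * K * 0) * d / 2) {0..s}"
      by (rule fundamental_theorem_of_calculus)
        (use s K in \<open>auto intro!: derivative_eq_intros simp: has_real_derivative_iff_has_vector_derivative[symmetric]\<close>)
    have "\<bar>integral {0..s} (\<lambda>x. g w1 x - g w2 x)\<bar> \<le> integral {0..s} (\<lambda>x. K * (exp (2 * K * x) * d))"
    proof -
      have "norm (integral {0..s} (\<lambda>x. g w1 x - g w2 x)) \<le> integral {0..s} (\<lambda>x. K * (exp (2 * K * x) * d))"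
      proof (rule integral_norm_bound_integral)
        show "(\<lambda>x. g w1 x - g w2 x) integrable_on {0..s}"
          by (intro integrable_diff int_g s) auto
        show "(\<lambda>x. K * (exp (2 * K * x) * d)) integrable_on {0..s}"
          using FTC by blast
        fix x assume "x \<in> {0..s}"
        then have x: "x \<in> {0..L}" using s by auto
        have "\<bar>g w1 x - g w2 x\<bar> \<le> K * \<bar>exp (2 * K * x) * w1 x - exp (2 * K * x) * w2 x\<bar>"
          using lip[OF x] by (simp add: g_def)
        also have "\<dots> = K * (exp (2 * K * x) * \<bar>w1 x - w2 x\<bar>)"
          by (simp add: abs_mult flip: right_diff_distrib)
        also have "\<dots> \<le> K * (exp (2 * K * x) * d)"
          using K bd by (intro mult_left_mono) auto
        finally show "norm (g w1 x - g w2 x) \<le> K * (exp (2 * K * x) * d)" by simp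
      qed
      then show ?thesis by simp
    qed
    also have "\<dots> = exp (2 * K * s) * d / 2 - d / 2"
      using integral_unique[OF FTC] by simp
    finally have I: "\<bar>integral {0..s} (\<lambda>x. g w1 x - g w2 x)\<bar> \<le> exp (2 * K * s) * (d / 2)"
      using bd[of 0] by linarith
    have "\<bar>\<Phi> w1 s - \<Phi> w2 s\<bar> = exp (- 2 * K * s) * \<bar>integral {0..s} (g w1) - integral {0..s} (g w2)\<bar>"
      by (simp add: \<Phi>_def abs_mult flip: right_diff_distrib)
    also have "\<dots> = exp (- 2 * K * s) * \<bar>integral {0..s} (\<lambda>x. g w1 x - g w2 x)\<bar>"
      by (subst integral_diff) (auto intro!: int_g s)
    also have "\<dots> \<le> exp (- 2 * K * s) * (exp (2 * K * s) * (d / 2))"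
      using I by (intro mult_left_mono) auto
    also have "\<dots> = d / 2"
      by (simp add: exp_minus)
    finally show "dist (T w1 s0) (T w2 s0) \<le> 1/2 * dist w1 w2"
      by (simp add: T s_def d_def dist_real_def)
  qed
  obtain w where w: "T w = w"
    using banach_fix_type[of "1/2" T] contraction by auto
  define v where "v s = exp (2 * K * s) * apply_bcontfun w s" for s
  have v: "v s = c + integral {0..s} (\<lambda>x. f x (v x) + r)" if "s \<in> {0..L}" for s
  proof -
    have "cl s = s" using that by (auto simp: cl_def)
    then have "apply_bcontfun w s = \<Phi> w s"
      using T[of w s] w by simp
    moreover have "exp (2 * K * s) * \<Phi> w s = c + integral {0..s} (g w)"
      by (simp add: \<Phi>_def exp_minus)
    ultimately show ?thesis
      by (simp add: v_def g_def[abs_def])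
  qed
  have cont_v: "continuous_on {0..L} v"
    unfolding v_def by (intro continuous_intros) auto
  show ?thesis
  proof (rule that)
    show "v 0 = c"
      using v[of 0] L by simp
    show "ode_sol f r L v"
      unfolding ode_sol_def
    proof
      fix s assume s: "s \<in> {0..L}"
      have "((\<lambda>s. c + integral {0..s} (\<lambda>x. f x (v x) + r)) has_real_derivative 0 + (f s (v s) + r))
          (at s within {0..L})"
        by (intro DERIV_add DERIV_const integral_has_real_derivative continuous_intros
            continuous_on_curried[OF cont] cont_v s)
      then show "(v has_real_derivative f s (v s) + r) (at s within {0..L})"
        using has_field_derivative_transform_within[OF _ zero_less_one s] v by fastforce
    qed
  qed
qed

text \<open>
  Solutions of a regular equation that are bounded by \<open>R\<close> are studied through the globally
  Lipschitz equation obtained by freezing the right-hand side outside \<open>[-R, R]\<close>.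
\<close>

definition truncate_rhs :: "real \<Rightarrow> (real \<Rightarrow> real \<Rightarrow> real) \<Rightarrow> real \<Rightarrow> real \<Rightarrow> real" where
  "truncate_rhs R f s p = f s (max (- R) (min R p))"

lemma truncate_rhs_eq: "\<bar>p\<bar> \<le> R \<Longrightarrow> truncate_rhs R f s p = f s p"
  by (cases "p = R"; cases "p = - R") (auto simp: truncate_rhs_def min_def max_def abs_le_iff)

lemma ode_sol_truncate:
  assumes "\<And>s. s \<in> {0..L} \<Longrightarrow> \<bar>v s\<bar> \<le> R"
  shows "ode_sol (truncate_rhs R f) r L v \<longleftrightarrow> ode_sol f r L v"
  using assms by (simp add: ode_sol_def truncate_rhs_eq)

lemma truncate_rhs_continuous:
  assumes "regular_rhs f L"
  shows "continuous_on ({0..L} \<times> UNIV) (\<lambda>(s, p). truncate_rhs R f s p)"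
proof -
  have c: "continuous_on ({0..L} \<times> UNIV) (\<lambda>(s, p). f s p)"
    using assms by (simp add: regular_rhs_def)
  have "continuous_on ({0..L} \<times> UNIV) (\<lambda>x. (\<lambda>(s, p). f s p) (fst x, max (- R) (min R (snd x))))"
    by (rule continuous_on_compose2[OF c]) (auto intro!: continuous_intros)
  then show ?thesis
    by (simp add: truncate_rhs_def case_prod_beta)
qed

lemma truncate_rhs_lipschitz:
  assumes "regular_rhs f L" and "0 \<le> R"
  obtains K where "0 < K"
    and "\<And>s p q. s \<in> {0..L} \<Longrightarrow> \<bar>truncate_rhs R f s p - truncate_rhs R f s q\<bar> \<le> K * \<bar>p - q\<bar>"
proof -
  obtain K where K: "\<And>s p q. s \<in> {0..L} \<Longrightarrow> \<bar>p\<bar> \<le> R \<Longrightarrow> \<bar>q\<bar> \<le> R \<Longrightarrow>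
      \<bar>f s p - f s q\<bar> \<le> K * \<bar>p - q\<bar>"
    using assms(1) unfolding regular_rhs_def by meson
  show ?thesis
  proof (rule that[of "\<bar>K\<bar> + 1"])
    fix s p q :: real assume s: "s \<in> {0..L}"
    let ?p = "max (- R) (min R p)" and ?q = "max (- R) (min R q)"
    have "\<bar>f s ?p - f s ?q\<bar> \<le> K * \<bar>?p - ?q\<bar>"
      by (rule K) (use s assms(2) in auto)
    also have "\<dots> \<le> (\<bar>K\<bar> + 1) * \<bar>p - q\<bar>"
      using assms(2) by (intro mult_mono) auto
    finally show "\<bar>truncate_rhs R f s p - truncate_rhs R f s q\<bar> \<le> (\<bar>K\<bar> + 1) * \<bar>p - q\<bar>"
      by (simp add: truncate_rhs_def)
  qed auto
qed

lemma ode_sol_gronwall: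
  assumes lip: "\<And>s p q. s \<in> {0..L} \<Longrightarrow> \<bar>f s p - f s q\<bar> \<le> K * \<bar>p - q\<bar>" and K: "0 \<le> K"
    and "ode_sol f r1 L v1" and "ode_sol f r2 L v2" and "s \<in> {0..L}"
  shows "\<bar>v1 s - v2 s\<bar> \<le> exp (K * L) * (\<bar>v1 0 - v2 0\<bar> + \<bar>r1 - r2\<bar> * L)"
proof (rule gronwall[OF ode_solD[OF assms(3)] ode_solD[OF assms(4)] _ K _ assms(5)])
  fix s assume "s \<in> {0..L}"
  from lip[OF this, of "v1 s" "v2 s"]
  show "\<bar>f s (v1 s) + r1 - (f s (v2 s) + r2)\<bar> \<le> K * \<bar>v1 s - v2 s\<bar> + \<bar>r1 - r2\<bar>"
    by linarith
qed auto

lemma truncate_rhs_regular: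
  assumes "regular_rhs f L" and "0 \<le> R"
  shows "regular_rhs (truncate_rhs R f) L"
proof -
  obtain K where "\<And>s p q. s \<in> {0..L} \<Longrightarrow>
      \<bar>truncate_rhs R f s p - truncate_rhs R f s q\<bar> \<le> K * \<bar>p - q\<bar>"
    using truncate_rhs_lipschitz[OF assms] by metis
  with truncate_rhs_continuous[OF assms(1)] show ?thesis
    unfolding regular_rhs_def by metis
qed

lemma lipschitz_along:
  assumes f: "regular_rhs f L" and "continuous_on {0..L} v1" and "continuous_on {0..L} v2"
  obtains K where "0 \<le> K"
    and "\<And>s. s \<in> {0..L} \<Longrightarrow> \<bar>f s (v1 s) - f s (v2 s)\<bar> \<le> K * \<bar>v1 s - v2 s\<bar>"
proof -
  obtain R1 R2 where R: "\<And>s. s \<in> {0..L} \<Longrightarrow> \<bar>v1 s\<bar> \<le> R1" "\<And>s. s \<in> {0..L} \<Longrightarrow> \<bar>v2 s\<bar> \<le> R2"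
    using continuous_on_Icc_bounded[OF assms(2)] continuous_on_Icc_bounded[OF assms(3)] by metis
  obtain K where K: "\<And>s p q. s \<in> {0..L} \<Longrightarrow> \<bar>p\<bar> \<le> max R1 R2 \<Longrightarrow> \<bar>q\<bar> \<le> max R1 R2 \<Longrightarrow>
      \<bar>f s p - f s q\<bar> \<le> K * \<bar>p - q\<bar>"
    using f unfolding regular_rhs_def by meson
  show ?thesis
  proof (rule that[of "\<bar>K\<bar>"])
    fix s assume s: "s \<in> {0..L}"
    then have "\<bar>f s (v1 s) - f s (v2 s)\<bar> \<le> K * \<bar>v1 s - v2 s\<bar>"
      using R[OF s] by (intro K) auto
    also have "\<dots> \<le> \<bar>K\<bar> * \<bar>v1 s - v2 s\<bar>"
      by (intro mult_right_mono) auto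
    finally show "\<bar>f s (v1 s) - f s (v2 s)\<bar> \<le> \<bar>K\<bar> * \<bar>v1 s - v2 s\<bar>" .
  qed auto
qed

text \<open>
  The solution with starting value \<open>c\<close> of the truncated equation depends on \<open>c\<close> and on \<open>r\<close> in a
  Lipschitz way, uniformly on \<open>[0, L]\<close>.
\<close>

lemma truncated_flow:
  assumes f: "regular_rhs f L" and L: "0 \<le> L" and R: "0 \<le> R"
  obtains K M \<phi> where "0 < K" and "0 < M"
    and "\<And>s p q. s \<in> {0..L} \<Longrightarrow> \<bar>truncate_rhs R f s p - truncate_rhs R f s q\<bar> \<le> K * \<bar>p - q\<bar>"
    and "\<And>c r. \<phi> c r 0 = c" and "\<And>c r. ode_sol (truncate_rhs R f) r L (\<phi> c r)"
    and "\<And>r r' v c s. ode_sol (truncate_rhs R f) r L v \<Longrightarrow> s \<in> {0..L} \<Longrightarrow>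
      \<bar>\<phi> c r' s - v s\<bar> \<le> M * (\<bar>c - v 0\<bar> + \<bar>r' - r\<bar>)"
    and "\<And>c c' r r'. \<bar>integral {0..L} (\<phi> c r) - integral {0..L} (\<phi> c' r')\<bar>
      \<le> L * M * (\<bar>c - c'\<bar> + \<bar>r - r'\<bar>)"
proof -
  obtain K where K: "0 < K" and lip: "\<And>s p q. s \<in> {0..L} \<Longrightarrow>
      \<bar>truncate_rhs R f s p - truncate_rhs R f s q\<bar> \<le> K * \<bar>p - q\<bar>"
    using truncate_rhs_lipschitz[OF f R] by blast
  have "\<exists>v. v 0 = c \<and> ode_sol (truncate_rhs R f) r L v" for c r
    by (rule lipschitz_ode_exists[OF L K truncate_rhs_continuous[OF f] lip]) auto
  then obtain \<phi> where \<phi>: "\<And>c r. \<phi> c r 0 = c" "\<And>c r. ode_sol (truncate_rhs R f) r L (\<phi> c r)"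
    by metis
  define M where "M = exp (K * L) * (1 + L)"
  have close: "\<bar>\<phi> c r' s - v s\<bar> \<le> M * (\<bar>c - v 0\<bar> + \<bar>r' - r\<bar>)"
    if v: "ode_sol (truncate_rhs R f) r L v" and s: "s \<in> {0..L}" for r r' v c s
  proof -
    have "\<bar>\<phi> c r' s - v s\<bar> \<le> exp (K * L) * (\<bar>\<phi> c r' 0 - v 0\<bar> + \<bar>r' - r\<bar> * L)"
      by (rule ode_sol_gronwall[OF lip _ \<phi>(2) v s]) (use K in auto)
    also have "\<dots> \<le> exp (K * L) * ((1 + L) * (\<bar>c - v 0\<bar> + \<bar>r' - r\<bar>))"
      using L by (intro mult_left_mono) (auto simp: \<phi> algebra_simps intro: mult_nonneg_nonneg)
    finally show ?thesis
      by (simp add: M_def mult.assoc)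
  qed
  have "\<bar>integral {0..L} (\<phi> c r) - integral {0..L} (\<phi> c' r')\<bar> \<le> L * M * (\<bar>c - c'\<bar> + \<bar>r - r'\<bar>)"
    for c c' r r'
  proof -
    have "norm (integral {0..L} (\<lambda>s. \<phi> c r s - \<phi> c' r' s)) \<le> M * (\<bar>c - c'\<bar> + \<bar>r - r'\<bar>) * (L - 0)"
      by (rule integral_bound)
        (use close[OF \<phi>(2)[of r' c'], of _ c r] L in
          \<open>auto simp: \<phi>(1) intro!: continuous_intros ode_sol_continuous[OF \<phi>(2)]\<close>)
    then show ?thesis
      by (simp add: integral_diff[OF integrable_continuous_interval integrable_continuous_interval]
          ode_sol_continuous[OF \<phi>(2)] algebra_simps)
  qed
  with K \<phi> lip close L show ?thesis
    by (intro that[of K M \<phi>]) (auto simp: M_def)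
qed

text \<open>The difference of two solutions of one equation falls under the Hopf lemma with \<open>\<delta> = 0\<close>.\<close>

lemma ode_sol_order:
  assumes f: "regular_rhs f L" and L: "0 < L"
    and v1: "ode_sol f r L v1" and v2: "ode_sol f r L v2"
  shows "integral {0..L} v1 \<le> integral {0..L} v2 \<Longrightarrow> v1 0 \<le> v2 0 \<and> v1 L \<le> v2 L"
    and "integral {0..L} v1 < integral {0..L} v2 \<Longrightarrow> v1 0 < v2 0 \<and> v1 L < v2 L"
proof -
  obtain K where K: "0 \<le> K"
    and ineq: "\<And>s. s \<in> {0..L} \<Longrightarrow> \<bar>f s (v1 s) - f s (v2 s)\<bar> \<le> K * \<bar>v1 s - v2 s\<bar>"
    by (rule lipschitz_along[OF f ode_sol_continuous[OF v1] ode_sol_continuous[OF v2]])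
      (rule that; assumption)
  have ineq1: "0 - K * \<bar>v1 s - v2 s\<bar> \<le> f s (v1 s) + r - (f s (v2 s) + r)"
    and ineq2: "0 - K * \<bar>v2 s - v1 s\<bar> \<le> f s (v2 s) + r - (f s (v1 s) + r)" if "s \<in> {0..L}" for s
    using ineq[OF that] by (simp_all add: abs_minus_commute abs_le_iff)
  have int: "integral {0..L} (\<lambda>s. v1 s - v2 s) = integral {0..L} v1 - integral {0..L} v2"
    "integral {0..L} (\<lambda>s. v2 s - v1 s) = integral {0..L} v2 - integral {0..L} v1"
    by (intro integral_diff integrable_continuous_interval ode_sol_continuous[OF v1]
        ode_sol_continuous[OF v2])+
  note start = start_value_of_nonpos_integral[OF L DERIV_diff[OF ode_solD[OF v1] ode_solD[OF v2]]
      ineq1 K order_refl]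
    and last = end_value_of_nonneg_integral[OF L DERIV_diff[OF ode_solD[OF v2] ode_solD[OF v1]]
      ineq2 K order_refl]
  show weak: "v1 0 \<le> v2 0 \<and> v1 L \<le> v2 L" if "integral {0..L} v1 \<le> integral {0..L} v2"
    using start(1) last(1) that by (simp add: int)
  assume *: "integral {0..L} v1 < integral {0..L} v2"
  have "v1 0 \<noteq> v2 0"
  proof
    assume "v1 0 = v2 0"
    with start(2) * have "\<forall>s\<in>{0..L}. v1 s - v2 s = 0" by (simp add: int)
    then have "integral {0..L} v1 = integral {0..L} v2" by (intro integral_cong) auto
    with * show False by simp
  qed
  moreover have "v1 L \<noteq> v2 L"
  proof
    assume "v1 L = v2 L"
    with last(2) * have "\<forall>s\<in>{0..L}. v2 s - v1 s = 0" by (simp add: int)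
    then have "integral {0..L} v1 = integral {0..L} v2" by (intro integral_cong) auto
    with * show False by simp
  qed
  ultimately show "v1 0 < v2 0 \<and> v1 L < v2 L"
    using weak * by simp
qed

text \<open>
  The solutions starting at \<open>v 0 - h\<close> and \<open>v 0 + h\<close> have integrals strictly below and above that
  of \<open>v\<close>, because distinct solutions do not cross; this strict inequality survives a small change
  of \<open>r\<close>, and the intermediate value theorem yields every nearby integral.
\<close>

lemma ode_sol_perturb:
  assumes f: "regular_rhs f L" and L: "0 < L" and v: "ode_sol f r L v" and \<epsilon>: "0 < \<epsilon>"
  obtains \<delta> where "0 < \<delta>"
    and "\<And>r' d'. \<bar>r' - r\<bar> < \<delta> \<Longrightarrow> \<bar>d' - integral {0..L} v\<bar> < \<delta> \<Longrightarrow>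
      \<exists>v'. ode_sol f r' L v' \<and> integral {0..L} v' = d' \<and> (\<forall>s\<in>{0..L}. \<bar>v' s - v s\<bar> < \<epsilon>)"
proof -
  obtain R0 where R0: "\<And>s. s \<in> {0..L} \<Longrightarrow> \<bar>v s\<bar> \<le> R0"
    using continuous_on_Icc_bounded[OF ode_sol_continuous[OF v]] by blast
  define R where "R = R0 + 1"
  have R: "0 \<le> R" "\<And>s. s \<in> {0..L} \<Longrightarrow> \<bar>v s\<bar> \<le> R - 1"
    using R0 order_trans[OF abs_ge_zero R0[of 0]] L by (auto simp: R_def)
  let ?f = "truncate_rhs R f"
  obtain K M \<phi> where K: "0 < K" and M: "0 < M"
    and lip: "\<And>s p q. s \<in> {0..L} \<Longrightarrow> \<bar>?f s p - ?f s q\<bar> \<le> K * \<bar>p - q\<bar>"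
    and \<phi>0: "\<And>c r. \<phi> c r 0 = c" and \<phi>: "\<And>c r. ode_sol ?f r L (\<phi> c r)"
    and \<phi>_lip: "\<And>r r' v c s. ode_sol ?f r L v \<Longrightarrow> s \<in> {0..L} \<Longrightarrow>
      \<bar>\<phi> c r' s - v s\<bar> \<le> M * (\<bar>c - v 0\<bar> + \<bar>r' - r\<bar>)"
    and int_lip: "\<And>c c' r r'. \<bar>integral {0..L} (\<phi> c r) - integral {0..L} (\<phi> c' r')\<bar>
      \<le> L * M * (\<bar>c - c'\<bar> + \<bar>r - r'\<bar>)"
    by (rule truncated_flow[OF f less_imp_le[OF L] R(1)]) (rule that; assumption)
  have fv: "ode_sol ?f r L v"
    using ode_sol_truncate[of L v R f r] R(2) v by force
  define I where "I c r' = integral {0..L} (\<phi> c r')" for c r'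
  have I_lip: "\<bar>I c r1 - I c' r2\<bar> \<le> L * M * (\<bar>c - c'\<bar> + \<bar>r1 - r2\<bar>)" for c c' r1 r2
    unfolding I_def by (rule int_lip)
  \<comment> \<open>Changing \<open>c\<close> and \<open>r\<close> by \<open>\<epsilon>'\<close> each moves solutions by less than \<open>\<epsilon>\<close>, and by less than \<open>1\<close>, so that they
    remain below the truncation level \<open>R\<close>.\<close>
  define \<epsilon>' where "\<epsilon>' = min \<epsilon> 1 / (2 * M)"
  have \<epsilon>': "0 < \<epsilon>'" and M\<epsilon>': "M * (2 * \<epsilon>') = min \<epsilon> 1"
    using \<epsilon> M by (auto simp: \<epsilon>'_def)
  have upper: "integral {0..L} v < I (v 0 + \<epsilon>') r"
    using ode_sol_order(1)[OF truncate_rhs_regular[OF f R(1)] L \<phi>[of r "v 0 + \<epsilon>'"] fv] \<epsilon>'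
    by (force simp: \<phi>0 I_def)
  have lower: "I (v 0 - \<epsilon>') r < integral {0..L} v"
    using ode_sol_order(1)[OF truncate_rhs_regular[OF f R(1)] L fv \<phi>[of r "v 0 - \<epsilon>'"]] \<epsilon>'
    by (force simp: \<phi>0 I_def)
  define g where "g = min (I (v 0 + \<epsilon>') r - integral {0..L} v) (integral {0..L} v - I (v 0 - \<epsilon>') r)"
  have g: "0 < g" using upper lower by (simp add: g_def)
  have g_le: "g \<le> I (v 0 + \<epsilon>') r - integral {0..L} v" "g \<le> integral {0..L} v - I (v 0 - \<epsilon>') r"
    by (simp_all add: g_def)
  define \<delta> where "\<delta> = min \<epsilon>' (min (g / 2) (g / (2 * (L * M))))"
  show ?thesis
  proof (rule that[of \<delta>])
    show "0 < \<delta>" using \<epsilon>' g L M by (simp add: \<delta>_def)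
    fix r' d' assume r': "\<bar>r' - r\<bar> < \<delta>" and d': "\<bar>d' - integral {0..L} v\<bar> < \<delta>"
    have "L * M * \<bar>r' - r\<bar> \<le> L * M * (g / (2 * (L * M)))"
      using r' L M by (intro mult_left_mono) (auto simp: \<delta>_def)
    also have "\<dots> = g / 2" using L M by simp
    finally have *: "\<bar>I c r' - I c r\<bar> \<le> g / 2" for c
      using I_lip[of c r' c r] by simp
    have "\<bar>d' - integral {0..L} v\<bar> < g / 2"
      using d' by (simp add: \<delta>_def)
    then have "I (v 0 - \<epsilon>') r' \<le> d'" "d' \<le> I (v 0 + \<epsilon>') r'"
      using *[of "v 0 - \<epsilon>'"] *[of "v 0 + \<epsilon>'"] g_le by linarith+
    moreover have "continuous_on {v 0 - \<epsilon>'..v 0 + \<epsilon>'} (\<lambda>c. I c r')"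
      by (rule lipschitz_on_continuous_on[of "L * M"])
        (use I_lip[of _ r' _ r'] L M in \<open>auto intro!: lipschitz_onI simp: dist_real_def\<close>)
    ultimately obtain c where c: "v 0 - \<epsilon>' \<le> c" "c \<le> v 0 + \<epsilon>'" "I c r' = d'"
      using IVT'[of "\<lambda>c. I c r'" "v 0 - \<epsilon>'" d' "v 0 + \<epsilon>'"] \<epsilon>' by auto
    have close: "\<bar>\<phi> c r' s - v s\<bar> < min \<epsilon> 1" if s: "s \<in> {0..L}" for s
    proof -
      have "\<bar>\<phi> c r' s - v s\<bar> \<le> M * (\<bar>c - v 0\<bar> + \<bar>r' - r\<bar>)"
        by (rule \<phi>_lip[OF fv s])
      also have "\<dots> < M * (2 * \<epsilon>')"
        using c r' M by (intro mult_strict_left_mono) (auto simp: \<delta>_def)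
      finally show ?thesis by (simp add: M\<epsilon>')
    qed
    have "\<bar>\<phi> c r' s\<bar> \<le> R" if "s \<in> {0..L}" for s
      using close[OF that] R(2)[OF that] by linarith
    then have "ode_sol f r' L (\<phi> c r')"
      using ode_sol_truncate[of L "\<phi> c r'" R f r'] \<phi> by blast
    with c(3) close show "\<exists>v'. ode_sol f r' L v' \<and> integral {0..L} v' = d' \<and>
        (\<forall>s\<in>{0..L}. \<bar>v' s - v s\<bar> < \<epsilon>)"
      by (intro exI[of _ "\<phi> c r'"]) (auto simp: I_def)
  qed
qed

text \<open>
  Bounded solutions solve a truncated equation, whose flow is continuous in the starting value and
  in \<open>r\<close>, uniformly on \<open>[0, L]\<close>.
\<close>

lemma ode_sol_limit:
  assumes f: "regular_rhs f L" and L: "0 < L"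
    and v: "\<And>n. ode_sol f (r n) L (v n)" and bd: "\<And>n s. s \<in> {0..L} \<Longrightarrow> \<bar>v n s\<bar> \<le> R"
    and r: "r \<longlonglongrightarrow> r'" and c: "(\<lambda>n. v n 0) \<longlonglongrightarrow> c"
  obtains v' where "ode_sol f r' L v'" and "\<And>s. s \<in> {0..L} \<Longrightarrow> (\<lambda>n. v n s) \<longlonglongrightarrow> v' s"
    and "(\<lambda>n. integral {0..L} (v n)) \<longlonglongrightarrow> integral {0..L} v'"
proof -
  have R: "0 \<le> R" using bd[of 0 0] L by auto
  let ?f = "truncate_rhs R f"
  obtain K M \<phi> where K: "0 < K" and M: "0 < M"
    and lip: "\<And>s p q. s \<in> {0..L} \<Longrightarrow> \<bar>?f s p - ?f s q\<bar> \<le> K * \<bar>p - q\<bar>"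
    and \<phi>0: "\<And>c r. \<phi> c r 0 = c" and \<phi>: "\<And>c r. ode_sol ?f r L (\<phi> c r)"
    and \<phi>_lip: "\<And>r r' v c s. ode_sol ?f r L v \<Longrightarrow> s \<in> {0..L} \<Longrightarrow>
      \<bar>\<phi> c r' s - v s\<bar> \<le> M * (\<bar>c - v 0\<bar> + \<bar>r' - r\<bar>)"
    and int_lip: "\<And>c c' r r'. \<bar>integral {0..L} (\<phi> c r) - integral {0..L} (\<phi> c' r')\<bar>
      \<le> L * M * (\<bar>c - c'\<bar> + \<bar>r - r'\<bar>)"
    by (rule truncated_flow[OF f less_imp_le[OF L] R]) (rule that; assumption)
  have fv: "ode_sol ?f (r n) L (v n)" for n
    using ode_sol_truncate[of L "v n" R f "r n"] bd v by blast
  have lim0: "(\<lambda>n. M * (\<bar>c - v n 0\<bar> + \<bar>r' - r n\<bar>)) \<longlonglongrightarrow> 0"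
    using r c by (auto intro!: tendsto_eq_intros)
  have lim: "(\<lambda>n. v n s) \<longlonglongrightarrow> \<phi> c r' s" if "s \<in> {0..L}" for s
  proof -
    have "(\<lambda>n. \<phi> c r' s - v n s) \<longlonglongrightarrow> 0"
      by (rule tendsto_rabs_zero_cancel, rule tendsto_sandwich[OF _ _ tendsto_const lim0])
        (use \<phi>_lip[OF fv that] in auto)
    from tendsto_diff[OF tendsto_const[of "\<phi> c r' s"] this] show ?thesis by simp
  qed
  have "\<bar>\<phi> c r' s\<bar> \<le> R" if "s \<in> {0..L}" for s
    by (rule tendsto_upperbound[OF tendsto_rabs[OF lim[OF that]]]) (use bd that in auto)
  then have sol: "ode_sol f r' L (\<phi> c r')"
    using ode_sol_truncate[of L "\<phi> c r'" R f r'] \<phi> by blast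
  have unif: "uniform_limit {0..L} v (\<phi> c r') sequentially"
  proof (rule uniform_limitI)
    fix e :: real assume "0 < e"
    then have "\<forall>\<^sub>F n in sequentially. M * (\<bar>c - v n 0\<bar> + \<bar>r' - r n\<bar>) < e"
      by (rule order_tendstoD(2)[OF lim0])
    then show "\<forall>\<^sub>F n in sequentially. \<forall>s\<in>{0..L}. dist (v n s) (\<phi> c r' s) < e"
    proof eventually_elim
      case (elim n)
      show ?case
      proof
        fix s assume "s \<in> {0..L}"
        from \<phi>_lip[OF fv[of n] this, of c r'] elim
        show "dist (v n s) (\<phi> c r' s) < e"
          by (simp add: dist_real_def)
      qed
    qed
  qed
  have "(\<lambda>n. integral {0..L} (v n)) \<longlonglongrightarrow> integral {0..L} (\<phi> c r')"
  proof -
    obtain I J where I: "\<And>n. (v n has_integral I n) {0..L}" and J: "(\<phi> c r' has_integral J) {0..L}"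
      and lim: "(I \<longlongrightarrow> J) sequentially"
      by (rule uniform_limit_integral[OF unif ode_sol_continuous[OF v] sequentially_bot])
        (rule that; assumption)
    show ?thesis
      using lim integral_unique[OF I] integral_unique[OF J] by simp
  qed
  with sol lim show ?thesis
    by (rule that)
qed

text \<open>
  For \<open>r\<close> so low that \<open>f s 0 + r < 0\<close>, solutions cross zero downwards only, and coercivity confines
  them to an interval \<open>[- P, P]\<close> as long as their integral vanishes. Shooting from \<open>v 0 \<in> [0, P]\<close>
  hits the integral zero: the solution started at \<open>0\<close> stays below zero, and for the truncated
  equation the one started at \<open>P\<close> stays above \<open>P\<close>.
\<close>

lemma ode_sol_concave_start:
  assumes f: "regular_rhs f L" and L: "0 < L"
    and coercive: "\<And>s p. s \<in> {0..L} \<Longrightarrow> c * \<bar>p\<bar> powr q - C \<le> f s p" and c: "0 < c" and q: "1 < q"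
    and low: "\<And>s. s \<in> {0..L} \<Longrightarrow> f s 0 + r \<le> 0"
  obtains v where "ode_sol f r L v" and "integral {0..L} v = 0" and "0 \<le> v 0" and "v L \<le> 0"
proof -
  \<comment> \<open>As \<open>P \<ge> 1\<close>, \<open>P powr q \<ge> P\<close>, and coercivity makes \<open>f s p + r\<close> nonnegative at \<open>p = P\<close> and \<open>p = - P\<close>.\<close>
  define P where "P = max 1 ((C - r) / c)"
  have P: "1 \<le> P" by (simp add: P_def)
  have at_P: "0 \<le> f s P + r" "0 \<le> f s (- P) + r" if "s \<in> {0..L}" for s
  proof -
    have "(C - r) / c \<le> P powr q"
      using powr_mono[of 1 q P] P q by (simp add: P_def)
    then have "0 \<le> c * P powr q - C + r"
      using c by (simp add: field_simps)
    then show "0 \<le> f s P + r" "0 \<le> f s (- P) + r"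
      using coercive[OF that, of P] coercive[OF that, of "- P"] P by auto
  qed
  let ?f = "truncate_rhs P f"
  obtain K M \<phi> where K: "0 < K" and M: "0 < M"
    and lip: "\<And>s p q. s \<in> {0..L} \<Longrightarrow> \<bar>?f s p - ?f s q\<bar> \<le> K * \<bar>p - q\<bar>"
    and \<phi>0: "\<And>c r. \<phi> c r 0 = c" and \<phi>: "\<And>c r. ode_sol ?f r L (\<phi> c r)"
    and \<phi>_lip: "\<And>r r' v c s. ode_sol ?f r L v \<Longrightarrow> s \<in> {0..L} \<Longrightarrow>
      \<bar>\<phi> c r' s - v s\<bar> \<le> M * (\<bar>c - v 0\<bar> + \<bar>r' - r\<bar>)"
    and int_lip: "\<And>c c' r r'. \<bar>integral {0..L} (\<phi> c r) - integral {0..L} (\<phi> c' r')\<bar>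
      \<le> L * M * (\<bar>c - c'\<bar> + \<bar>r - r'\<bar>)"
    by (rule truncated_flow[OF f less_imp_le[OF L], of P]) (use P in auto)
  have f_P: "?f s P = f s P" "?f s (- P) = f s (- P)" "?f s 0 = f s 0" for s
    using P by (auto intro!: truncate_rhs_eq)
  \<comment> \<open>\<open>P\<close> and \<open>- P\<close> are crossed upwards only, and \<open>0\<close> downwards only.\<close>
  have crossing: "0 \<le> e * (\<phi> c r t - b)"
    if b: "\<And>s. s \<in> {0..L} \<Longrightarrow> 0 \<le> e * (?f s b + r)" and init: "0 \<le> e * (\<phi> c r a - b)"
      and e: "e = 1 \<or> e = - 1" and a: "0 \<le> a" "a \<le> t" "t \<le> L" for a b c e t
  proof (rule nonneg_barrier[where a = a and b = L and K = K and z = "\<lambda>s. e * (\<phi> c r s - b)"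
        and z' = "\<lambda>s. e * (?f s (\<phi> c r s) + r)"])
    fix s assume s: "s \<in> {a..L}"
    then have s': "s \<in> {0..L}" using a by auto
    have "(\<phi> c r has_real_derivative ?f s (\<phi> c r s) + r) (at s within {a..L})"
      by (rule DERIV_subset[OF ode_solD[OF \<phi> s']]) (use a in auto)
    then show "((\<lambda>s. e * (\<phi> c r s - b)) has_real_derivative e * (?f s (\<phi> c r s) + r)) (at s within {a..L})"
      by (auto intro!: derivative_eq_intros)
    assume "e * (\<phi> c r s - b) < 0"
    then have "\<bar>\<phi> c r s - b\<bar> = - (e * (\<phi> c r s - b))"
      using e by auto
    with lip[OF s', of "\<phi> c r s" b] have "\<bar>?f s (\<phi> c r s) - ?f s b\<bar> \<le> - (K * (e * (\<phi> c r s - b)))"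
      by simp
    moreover have "- \<bar>?f s (\<phi> c r s) - ?f s b\<bar> \<le> e * (?f s (\<phi> c r s) - ?f s b)"
      using e by auto
    moreover have "e * (?f s (\<phi> c r s) + r) = e * (?f s (\<phi> c r s) - ?f s b) + e * (?f s b + r)"
      by (simp add: algebra_simps)
    ultimately show "K * (e * (\<phi> c r s - b)) \<le> e * (?f s (\<phi> c r s) + r)"
      using b[OF s'] by linarith
  qed (use init a in auto)
  have ge: "b \<le> \<phi> c r t" if "b \<le> \<phi> c r a" "b = P \<or> b = - P" "0 \<le> a" "a \<le> t" "t \<le> L" for a b c t
  proof -
    have "0 \<le> 1 * (\<phi> c r t - b)"
    proof (rule crossing[where a = a])
      show "0 \<le> 1 * (?f s b + r)" if "s \<in> {0..L}" for s
        using at_P[OF that] \<open>b = P \<or> b = - P\<close> by (auto simp: f_P)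
    qed (use that in simp_all)
    then show ?thesis by simp
  qed
  have nonpos: "\<phi> c r t \<le> 0" if "\<phi> c r a \<le> 0" "0 \<le> a" "a \<le> t" "t \<le> L" for a c t
  proof -
    have "0 \<le> - 1 * (\<phi> c r t - 0)"
    proof (rule crossing[where a = a])
      show "0 \<le> - 1 * (?f s 0 + r)" if "s \<in> {0..L}" for s
        using low[OF that] by (simp add: f_P)
    qed (use that in simp_all)
    then show ?thesis by simp
  qed
  define I where "I c = integral {0..L} (\<phi> c r)" for c
  have cont: "continuous_on {0..L} (\<phi> c r)" for c
    by (rule ode_sol_continuous[OF \<phi>])
  have int: "\<phi> c r integrable_on {0..L}" for c
    by (rule integrable_continuous_interval[OF cont])
  have I_lip: "\<bar>I c - I c'\<bar> \<le> L * M * \<bar>c - c'\<bar>" for c c'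
    using int_lip[of c r c' r] by (simp add: I_def)
  have "I 0 \<le> integral {0..L} (\<lambda>s. 0)"
    unfolding I_def using nonpos[of 0 0] by (intro integral_le int) (auto simp: \<phi>0)
  moreover have "integral {0..L} (\<lambda>s. 0) \<le> I P"
    unfolding I_def using ge[of P P 0] P by (intro integral_le int) (force simp: \<phi>0)+
  moreover have "continuous_on {0..P} I"
    by (rule lipschitz_on_continuous_on[of "L * M"])
      (use I_lip L M in \<open>auto intro!: lipschitz_onI simp: dist_real_def\<close>)
  ultimately obtain c0 where c0: "0 \<le> c0" "c0 \<le> P" "I c0 = 0"
    using IVT'[of I 0 0 P] P by auto
  let ?v = "\<phi> c0 r"
  have not_pos: "\<exists>t\<in>{0..L}. ?v t \<le> 0"
  proof (rule ccontr)
    assume "\<not> ?thesis"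
    then have pos: "\<And>s. s \<in> {0..L} \<Longrightarrow> 0 < ?v s" by force
    have "\<forall>s\<in>{0..L}. ?v s = 0"
      using integral_eq_0_iff[OF cont L less_imp_le[OF pos]] c0(3) by (simp add: I_def)
    with pos[of 0] L show False by simp
  qed
  have upper: "?v s \<le> P" if s: "s \<in> {0..L}" for s
  proof (rule ccontr)
    assume "\<not> ?v s \<le> P"
    then have "P \<le> ?v s" and "\<not> ?v s \<le> 0" using P by auto
    obtain t where t: "t \<in> {0..L}" "?v t \<le> 0"
      using not_pos by blast
    show False
    proof (cases "t \<le> s")
      case True
      with nonpos[of c0 t s] t s \<open>\<not> ?v s \<le> 0\<close> show False by simp
    next
      case False
      with ge[of P c0 s t] t s \<open>P \<le> ?v s\<close> P show False by simp
    qed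
  qed
  have lower: "- P \<le> ?v s" if "s \<in> {0..L}" for s
    using ge[of "- P" c0 0 s] that c0 P by (simp add: \<phi>0)
  have "\<bar>?v s\<bar> \<le> P" if "s \<in> {0..L}" for s
    using upper[OF that] lower[OF that] by (simp add: abs_le_iff)
  then have "ode_sol f r L ?v"
    using ode_sol_truncate[of L ?v P f r] \<phi> by blast
  moreover have "?v L \<le> 0"
    using not_pos nonpos[of c0 _ L] by auto
  ultimately show ?thesis
    using c0 by (intro that[of ?v]) (auto simp: \<phi>0 I_def)
qed

section \<open>Fluxes on finite graphs\<close>

text \<open>
  The edge \<open>a\<close> is the interval \<open>[0, len a]\<close> from \<open>org a\<close> to \<open>dst a\<close>. Connectedness is stated for
  sets of vertices, the form in which it is used: a set of vertices that is closed under passing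
  to neighbours is everything.
\<close>

locale metric_graph =
  fixes V :: "'v set" and E :: "'e set" and org dst :: "'e \<Rightarrow> 'v" and len :: "'e \<Rightarrow> real"
  assumes finite_V: "finite V" and V_nonempty: "V \<noteq> {}" and finite_E: "finite E"
    and org_in_V: "a \<in> E \<Longrightarrow> org a \<in> V" and dst_in_V: "a \<in> E \<Longrightarrow> dst a \<in> V"
    and org_neq_dst: "a \<in> E \<Longrightarrow> org a \<noteq> dst a"
    and len_pos: "a \<in> E \<Longrightarrow> 0 < len a"
    and no_isolated_vertex: "x \<in> V \<Longrightarrow> \<exists>a\<in>E. x = org a \<or> x = dst a"
    and connected_graph: "S \<subseteq> V \<Longrightarrow> S \<noteq> {} \<Longrightarrow> (\<And>a. a \<in> E \<Longrightarrow> org a \<in> S \<longleftrightarrow> dst a \<in> S) \<Longrightarrow> S = V"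
begin

definition inc :: "'v \<Rightarrow> 'e set" where
  "inc x = {a \<in> E. x = org a \<or> x = dst a}"

definition out :: "('e \<Rightarrow> real \<Rightarrow> real) \<Rightarrow> 'e \<Rightarrow> 'v \<Rightarrow> real" where
  "out w a x = (if x = org a then - w a 0 else w a (len a))"

definition net :: "('v \<Rightarrow> 'e \<Rightarrow> real) \<Rightarrow> ('e \<Rightarrow> real \<Rightarrow> real) \<Rightarrow> 'v \<Rightarrow> real" where
  "net \<kappa> w x = (\<Sum>a\<in>inc x. \<kappa> x a * out w a x)"

definition potential :: "('v \<Rightarrow> real) \<Rightarrow> ('e \<Rightarrow> real \<Rightarrow> real) \<Rightarrow> bool" where
  "potential U w \<longleftrightarrow> (\<forall>a\<in>E. integral {0..len a} (w a) = U (dst a) - U (org a))"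

definition coercive_family ::
    "('e \<Rightarrow> real) \<Rightarrow> real \<Rightarrow> ('e \<Rightarrow> real) \<Rightarrow> ('e \<Rightarrow> real \<Rightarrow> real) \<Rightarrow> ('e \<Rightarrow> real \<Rightarrow> real) \<Rightarrow> bool" where
  "coercive_family c q C w w' \<longleftrightarrow> (\<forall>a\<in>E. \<forall>s\<in>{0..len a}.
     (w a has_real_derivative w' a s) (at s within {0..len a}) \<and>
     c a * \<bar>w a s\<bar> powr q - C a \<le> w' a s)"

lemma incD: "a \<in> inc x \<Longrightarrow> a \<in> E" "a \<in> inc x \<Longrightarrow> x = org a \<or> x = dst a"
  by (auto simp: inc_def)

lemma finite_inc: "finite (inc x)"
  using finite_E by (simp add: inc_def)

text \<open>
  At a vertex where \<open>U\<close> is maximal the Hopf lemma makes all outward fluxes nonnegative. As their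
  weighted sum is not positive, they vanish, and then \<open>w\<close> vanishes on all incident edges. So \<open>U\<close>
  is maximal at the neighbours as well, and connectedness does the rest.
\<close>

lemma strong_maximum_principle:
  assumes \<kappa>: "\<And>x a. x \<in> V \<Longrightarrow> a \<in> inc x \<Longrightarrow> 0 < \<kappa> x a"
    and D: "\<And>a s. a \<in> E \<Longrightarrow> s \<in> {0..len a} \<Longrightarrow>
      (w a has_real_derivative w' a s) (at s within {0..len a})"
    and ineq: "\<And>a s. a \<in> E \<Longrightarrow> s \<in> {0..len a} \<Longrightarrow> \<delta> a - K a * \<bar>w a s\<bar> \<le> w' a s"
    and K: "\<And>a. a \<in> E \<Longrightarrow> 0 \<le> K a" and \<delta>: "\<And>a. a \<in> E \<Longrightarrow> 0 \<le> \<delta> a"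
    and U: "potential U w" and net: "\<And>x. x \<in> V \<Longrightarrow> net \<kappa> w x \<le> 0"
    and a: "a \<in> E"
  shows "\<delta> a = 0 \<and> (\<forall>s\<in>{0..len a}. w a s = 0)"
proof -
  define S where "S = {x \<in> V. U x = Max (U ` V)}"
  have max: "U y \<le> U x" if "x \<in> S" "y \<in> V" for x y
    using that finite_V by (simp add: S_def)
  have zero: "\<delta> a = 0 \<and> (\<forall>s\<in>{0..len a}. w a s = 0)" if x: "x \<in> S" and a: "a \<in> inc x" for x a
  proof -
    have sign: "0 \<le> out w b x \<and> (out w b x = 0 \<longrightarrow> \<delta> b = 0 \<and> (\<forall>s\<in>{0..len b}. w b s = 0))"
      if b: "b \<in> inc x" for b
    proof -
      note bE = incD(1)[OF b]
      have int: "integral {0..len b} (w b) = U (dst b) - U (org b)"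
        using U bE by (simp add: potential_def)
      show ?thesis
      proof (cases "x = org b")
        case True
        have "integral {0..len b} (w b) \<le> 0"
          using int max[OF x dst_in_V[OF bE]] True by simp
        from start_value_of_nonpos_integral[OF len_pos[OF bE] D[OF bE] ineq[OF bE] K[OF bE] \<delta>[OF bE] this]
        show ?thesis using True by (simp add: out_def)
      next
        case False
        then have xb: "x = dst b" using incD(2)[OF b] by simp
        have "0 \<le> integral {0..len b} (w b)"
          using int max[OF x org_in_V[OF bE]] xb by simp
        from end_value_of_nonneg_integral[OF len_pos[OF bE] D[OF bE] ineq[OF bE] K[OF bE] \<delta>[OF bE] this]
        show ?thesis using False by (simp add: out_def)
      qed
    qed
    have xV: "x \<in> V" using x by (simp add: S_def)
    have nonneg: "\<And>b. b \<in> inc x \<Longrightarrow> 0 \<le> \<kappa> x b * out w b x"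
      using sign \<kappa>[OF xV] by (simp add: less_imp_le)
    then have "net \<kappa> w x = 0"
      using net[OF xV] unfolding net_def by (intro antisym sum_nonneg) auto
    then have "\<kappa> x a * out w a x = 0"
      using sum_nonneg_eq_0_iff[OF finite_inc nonneg] a by (auto simp: net_def)
    then show ?thesis
      using sign[OF a] \<kappa>[OF xV a] by simp
  qed
  have "S = V"
  proof (rule connected_graph)
    show "S \<subseteq> V" by (auto simp: S_def)
    have "Max (U ` V) \<in> U ` V"
      using finite_V V_nonempty by (intro Max_in) auto
    then show "S \<noteq> {}" by (auto simp: S_def)
    fix a assume a: "a \<in> E"
    have "U (org a) = U (dst a)" if "x \<in> S" "a \<in> inc x" for x
    proof -
      have "integral {0..len a} (w a) = integral {0..len a} (\<lambda>s. 0)"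
        using zero[OF that] by (intro integral_cong) auto
      then show ?thesis using U a by (simp add: potential_def)
    qed
    from this[of "org a"] this[of "dst a"] show "org a \<in> S \<longleftrightarrow> dst a \<in> S"
      using a org_in_V[OF a] dst_in_V[OF a] by (auto simp: S_def inc_def)
  qed
  then show ?thesis
    using zero[of "org a" a] a org_in_V[OF a] by (simp add: inc_def)
qed

text \<open>
  Coercivity bounds every outward flux from below. If the weighted sums of the fluxes are bounded
  above, each flux is therefore bounded on both sides; inside the edges, \<open>w' \<ge> - C\<close> suffices.
\<close>

lemma net_bound_imp_bounded:
  assumes \<kappa>: "\<And>x a. x \<in> V \<Longrightarrow> a \<in> inc x \<Longrightarrow> 0 < \<kappa> x a"
    and c: "\<And>a. a \<in> E \<Longrightarrow> 0 < c a" and q: "1 < q"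
  obtains R where "\<And>w w' a s. coercive_family c q C w w' \<Longrightarrow> \<forall>x\<in>V. net \<kappa> w x \<le> B \<Longrightarrow>
    a \<in> E \<Longrightarrow> s \<in> {0..len a} \<Longrightarrow> \<bar>w a s\<bar> \<le> R"
proof -
  have "\<exists>K. \<forall>v v'. (\<forall>s\<in>{0..len a}. (v has_real_derivative v' s) (at s within {0..len a})) \<longrightarrow>
      (\<forall>s\<in>{0..len a}. c a * \<bar>v s\<bar> powr q - C a \<le> v' s) \<longrightarrow> v 0 \<le> (K :: real) \<and> - K \<le> v (len a)"
    if a: "a \<in> E" for a
    using coercive_flux_bound[OF c[OF a] q len_pos[OF a], of "C a"] by metis
  then obtain K :: "'e \<Rightarrow> real" where K: "\<And>a v v'. a \<in> E \<Longrightarrow>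
      (\<forall>s\<in>{0..len a}. (v has_real_derivative v' s) (at s within {0..len a})) \<Longrightarrow>
      (\<forall>s\<in>{0..len a}. c a * \<bar>v s\<bar> powr q - C a \<le> v' s) \<Longrightarrow> v 0 \<le> K a \<and> - K a \<le> v (len a)"
    by metis
  define K0 where "K0 = (\<Sum>a\<in>E. \<bar>K a\<bar>)"
  have K0: "K a \<le> K0" if "a \<in> E" for a
  proof -
    have "\<bar>K a\<bar> \<le> K0"
      unfolding K0_def using that finite_E by (intro member_le_sum) auto
    then show ?thesis by simp
  qed
  have K0_nonneg: "0 \<le> K0" by (simp add: K0_def sum_nonneg)
  \<comment> \<open>Bounds the flux through \<open>a\<close> at \<open>x\<close> if those through the other edges are at least \<open>- K0\<close>.\<close>
  define bnd where "bnd x a = (\<bar>B\<bar> + K0 * (\<Sum>b\<in>inc x. \<kappa> x b)) / \<kappa> x a" for x a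
  have bnd_nonneg: "0 \<le> bnd x a" if "x \<in> V" "a \<in> inc x" for x a
    unfolding bnd_def using K0_nonneg \<kappa>[OF that(1)] that(2)
    by (intro divide_nonneg_nonneg add_nonneg_nonneg mult_nonneg_nonneg sum_nonneg)
      (auto simp: less_imp_le)
  define M where "M = K0 + (\<Sum>x\<in>V. \<Sum>a\<in>inc x. bnd x a)"
  have bnd_le: "bnd x a \<le> M" if "x \<in> V" "a \<in> inc x" for x a
  proof -
    have "bnd x a \<le> (\<Sum>a\<in>inc x. bnd x a)"
      using that bnd_nonneg finite_inc by (intro member_le_sum) auto
    also have "\<dots> \<le> (\<Sum>x\<in>V. \<Sum>a\<in>inc x. bnd x a)"
      using that(1) bnd_nonneg finite_V
      by (intro member_le_sum[of x V "\<lambda>x. \<Sum>a\<in>inc x. bnd x a"] sum_nonneg) auto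
    finally show ?thesis using K0_nonneg by (simp add: M_def)
  qed
  have M_ge: "K0 \<le> M"
    using bnd_nonneg by (auto simp: M_def intro!: sum_nonneg)
  define R where "R = M + (\<Sum>a\<in>E. \<bar>C a\<bar> * len a)"
  show ?thesis
  proof (rule that[of R])
    fix w w' :: "'e \<Rightarrow> real \<Rightarrow> real" and a s
    assume hyp: "coercive_family c q C w w'"
      and "\<forall>x\<in>V. net \<kappa> w x \<le> B" and a: "a \<in> E" and s: "s \<in> {0..len a}"
    then have net: "\<And>x. x \<in> V \<Longrightarrow> net \<kappa> w x \<le> B" by blast
    have D: "\<And>a s. a \<in> E \<Longrightarrow> s \<in> {0..len a} \<Longrightarrow>
        (w a has_real_derivative w' a s) (at s within {0..len a})"
      and ineq: "\<And>a s. a \<in> E \<Longrightarrow> s \<in> {0..len a} \<Longrightarrow> c a * \<bar>w a s\<bar> powr q - C a \<le> w' a s"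
      using hyp unfolding coercive_family_def by blast+
    have lower: "- K0 \<le> out w b x" if "b \<in> E" for b x
      using K[OF that, of "w b" "w' b"] D[OF that] ineq[OF that] K0[OF that] by (auto simp: out_def)
    have upper: "out w b x \<le> M" if x: "x \<in> V" and b: "b \<in> inc x" for x b
    proof -
      have "\<kappa> x b * (out w b x + K0) \<le> (\<Sum>b\<in>inc x. \<kappa> x b * (out w b x + K0))"
      proof (rule member_le_sum[OF b _ finite_inc])
        fix y assume "y \<in> inc x - {b}"
        then have y: "y \<in> inc x" by simp
        show "0 \<le> \<kappa> x y * (out w y x + K0)"
          using \<kappa>[OF x y] lower[OF incD(1)[OF y], of x] by simp
      qed
      also have "\<dots> = net \<kappa> w x + K0 * (\<Sum>b\<in>inc x. \<kappa> x b)"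
        by (simp add: net_def sum.distrib sum_distrib_left algebra_simps)
      also have "\<dots> \<le> \<bar>B\<bar> + K0 * (\<Sum>b\<in>inc x. \<kappa> x b)"
        using net[OF x] by linarith
      finally have "out w b x + K0 \<le> bnd x b"
        using \<kappa>[OF x b] by (simp add: bnd_def pos_le_divide_eq mult.commute)
      with bnd_le[OF x b] K0_nonneg show ?thesis by linarith
    qed
    have w0: "- M \<le> w a 0"
      using upper[OF org_in_V[OF a], of a] a by (simp add: inc_def out_def)
    have wL: "w a (len a) \<le> M"
      using upper[OF dst_in_V[OF a], of a] a org_neq_dst[OF a] by (simp add: inc_def out_def)
    let ?y = "\<lambda>s. w a s + \<bar>C a\<bar> * s"
    have Dy: "(?y has_real_derivative w' a s + \<bar>C a\<bar>) (at s within {0..len a})" if "s \<in> {0..len a}" for s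
      using D[OF a that] by (auto intro!: derivative_eq_intros)
    have y': "0 \<le> w' a s + \<bar>C a\<bar>" if "s \<in> {0..len a}" for s
    proof -
      have "0 \<le> c a * \<bar>w a s\<bar> powr q"
        using c[OF a] by simp
      with ineq[OF a that] show ?thesis by linarith
    qed
    have mono: "?y s1 \<le> ?y s2" if "0 \<le> s1" "s1 \<le> s2" "s2 \<le> len a" for s1 s2
      by (rule Icc_deriv_nonneg_imp_le[where z = ?y and S = "{0..len a}", OF _ _ Dy y'])
        (use that in auto)
    have "\<bar>C a\<bar> * s \<le> \<bar>C a\<bar> * len a" "0 \<le> \<bar>C a\<bar> * s"
      using s by (auto intro: mult_left_mono)
    moreover have "\<bar>C a\<bar> * len a \<le> R - M"
      unfolding R_def add_diff_cancel_left' using a finite_E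
      by (intro member_le_sum[of a E "\<lambda>a. \<bar>C a\<bar> * len a"])
        (auto intro!: mult_nonneg_nonneg less_imp_le[OF len_pos])
    moreover have "w a 0 \<le> ?y s" "?y s \<le> w a (len a) + \<bar>C a\<bar> * len a"
      using mono[of 0 s] mono[of s "len a"] s by auto
    ultimately show "\<bar>w a s\<bar> \<le> R"
      using w0 wL by (simp add: abs_le_iff)
  qed
qed

text \<open>
  Any two vertices are joined by a chain of edges. The length of such a chain bounds the ratio of
  the difference of \<open>U\<close> between the two vertices and its largest increment along one edge, and it
  does not depend on \<open>U\<close>.
\<close>

lemma potential_difference_bound:
  obtains D where "0 \<le> D"
    and "\<And>U M x y. (\<And>a. a \<in> E \<Longrightarrow> \<bar>U (dst a) - U (org a)\<bar> \<le> M) \<Longrightarrow> x \<in> V \<Longrightarrow> y \<in> V \<Longrightarrow>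
      \<bar>U x - U y\<bar> \<le> D * (M :: real)"
proof -
  let ?P = "\<lambda>x y n. \<forall>U M. (\<forall>a\<in>E. \<bar>U (dst a) - U (org a)\<bar> \<le> M) \<longrightarrow> \<bar>U x - U y\<bar> \<le> n * (M :: real)"
  have ex: "{y \<in> V. \<exists>n. ?P x y n} = V" if x: "x \<in> V" for x
  proof (rule connected_graph)
    have "?P x x 0" by auto
    with x show "{y \<in> V. \<exists>n. ?P x y n} \<noteq> {}" by blast
    fix a assume a: "a \<in> E"
    have step: "?P x (org a) n \<Longrightarrow> ?P x (dst a) (n + 1)" "?P x (dst a) n \<Longrightarrow> ?P x (org a) (n + 1)" for n
      using a by (fastforce simp: algebra_simps)+
    then show "(org a \<in> {y \<in> V. \<exists>n. ?P x y n}) = (dst a \<in> {y \<in> V. \<exists>n. ?P x y n})"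
      using org_in_V[OF a] dst_in_V[OF a] by blast
  qed auto
  then have "\<forall>x\<in>V. \<forall>y\<in>V. \<exists>n. ?P x y n" by blast
  then obtain n where n: "\<And>x y. x \<in> V \<Longrightarrow> y \<in> V \<Longrightarrow> ?P x y (n x y)"
    by metis
  define D where "D = (\<Sum>x\<in>V. \<Sum>y\<in>V. \<bar>n x y\<bar>)"
  show ?thesis
  proof (rule that[of D])
    show "0 \<le> D" by (simp add: D_def sum_nonneg)
    fix U :: "'v \<Rightarrow> real" and M x y
    assume U: "\<And>a. a \<in> E \<Longrightarrow> \<bar>U (dst a) - U (org a)\<bar> \<le> M" and x: "x \<in> V" and y: "y \<in> V"
    obtain a where "a \<in> E" using no_isolated_vertex[OF x] by blast
    from U[OF this] have M: "0 \<le> M" by linarith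
    have "\<bar>n x y\<bar> \<le> (\<Sum>y\<in>V. \<bar>n x y\<bar>)"
      using y finite_V by (intro member_le_sum) auto
    also have "\<dots> \<le> D"
      unfolding D_def using x finite_V
      by (intro member_le_sum[of x V "\<lambda>x. \<Sum>y\<in>V. \<bar>n x y\<bar>"]) (auto intro: sum_nonneg)
    finally have "n x y \<le> D" by linarith
    have "\<bar>U x - U y\<bar> \<le> n x y * M"
      using n[OF x y] U by blast
    also have "\<dots> \<le> D * M"
      using \<open>n x y \<le> D\<close> M by (rule mult_right_mono)
    finally show "\<bar>U x - U y\<bar> \<le> D * M" .
  qed
qed

end

section \<open>The ergodic problem on a graph\<close>

text \<open>
  In terms of \<open>w = \<partial>u\<close> the problem consists of scalar equations \<open>w' = f s w + m \<rho>\<close> on the edges,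
  where \<open>m = 1 / \<mu>\<close> and \<open>f = (H - F) / \<mu>\<close>, coupled by the flux conditions at the vertices and by
  the existence of the potential \<open>u\<close>. A Neumann condition at a boundary vertex is the flux
  condition with \<open>\<kappa> = 1\<close> and \<open>\<eta> = 0\<close>.
\<close>

locale kirchhoff_problem = metric_graph V E org dst len
  for V :: "'v set" and E :: "'e set" and org dst :: "'e \<Rightarrow> 'v" and len :: "'e \<Rightarrow> real" +
  fixes f :: "'e \<Rightarrow> real \<Rightarrow> real \<Rightarrow> real" and m :: "'e \<Rightarrow> real"
    and \<kappa> :: "'v \<Rightarrow> 'e \<Rightarrow> real" and \<eta> \<theta> :: "'v \<Rightarrow> real" and c C :: "'e \<Rightarrow> real" and q :: real
  assumes \<kappa>_pos: "x \<in> V \<Longrightarrow> a \<in> inc x \<Longrightarrow> 0 < \<kappa> x a"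
    and \<eta>_nonneg: "x \<in> V \<Longrightarrow> 0 \<le> \<eta> x"
    and m_pos: "a \<in> E \<Longrightarrow> 0 < m a"
    and regular: "a \<in> E \<Longrightarrow> regular_rhs (f a) (len a)"
    and c_pos: "a \<in> E \<Longrightarrow> 0 < c a" and q_gt_1: "1 < q"
    and coercive: "a \<in> E \<Longrightarrow> s \<in> {0..len a} \<Longrightarrow> c a * \<bar>p\<bar> powr q - C a \<le> f a s p"
begin

definition flow :: "real \<Rightarrow> ('v \<Rightarrow> real) \<Rightarrow> ('e \<Rightarrow> real \<Rightarrow> real) \<Rightarrow> bool" where
  "flow \<rho> U w \<longleftrightarrow> (\<forall>a\<in>E. ode_sol (f a) (m a * \<rho>) (len a) (w a)) \<and> potential U w"

definition subsolution :: "real \<Rightarrow> ('v \<Rightarrow> real) \<Rightarrow> ('e \<Rightarrow> real \<Rightarrow> real) \<Rightarrow> bool" where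
  "subsolution \<rho> U w \<longleftrightarrow> flow \<rho> U w \<and> (\<forall>x\<in>V. net \<kappa> w x \<le> \<eta> x * (\<theta> x - \<rho>))"

definition solution :: "real \<Rightarrow> ('v \<Rightarrow> real) \<Rightarrow> ('e \<Rightarrow> real \<Rightarrow> real) \<Rightarrow> bool" where
  "solution \<rho> U w \<longleftrightarrow> flow \<rho> U w \<and> (\<forall>x\<in>V. net \<kappa> w x = \<eta> x * (\<theta> x - \<rho>))"

lemma flowD:
  assumes "flow \<rho> U w" and "a \<in> E"
  shows "ode_sol (f a) (m a * \<rho>) (len a) (w a)"
    and "integral {0..len a} (w a) = U (dst a) - U (org a)"
  using assms by (auto simp: flow_def potential_def)

lemma solution_imp_subsolution: "solution \<rho> U w \<Longrightarrow> subsolution \<rho> U w"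
  by (simp add: solution_def subsolution_def)

lemma edge_exists: "\<exists>a. a \<in> E"
  using V_nonempty no_isolated_vertex by blast

lemma flow_lipschitz:
  assumes "flow \<rho> U w" and "\<And>a. a \<in> E \<Longrightarrow> continuous_on {0..len a} (z a)"
  obtains K where "\<And>a. a \<in> E \<Longrightarrow> 0 \<le> K a"
    and "\<And>a s. a \<in> E \<Longrightarrow> s \<in> {0..len a} \<Longrightarrow> \<bar>f a s (w a s) - f a s (z a s)\<bar> \<le> K a * \<bar>w a s - z a s\<bar>"
proof -
  have "\<exists>K\<ge>0. \<forall>s\<in>{0..len a}. \<bar>f a s (w a s) - f a s (z a s)\<bar> \<le> K * \<bar>w a s - z a s\<bar>"
    if a: "a \<in> E" for a
    using lipschitz_along[OF regular[OF a] ode_sol_continuous[OF flowD(1)[OF assms(1) a]] assms(2)[OF a]]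
    by metis
  then show ?thesis using that by metis
qed

lemma net_diff: "net \<kappa> (\<lambda>a s. w a s - w' a s) x = net \<kappa> w x - net \<kappa> w' x"
  unfolding net_def sum_subtractf[symmetric]
  by (intro sum.cong refl) (simp add: out_def algebra_simps)

lemma net_cmult: "net \<kappa> (\<lambda>a s. e * w a s) x = e * net \<kappa> w x"
  unfolding net_def sum_distrib_left
  by (intro sum.cong refl) (simp add: out_def)

text \<open>
  The difference of two solutions satisfies the assumptions of the strong maximum principle,
  with \<open>\<delta> = m (\<rho>' - \<rho>)\<close>.
\<close>

lemma solution_unique_aux:
  assumes w: "solution \<rho> U w" and w': "solution \<rho>' U' w'" and le: "\<rho> \<le> \<rho>'"
  shows "\<rho>' = \<rho> \<and> (\<forall>a\<in>E. \<forall>s\<in>{0..len a}. w' a s = w a s)"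
proof -
  have fl: "flow \<rho> U w" "flow \<rho>' U' w'"
    using w w' by (auto simp: solution_def)
  obtain K where K: "\<And>a. a \<in> E \<Longrightarrow> 0 \<le> K a"
    and lip: "\<And>a s. a \<in> E \<Longrightarrow> s \<in> {0..len a} \<Longrightarrow>
      \<bar>f a s (w' a s) - f a s (w a s)\<bar> \<le> K a * \<bar>w' a s - w a s\<bar>"
    by (rule flow_lipschitz[OF fl(2) ode_sol_continuous[OF flowD(1)[OF fl(1)]]]) (assumption, rule that)
  have main: "m a * (\<rho>' - \<rho>) = 0 \<and> (\<forall>s\<in>{0..len a}. w' a s - w a s = 0)" if a: "a \<in> E" for a
  proof (rule strong_maximum_principle[where \<kappa> = \<kappa> and w = "\<lambda>a s. w' a s - w a s" and K = K
        and \<delta> = "\<lambda>a. m a * (\<rho>' - \<rho>)" and U = "\<lambda>x. U' x - U x"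
        and w' = "\<lambda>a s. f a s (w' a s) + m a * \<rho>' - (f a s (w a s) + m a * \<rho>)", OF \<kappa>_pos])
    fix a s assume a: "a \<in> E" and s: "s \<in> {0..len a}"
    show "((\<lambda>s. w' a s - w a s) has_real_derivative
        f a s (w' a s) + m a * \<rho>' - (f a s (w a s) + m a * \<rho>)) (at s within {0..len a})"
      by (intro DERIV_diff ode_solD[OF flowD(1)[OF fl(1) a] s] ode_solD[OF flowD(1)[OF fl(2) a] s])
    show "m a * (\<rho>' - \<rho>) - K a * \<bar>w' a s - w a s\<bar>
        \<le> f a s (w' a s) + m a * \<rho>' - (f a s (w a s) + m a * \<rho>)"
      using lip[OF a s] by (simp add: algebra_simps abs_le_iff)
  next
    show "potential (\<lambda>x. U' x - U x) (\<lambda>a s. w' a s - w a s)"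
      unfolding potential_def
    proof
      fix a assume a: "a \<in> E"
      have "integral {0..len a} (\<lambda>s. w' a s - w a s) = integral {0..len a} (w' a) - integral {0..len a} (w a)"
        by (intro integral_diff integrable_continuous_interval ode_sol_continuous[OF flowD(1)[OF fl(1) a]]
            ode_sol_continuous[OF flowD(1)[OF fl(2) a]])
      then show "integral {0..len a} (\<lambda>s. w' a s - w a s) = U' (dst a) - U (dst a) - (U' (org a) - U (org a))"
        using flowD(2)[OF fl(1) a] flowD(2)[OF fl(2) a] by simp
    qed
  next
    fix x assume x: "x \<in> V"
    have "\<eta> x * \<rho> \<le> \<eta> x * \<rho>'"
      using le \<eta>_nonneg[OF x] by (rule mult_left_mono)
    moreover have "net \<kappa> w x = \<eta> x * (\<theta> x - \<rho>)" "net \<kappa> w' x = \<eta> x * (\<theta> x - \<rho>')"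
      using w w' x by (auto simp: solution_def)
    ultimately show "net \<kappa> (\<lambda>a s. w' a s - w a s) x \<le> 0"
      by (simp add: net_diff algebra_simps)
  qed (use K le m_pos a in \<open>auto intro!: mult_nonneg_nonneg less_imp_le[OF m_pos]\<close>)
  obtain a where a: "a \<in> E" using edge_exists by blast
  have "\<rho>' = \<rho>"
    using main[OF a] m_pos[OF a] by simp
  then show ?thesis
    using main by simp
qed

lemma solution_unique:
  assumes "solution \<rho> U w" and "solution \<rho>' U' w'"
  shows "\<rho>' = \<rho> \<and> (\<forall>a\<in>E. \<forall>s\<in>{0..len a}. w' a s = w a s)"
  using solution_unique_aux[OF assms] solution_unique_aux[OF assms(2,1)] by (metis linear)

text \<open>
  The bounds on \<open>\<rho>\<close> come from the strong maximum principle for \<open>w\<close> itself (\<open>e = 1\<close>) and for \<open>- w\<close>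
  (\<open>e = - 1\<close>): if \<open>e (f s 0 + m \<rho>) \<ge> m d\<close>, then \<open>e (f s w + m \<rho>) \<ge> m d - K |w|\<close> by the Lipschitz
  continuity of \<open>f\<close>, and the case \<open>d > 0\<close> is contradictory.
\<close>

lemma no_one_signed_flow:
  assumes fl: "flow \<rho> U w" and d: "0 < d" and e: "e = 1 \<or> e = - 1"
    and rhs: "\<And>a s. a \<in> E \<Longrightarrow> s \<in> {0..len a} \<Longrightarrow> m a * d \<le> e * (f a s 0 + m a * \<rho>)"
    and net: "\<And>x. x \<in> V \<Longrightarrow> e * net \<kappa> w x \<le> 0"
  shows False
proof -
  obtain K where K: "\<And>a. a \<in> E \<Longrightarrow> 0 \<le> K a"
    and lip: "\<And>a s. a \<in> E \<Longrightarrow> s \<in> {0..len a} \<Longrightarrow> \<bar>f a s (w a s) - f a s 0\<bar> \<le> K a * \<bar>w a s - 0\<bar>"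
    by (rule flow_lipschitz[OF fl continuous_on_const[of _ 0]]) (rule that)
  obtain a where a: "a \<in> E" using edge_exists by blast
  have "m a * d = 0 \<and> (\<forall>s\<in>{0..len a}. e * w a s = 0)"
  proof (rule strong_maximum_principle[where \<kappa> = \<kappa> and w = "\<lambda>a s. e * w a s" and K = K
        and U = "\<lambda>x. e * U x" and \<delta> = "\<lambda>a. m a * d"
        and w' = "\<lambda>a s. e * (f a s (w a s) + m a * \<rho>)", OF \<kappa>_pos])
    fix a s assume a: "a \<in> E" and s: "s \<in> {0..len a}"
    show "((\<lambda>s. e * w a s) has_real_derivative e * (f a s (w a s) + m a * \<rho>)) (at s within {0..len a})"
      by (rule DERIV_cmult[OF ode_solD[OF flowD(1)[OF fl a] s]])
    show "m a * d - K a * \<bar>e * w a s\<bar> \<le> e * (f a s (w a s) + m a * \<rho>)"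
      using e lip[OF a s] rhs[OF a s] by (auto simp: abs_mult abs_le_iff)
  next
    show "net \<kappa> (\<lambda>a s. e * w a s) x \<le> 0" if "x \<in> V" for x
      using net[OF that] by (simp add: net_cmult)
  qed (use fl K d m_pos a in
      \<open>auto simp: flow_def potential_def right_diff_distrib intro!: mult_nonneg_nonneg less_imp_le[OF m_pos]\<close>)
  with m_pos[OF a] d show False by simp
qed

lemma subsolution_upper_bound:
  assumes w: "subsolution \<rho> U w"
    and A: "\<And>a s. a \<in> E \<Longrightarrow> s \<in> {0..len a} \<Longrightarrow> - (m a * A) \<le> f a s 0" "\<And>x. x \<in> V \<Longrightarrow> \<theta> x \<le> A"
  shows "\<rho> \<le> A"
proof (rule ccontr)
  assume less: "\<not> \<rho> \<le> A"
  show False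
  proof (rule no_one_signed_flow[of \<rho> U w "\<rho> - A" 1])
    fix x assume x: "x \<in> V"
    have "\<eta> x * (\<theta> x - \<rho>) \<le> 0"
      using A(2)[OF x] less \<eta>_nonneg[OF x] by (intro mult_nonneg_nonpos) auto
    then show "1 * net \<kappa> w x \<le> 0"
      using w x by (force simp: subsolution_def)
  next
    show "m a * (\<rho> - A) \<le> 1 * (f a s 0 + m a * \<rho>)" if "a \<in> E" "s \<in> {0..len a}" for a s
      using A(1)[OF that] by (simp add: right_diff_distrib)
  qed (use w less in \<open>auto simp: subsolution_def\<close>)
qed

lemma solution_lower_bound:
  assumes w: "solution \<rho> U w"
    and A: "\<And>a s. a \<in> E \<Longrightarrow> s \<in> {0..len a} \<Longrightarrow> f a s 0 \<le> m a * A" "\<And>x. x \<in> V \<Longrightarrow> - A \<le> \<theta> x"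
  shows "- A \<le> \<rho>"
proof (rule ccontr)
  assume less: "\<not> - A \<le> \<rho>"
  show False
  proof (rule no_one_signed_flow[of \<rho> U w "- A - \<rho>" "- 1"])
    fix x assume x: "x \<in> V"
    have "0 \<le> \<eta> x * (\<theta> x - \<rho>)"
      using A(2)[OF x] less \<eta>_nonneg[OF x] by (intro mult_nonneg_nonneg) auto
    then show "- 1 * net \<kappa> w x \<le> 0"
      using w x by (simp add: solution_def)
  next
    show "m a * (- A - \<rho>) \<le> - 1 * (f a s 0 + m a * \<rho>)" if "a \<in> E" "s \<in> {0..len a}" for a s
      using A(1)[OF that] by (simp add: right_diff_distrib)
  qed (use w less in \<open>auto simp: solution_def\<close>)
qed

lemma rhs_at_zero_bounded:
  obtains A where "0 \<le> A"
    and "\<And>a s. a \<in> E \<Longrightarrow> s \<in> {0..len a} \<Longrightarrow> \<bar>f a s 0\<bar> \<le> m a * A" and "\<And>x. x \<in> V \<Longrightarrow> \<bar>\<theta> x\<bar> \<le> A"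
proof -
  have "\<exists>B. \<forall>s\<in>{0..len a}. \<bar>f a s 0\<bar> \<le> B" if a: "a \<in> E" for a
  proof -
    have "continuous_on {0..len a} (\<lambda>s. f a s 0)"
      using continuous_on_curried[of "len a" "f a" "\<lambda>s. 0"] regular[OF a] by (simp add: regular_rhs_def)
    then show ?thesis
      by (rule continuous_on_Icc_bounded) blast
  qed
  then obtain B where B: "\<And>a s. a \<in> E \<Longrightarrow> s \<in> {0..len a} \<Longrightarrow> \<bar>f a s 0\<bar> \<le> B a"
    by metis
  define A where "A = (\<Sum>a\<in>E. \<bar>B a\<bar> / m a) + (\<Sum>x\<in>V. \<bar>\<theta> x\<bar>)"
  have nn: "0 \<le> (\<Sum>a\<in>E. \<bar>B a\<bar> / m a)" "0 \<le> (\<Sum>x\<in>V. \<bar>\<theta> x\<bar>)"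
    using m_pos by (auto intro!: sum_nonneg divide_nonneg_pos)
  show ?thesis
  proof (rule that[of A])
    show "0 \<le> A" using nn by (simp add: A_def)
    show "\<bar>\<theta> x\<bar> \<le> A" if "x \<in> V" for x
      using member_le_sum[of x V "\<lambda>x. \<bar>\<theta> x\<bar>"] that finite_V nn by (simp add: A_def)
    show "\<bar>f a s 0\<bar> \<le> m a * A" if a: "a \<in> E" and s: "s \<in> {0..len a}" for a s
    proof -
      have "\<bar>B a\<bar> / m a \<le> (\<Sum>a\<in>E. \<bar>B a\<bar> / m a)"
        using a m_pos finite_E by (intro member_le_sum[of a E "\<lambda>a. \<bar>B a\<bar> / m a"]) (auto simp: less_imp_le)
      then have "\<bar>B a\<bar> / m a \<le> A"
        unfolding A_def using nn by linarith
      then have "\<bar>B a\<bar> \<le> m a * A"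
        using m_pos[OF a] by (simp add: pos_divide_le_eq mult.commute)
      with B[OF a s] show ?thesis by linarith
    qed
  qed
qed

text \<open>For very low \<open>\<rho>\<close>, the constant potential carries a flow that runs inwards at both ends.\<close>

lemma subsolution_exists: "\<exists>\<rho> U w. subsolution \<rho> U w"
proof -
  obtain A where A: "0 \<le> A" "\<And>a s. a \<in> E \<Longrightarrow> s \<in> {0..len a} \<Longrightarrow> \<bar>f a s 0\<bar> \<le> m a * A"
    "\<And>x. x \<in> V \<Longrightarrow> \<bar>\<theta> x\<bar> \<le> A"
    using rhs_at_zero_bounded by blast
  have "\<exists>v. ode_sol (f a) (m a * (- A)) (len a) v \<and> integral {0..len a} v = 0 \<and> 0 \<le> v 0 \<and> v (len a) \<le> 0"
    if a: "a \<in> E" for a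
  proof -
    have low: "f a s 0 + m a * (- A) \<le> 0" if "s \<in> {0..len a}" for s
      using A(2)[OF a that] by simp
    show ?thesis
      using ode_sol_concave_start[OF regular[OF a] len_pos[OF a] coercive[OF a] c_pos[OF a] q_gt_1 low]
      by metis
  qed
  then obtain w where w: "\<And>a. a \<in> E \<Longrightarrow> ode_sol (f a) (m a * (- A)) (len a) (w a)"
    "\<And>a. a \<in> E \<Longrightarrow> integral {0..len a} (w a) = 0" "\<And>a. a \<in> E \<Longrightarrow> 0 \<le> w a 0"
    "\<And>a. a \<in> E \<Longrightarrow> w a (len a) \<le> 0"
    by metis
  have "subsolution (- A) (\<lambda>x. 0) w"
    unfolding subsolution_def flow_def potential_def
  proof (intro conjI ballI)
    fix x assume x: "x \<in> V"
    have "net \<kappa> w x \<le> 0"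
      unfolding net_def
      by (intro sum_nonpos mult_nonneg_nonpos less_imp_le[OF \<kappa>_pos[OF x]])
        (auto simp: out_def inc_def w)
    also have "0 \<le> \<eta> x * (\<theta> x - (- A))"
      using A(3)[OF x] \<eta>_nonneg[OF x] by (intro mult_nonneg_nonneg) (auto simp: abs_le_iff)
    finally show "net \<kappa> w x \<le> \<eta> x * (\<theta> x - (- A))" .
  qed (use w in auto)
  then show ?thesis by blast
qed

end

lemma finite_family_convergent_subsequence:
  fixes x :: "nat \<Rightarrow> 'a \<Rightarrow> real"
  assumes "finite A" and "\<And>n a. a \<in> A \<Longrightarrow> \<bar>x n a\<bar> \<le> B"
  obtains l r where "strict_mono (r :: nat \<Rightarrow> nat)" and "\<And>a. a \<in> A \<Longrightarrow> (\<lambda>n. x (r n) a) \<longlonglongrightarrow> l a"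
proof -
  have "\<exists>r l. strict_mono (r :: nat \<Rightarrow> nat) \<and> (\<forall>a\<in>A. (\<lambda>n. x (r n) a) \<longlonglongrightarrow> l a)"
    using assms
  proof (induction A rule: finite_induct)
    case empty
    show ?case by (auto intro: strict_mono_id simp: id_def)
  next
    case (insert b A)
    then obtain r l where r: "strict_mono (r :: nat \<Rightarrow> nat)"
      and l: "\<And>a. a \<in> A \<Longrightarrow> (\<lambda>n. x (r n) a) \<longlonglongrightarrow> l a"
      by (metis insertCI)
    have "bounded (range (\<lambda>n. x (r n) b))"
      unfolding bounded_iff using insert.prems[of b] by auto
    then obtain l' r' where r': "strict_mono (r' :: nat \<Rightarrow> nat)"
      and l': "((\<lambda>n. x (r n) b) \<circ> r') \<longlonglongrightarrow> l'"
      using bounded_imp_convergent_subsequence by metis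
    have "(\<lambda>n. x (r (r' n)) a) \<longlonglongrightarrow> (if a = b then l' else l a)" if "a \<in> insert b A" for a
      using l'[unfolded o_def] LIMSEQ_subseq_LIMSEQ[OF l r', of a] that by (auto simp: o_def)
    moreover have "strict_mono (r \<circ> r')"
      using r r' by (rule strict_mono_o)
    ultimately show ?case
      by (intro exI[of _ "\<lambda>n. r (r' n)"] exI[of _ "\<lambda>a. if a = b then l' else l a"]) (auto simp: o_def)
  qed
  then show ?thesis using that by blast
qed

context kirchhoff_problem
begin

text \<open>
  Only an upper bound on the net flux enters the a priori bound, so that it applies to
  subsolutions. This is why subsolutions rather than supersolutions are maximized below.
\<close>

lemma subsolutions_bounded:
  obtains R where "\<And>\<rho> U w a s. subsolution \<rho> U w \<Longrightarrow> \<bar>\<rho>\<bar> \<le> A \<Longrightarrow> a \<in> E \<Longrightarrow> s \<in> {0..len a} \<Longrightarrow>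
    \<bar>w a s\<bar> \<le> (R :: real)"
proof -
  define B where "B = (\<Sum>x\<in>V. \<eta> x * (\<bar>\<theta> x\<bar> + A))"
  obtain R where R: "\<And>w w' a s. coercive_family c q (\<lambda>a. C a + m a * A) w w' \<Longrightarrow>
      \<forall>x\<in>V. net \<kappa> w x \<le> B \<Longrightarrow> a \<in> E \<Longrightarrow> s \<in> {0..len a} \<Longrightarrow> \<bar>w a s\<bar> \<le> R"
    by (rule net_bound_imp_bounded[where \<kappa> = \<kappa> and c = c and C = "\<lambda>a. C a + m a * A" and B = B and q = q])
      (rule \<kappa>_pos c_pos q_gt_1 | assumption | rule that)+
  show ?thesis
  proof (rule that[of R])
    fix \<rho> U w a s
    assume w: "subsolution \<rho> U w" and \<rho>: "\<bar>\<rho>\<bar> \<le> A" and a: "a \<in> E" and s: "s \<in> {0..len a}"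
    have fl: "flow \<rho> U w"
      using w by (simp add: subsolution_def)
    show "\<bar>w a s\<bar> \<le> R"
    proof (rule R[where w' = "\<lambda>a s. f a s (w a s) + m a * \<rho>", OF _ _ a s];
        (unfold coercive_family_def)?; intro ballI)
      fix a s assume a: "a \<in> E" and s: "s \<in> {0..len a}"
      have "m a * (- A) \<le> m a * \<rho>"
        using m_pos[OF a] \<rho> by (intro mult_left_mono) auto
      then show "(w a has_real_derivative f a s (w a s) + m a * \<rho>) (at s within {0..len a}) \<and>
          c a * \<bar>w a s\<bar> powr q - (C a + m a * A) \<le> f a s (w a s) + m a * \<rho>"
        using coercive[OF a s, of "w a s"] ode_solD[OF flowD(1)[OF fl a] s] by simp
    next
      fix x assume x: "x \<in> V"
      have "net \<kappa> w x \<le> \<eta> x * (\<theta> x - \<rho>)"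
        using w x by (simp add: subsolution_def)
      also have "\<dots> \<le> \<eta> x * (\<bar>\<theta> x\<bar> + A)"
        using \<rho> \<eta>_nonneg[OF x] by (intro mult_left_mono) auto
      also have "\<dots> \<le> B"
        unfolding B_def using x finite_V \<rho> \<eta>_nonneg
        by (intro member_le_sum[of x V "\<lambda>x. \<eta> x * (\<bar>\<theta> x\<bar> + A)"]) (auto intro!: mult_nonneg_nonneg)
      finally show "net \<kappa> w x \<le> B" .
    qed
  qed
qed

text \<open>
  The bounds above make the starting values of the \<open>w a\<close> and the potentials, normalized at one
  vertex, converge along a subsequence.
\<close>

lemma subsolution_limit:
  assumes sub: "\<And>n. subsolution (\<rho> n) (U n) (w n)" and \<rho>: "\<rho> \<longlonglongrightarrow> \<rho>'"
  shows "\<exists>U w. subsolution \<rho>' U w"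
proof -
  have fl: "flow (\<rho> n) (U n) (w n)" for n
    using sub by (simp add: subsolution_def)
  obtain A where A: "\<And>n. \<bar>\<rho> n\<bar> \<le> A"
    using convergent_imp_bounded[OF \<rho>] unfolding bounded_iff by auto
  obtain R where R: "\<And>\<rho> U w a s. subsolution \<rho> U w \<Longrightarrow> \<bar>\<rho>\<bar> \<le> A \<Longrightarrow> a \<in> E \<Longrightarrow> s \<in> {0..len a} \<Longrightarrow>
    \<bar>w a s\<bar> \<le> (R :: real)"
    using subsolutions_bounded[of A] by blast
  have bd: "\<bar>w n a s\<bar> \<le> R" if "a \<in> E" "s \<in> {0..len a}" for n a s
    by (rule R[OF sub A that])
  obtain x0 where x0: "x0 \<in> V" using V_nonempty by blast
  obtain D where D: "\<And>U M x y. (\<And>a. a \<in> E \<Longrightarrow> \<bar>U (dst a) - U (org a)\<bar> \<le> M) \<Longrightarrow> x \<in> V \<Longrightarrow> y \<in> V \<Longrightarrow>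
      \<bar>U x - U y\<bar> \<le> D * (M :: real)"
    using potential_difference_bound by metis
  have incr: "\<bar>U n (dst a) - U n (org a)\<bar> \<le> (\<Sum>a\<in>E. R * len a)" if a: "a \<in> E" for n a
  proof -
    have "norm (integral {0..len a} (w n a)) \<le> R * (len a - 0)"
      by (rule integral_bound[OF _ ode_sol_continuous[OF flowD(1)[OF fl a]]])
        (use len_pos[OF a] bd[OF a] in auto)
    then have "\<bar>U n (dst a) - U n (org a)\<bar> \<le> R * len a"
      using flowD(2)[OF fl a, of n] by simp
    also have "\<dots> \<le> (\<Sum>a\<in>E. R * len a)"
    proof (rule member_le_sum[of a E "\<lambda>a. R * len a"])
      fix b assume "b \<in> E - {a}"
      then have b: "b \<in> E" by simp
      show "0 \<le> R * len b"
        using order_trans[OF abs_ge_zero bd[OF b, of 0]] len_pos[OF b] by simp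
    qed (use a finite_E in auto)
    finally show ?thesis .
  qed
  have "\<bar>U n x - U n x0\<bar> \<le> D * (\<Sum>a\<in>E. R * len a)" if "x \<in> V" for n x
    by (rule D[OF incr that x0])
  then obtain r1 U' where r1: "strict_mono (r1 :: nat \<Rightarrow> nat)"
    and U': "\<And>x. x \<in> V \<Longrightarrow> (\<lambda>n. U (r1 n) x - U (r1 n) x0) \<longlonglongrightarrow> U' x"
    using finite_family_convergent_subsequence[OF finite_V, of "\<lambda>n x. U n x - U n x0"] by metis
  have "\<bar>w (r1 n) a 0\<bar> \<le> R" if "a \<in> E" for n a
    using bd[OF that, of 0] len_pos[OF that] by simp
  then obtain r2 l where r2: "strict_mono (r2 :: nat \<Rightarrow> nat)"
    and l: "\<And>a. a \<in> E \<Longrightarrow> (\<lambda>n. w (r1 (r2 n)) a 0) \<longlonglongrightarrow> l a"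
    using finite_family_convergent_subsequence[OF finite_E, of "\<lambda>n a. w (r1 n) a 0"] by metis
  define r where "r n = r1 (r2 n)" for n
  have r: "strict_mono r"
    unfolding r_def using strict_mono_o[OF r1 r2] by (simp add: o_def)
  have \<rho>r: "(\<lambda>n. \<rho> (r n)) \<longlonglongrightarrow> \<rho>'"
    using LIMSEQ_subseq_LIMSEQ[OF \<rho> r] by (simp add: o_def)
  have Ur: "(\<lambda>n. U (r n) x - U (r n) x0) \<longlonglongrightarrow> U' x" if "x \<in> V" for x
    using LIMSEQ_subseq_LIMSEQ[OF U'[OF that] r2] by (simp add: o_def r_def)
  have "\<exists>v. ode_sol (f a) (m a * \<rho>') (len a) v \<and> (\<forall>s\<in>{0..len a}. (\<lambda>n. w (r n) a s) \<longlonglongrightarrow> v s) \<and>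
      (\<lambda>n. integral {0..len a} (w (r n) a)) \<longlonglongrightarrow> integral {0..len a} v" if a: "a \<in> E" for a
  proof -
    have lim: "(\<lambda>n. m a * \<rho> (r n)) \<longlonglongrightarrow> m a * \<rho>'"
      by (intro tendsto_intros \<rho>r)
    show ?thesis
      using ode_sol_limit[OF regular[OF a] len_pos[OF a] flowD(1)[OF fl a] bd[OF a] lim
          l[OF a, folded r_def]] by metis
  qed
  then obtain w' where w': "\<And>a. a \<in> E \<Longrightarrow> ode_sol (f a) (m a * \<rho>') (len a) (w' a)"
    and lim: "\<And>a s. a \<in> E \<Longrightarrow> s \<in> {0..len a} \<Longrightarrow> (\<lambda>n. w (r n) a s) \<longlonglongrightarrow> w' a s"
    and int: "\<And>a. a \<in> E \<Longrightarrow>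
      (\<lambda>n. integral {0..len a} (w (r n) a)) \<longlonglongrightarrow> integral {0..len a} (w' a)"
    by metis
  have "subsolution \<rho>' U' w'"
    unfolding subsolution_def flow_def potential_def
  proof (intro conjI ballI)
    fix a assume a: "a \<in> E"
    show "ode_sol (f a) (m a * \<rho>') (len a) (w' a)" by (rule w'[OF a])
    have "(\<lambda>n. (U (r n) (dst a) - U (r n) x0) - (U (r n) (org a) - U (r n) x0))
        \<longlonglongrightarrow> U' (dst a) - U' (org a)"
      by (intro tendsto_diff Ur org_in_V[OF a] dst_in_V[OF a])
    then have "(\<lambda>n. integral {0..len a} (w (r n) a)) \<longlonglongrightarrow> U' (dst a) - U' (org a)"
      by (simp add: flowD(2)[OF fl a])
    then show "integral {0..len a} (w' a) = U' (dst a) - U' (org a)"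
      using int[OF a] LIMSEQ_unique by blast
  next
    fix x assume x: "x \<in> V"
    have "(\<lambda>n. out (w (r n)) a x) \<longlonglongrightarrow> out w' a x" if "a \<in> E" for a
      using lim[OF that, of 0] lim[OF that, of "len a"] len_pos[OF that]
      by (auto simp: out_def intro: tendsto_minus)
    then have "(\<lambda>n. net \<kappa> (w (r n)) x) \<longlonglongrightarrow> net \<kappa> w' x"
      unfolding net_def by (intro tendsto_sum tendsto_mult tendsto_const) (auto dest: incD)
    moreover have "(\<lambda>n. \<eta> x * (\<theta> x - \<rho> (r n))) \<longlonglongrightarrow> \<eta> x * (\<theta> x - \<rho>')"
      by (intro tendsto_intros \<rho>r)
    ultimately show "net \<kappa> w' x \<le> \<eta> x * (\<theta> x - \<rho>')"
      by (rule LIMSEQ_le) (use sub x in \<open>auto simp: subsolution_def\<close>)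
  qed
  then show ?thesis by blast
qed

text \<open>The edgewise perturbation lemma, for all edges at once.\<close>

lemma flow_perturb:
  assumes w: "flow \<rho> U w" and \<epsilon>: "0 < \<epsilon>"
  obtains h where "0 < h"
    and "\<And>\<rho>' U'. \<bar>\<rho>' - \<rho>\<bar> \<le> h \<Longrightarrow> (\<And>x. x \<in> V \<Longrightarrow> \<bar>U' x - U x\<bar> \<le> h) \<Longrightarrow>
      \<exists>w'. flow \<rho>' U' w' \<and> (\<forall>x\<in>V. net \<kappa> w' x < net \<kappa> w x + \<epsilon>)"
proof -
  define \<epsilon>' where "\<epsilon>' = \<epsilon> / (\<Sum>x\<in>V. \<Sum>a\<in>inc x. \<kappa> x a)"
  have inner_pos: "0 < (\<Sum>a\<in>inc x. \<kappa> x a)" if x: "x \<in> V" for x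
    using finite_inc \<kappa>_pos[OF x] no_isolated_vertex[OF x] by (intro sum_pos) (auto simp: inc_def)
  have total_pos: "0 < (\<Sum>x\<in>V. \<Sum>a\<in>inc x. \<kappa> x a)"
    by (rule sum_pos[OF finite_V V_nonempty inner_pos])
  have \<epsilon>': "0 < \<epsilon>'"
    using \<epsilon> total_pos by (simp add: \<epsilon>'_def)
  have "\<exists>\<delta>>0. \<forall>r' d'. \<bar>r' - m a * \<rho>\<bar> < \<delta> \<longrightarrow> \<bar>d' - integral {0..len a} (w a)\<bar> < \<delta> \<longrightarrow>
      (\<exists>v'. ode_sol (f a) r' (len a) v' \<and> integral {0..len a} v' = d' \<and>
        (\<forall>s\<in>{0..len a}. \<bar>v' s - w a s\<bar> < \<epsilon>'))" if a: "a \<in> E" for a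
    using ode_sol_perturb[OF regular[OF a] len_pos[OF a] flowD(1)[OF w a] \<epsilon>'] by metis
  then obtain \<delta> where \<delta>: "\<And>a. a \<in> E \<Longrightarrow> 0 < \<delta> a"
    and pert: "\<And>a r' d'. a \<in> E \<Longrightarrow> \<bar>r' - m a * \<rho>\<bar> < \<delta> a \<Longrightarrow> \<bar>d' - integral {0..len a} (w a)\<bar> < \<delta> a \<Longrightarrow>
      \<exists>v'. ode_sol (f a) r' (len a) v' \<and> integral {0..len a} v' = d' \<and>
        (\<forall>s\<in>{0..len a}. \<bar>v' s - w a s\<bar> < \<epsilon>')"
    by metis
  \<comment> \<open>The increment of the potential changes by \<open>2 h\<close> at most, and \<open>m a * \<rho>\<close> by \<open>m a * h\<close>.\<close>
  define h where "h = Min ((\<lambda>a. \<delta> a / (3 + m a)) ` E)"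
  have h_le: "h * (3 + m a) \<le> \<delta> a" if "a \<in> E" for a
  proof -
    have "h \<le> \<delta> a / (3 + m a)"
      unfolding h_def using that finite_E by (intro Min_le) auto
    then show ?thesis
      using m_pos[OF that] by (simp add: pos_le_divide_eq)
  qed
  show ?thesis
  proof (rule that[of h])
    show h: "0 < h"
      unfolding h_def using finite_E edge_exists \<delta> m_pos
      by (subst Min_gr_iff) (auto intro!: divide_pos_pos add_pos_pos)
    fix \<rho>' U'
    assume \<rho>': "\<bar>\<rho>' - \<rho>\<bar> \<le> h" and U': "\<And>x. x \<in> V \<Longrightarrow> \<bar>U' x - U x\<bar> \<le> h"
    have "\<exists>v'. ode_sol (f a) (m a * \<rho>') (len a) v' \<and> integral {0..len a} v' = U' (dst a) - U' (org a) \<and>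
        (\<forall>s\<in>{0..len a}. \<bar>v' s - w a s\<bar> < \<epsilon>')" if a: "a \<in> E" for a
    proof (rule pert[OF a])
      have h': "h * 3 + h * m a \<le> \<delta> a"
        using h_le[OF a] by (simp add: algebra_simps)
      have "0 < h * m a" using h m_pos[OF a] by simp
      have "\<bar>m a * \<rho>' - m a * \<rho>\<bar> = m a * \<bar>\<rho>' - \<rho>\<bar>"
        using m_pos[OF a] by (simp add: abs_mult flip: right_diff_distrib)
      also have "\<dots> \<le> m a * h"
        using \<rho>' m_pos[OF a] by (intro mult_left_mono) auto
      finally show "\<bar>m a * \<rho>' - m a * \<rho>\<bar> < \<delta> a"
        using h h' by (simp add: mult.commute)
      show "\<bar>U' (dst a) - U' (org a) - integral {0..len a} (w a)\<bar> < \<delta> a"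
        using U'[OF dst_in_V[OF a]] U'[OF org_in_V[OF a]] flowD(2)[OF w a] h h' \<open>0 < h * m a\<close>
        by linarith
    qed
    then obtain w' where w': "\<And>a. a \<in> E \<Longrightarrow> ode_sol (f a) (m a * \<rho>') (len a) (w' a)"
      "\<And>a. a \<in> E \<Longrightarrow> integral {0..len a} (w' a) = U' (dst a) - U' (org a)"
      and close: "\<And>a s. a \<in> E \<Longrightarrow> s \<in> {0..len a} \<Longrightarrow> \<bar>w' a s - w a s\<bar> < \<epsilon>'"
      by metis
    have "net \<kappa> w' x < net \<kappa> w x + \<epsilon>" if x: "x \<in> V" for x
    proof -
      have "net \<kappa> w' x < (\<Sum>a\<in>inc x. \<kappa> x a * (out w a x + \<epsilon>'))"
        unfolding net_def
      proof (rule sum_strict_mono[OF finite_inc])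
        show "inc x \<noteq> {}"
          using no_isolated_vertex[OF x] by (auto simp: inc_def)
        fix a assume a: "a \<in> inc x"
        have "out w' a x < out w a x + \<epsilon>'"
          using close[OF incD(1)[OF a], of 0] close[OF incD(1)[OF a], of "len a"]
            len_pos[OF incD(1)[OF a]] by (auto simp: out_def abs_less_iff)
        then show "\<kappa> x a * out w' a x < \<kappa> x a * (out w a x + \<epsilon>')"
          using \<kappa>_pos[OF x a] by simp
      qed
      also have "\<dots> = net \<kappa> w x + \<epsilon>' * (\<Sum>a\<in>inc x. \<kappa> x a)"
        by (simp add: net_def distrib_left sum.distrib sum_distrib_left mult.commute)
      also have "\<epsilon>' * (\<Sum>a\<in>inc x. \<kappa> x a) \<le> \<epsilon>' * (\<Sum>x\<in>V. \<Sum>a\<in>inc x. \<kappa> x a)"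
        using \<epsilon>' x finite_V inner_pos
        by (intro mult_left_mono member_le_sum[of x V "\<lambda>x. \<Sum>a\<in>inc x. \<kappa> x a"]) (auto intro: less_imp_le)
      also have "\<dots> = \<epsilon>"
        using total_pos by (simp add: \<epsilon>'_def)
      finally show ?thesis by simp
    qed
    with w' show "\<exists>w'. flow \<rho>' U' w' \<and> (\<forall>x\<in>V. net \<kappa> w' x < net \<kappa> w x + \<epsilon>)"
      by (auto simp: flow_def potential_def)
  qed
qed

definition strict_verts :: "real \<Rightarrow> ('e \<Rightarrow> real \<Rightarrow> real) \<Rightarrow> 'v set" where
  "strict_verts \<rho> w = {x \<in> V. net \<kappa> w x < \<eta> x * (\<theta> x - \<rho>)}"

text \<open>
  Raising the potential slightly at a strict vertex \<open>x\<close> keeps \<open>x\<close> strict and lowers the fluxes at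
  the far ends of the edges from \<open>x\<close>, which makes all neighbours of \<open>x\<close> strict.
\<close>

lemma strictness_spreads:
  assumes w: "subsolution \<rho> U w" and x: "x \<in> strict_verts \<rho> w"
  obtains U' w' where "subsolution \<rho> U' w'" and "strict_verts \<rho> w \<subseteq> strict_verts \<rho> w'"
    and "\<And>a. a \<in> inc x \<Longrightarrow> org a \<in> strict_verts \<rho> w' \<and> dst a \<in> strict_verts \<rho> w'"
proof -
  have xV: "x \<in> V" and gap: "0 < \<eta> x * (\<theta> x - \<rho>) - net \<kappa> w x"
    using x by (auto simp: strict_verts_def)
  have fl: "flow \<rho> U w" and sub: "\<And>y. y \<in> V \<Longrightarrow> net \<kappa> w y \<le> \<eta> y * (\<theta> y - \<rho>)"
    using w by (auto simp: subsolution_def)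
  obtain h where h: "0 < h" and pert: "\<And>\<rho>' U'. \<bar>\<rho>' - \<rho>\<bar> \<le> h \<Longrightarrow>
      (\<And>y. y \<in> V \<Longrightarrow> \<bar>U' y - U y\<bar> \<le> h) \<Longrightarrow>
      \<exists>w'. flow \<rho>' U' w' \<and> (\<forall>y\<in>V. net \<kappa> w' y < net \<kappa> w y + (\<eta> x * (\<theta> x - \<rho>) - net \<kappa> w x))"
    using flow_perturb[OF fl gap] by metis
  define U' where "U' = U(x := U x + h)"
  obtain w' where fl': "flow \<rho> U' w'"
    and near: "\<And>y. y \<in> V \<Longrightarrow> net \<kappa> w' y < net \<kappa> w y + (\<eta> x * (\<theta> x - \<rho>) - net \<kappa> w x)"
  proof -
    have "\<bar>U' y - U y\<bar> \<le> h" for y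
      using h by (simp add: U'_def)
    then show ?thesis
      using pert[of \<rho> U'] h that by auto
  qed
  have out: "out w' a y \<le> out w a y \<and> (a \<in> inc x \<longrightarrow> out w' a y < out w a y)"
    if a: "a \<in> inc y" and y: "y \<noteq> x" for a y
  proof -
    note aE = incD(1)[OF a]
    note ne = org_neq_dst[OF aE]
    note fwd = ode_sol_order[OF regular[OF aE] len_pos[OF aE] flowD(1)[OF fl aE] flowD(1)[OF fl' aE],
        unfolded flowD(2)[OF fl aE] flowD(2)[OF fl' aE]]
    note bwd = ode_sol_order[OF regular[OF aE] len_pos[OF aE] flowD(1)[OF fl' aE] flowD(1)[OF fl aE],
        unfolded flowD(2)[OF fl aE] flowD(2)[OF fl' aE]]
    show ?thesis
      using fwd bwd incD(2)[OF a] y ne h by (auto simp: out_def U'_def inc_def)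
  qed
  have le: "net \<kappa> w' y \<le> net \<kappa> w y" if y: "y \<in> V" "y \<noteq> x" for y
    unfolding net_def
    using out[OF _ y(2)] \<kappa>_pos[OF y(1)] by (intro sum_mono mult_left_mono) (auto simp: less_imp_le)
  have less: "net \<kappa> w' y < net \<kappa> w y" if y: "y \<in> V" "y \<noteq> x" and a: "a \<in> inc x" "a \<in> inc y" for y a
    unfolding net_def
  proof (rule sum_strict_mono_ex1[OF finite_inc])
    show "\<forall>b\<in>inc y. \<kappa> y b * out w' b y \<le> \<kappa> y b * out w b y"
      using out[OF _ y(2)] \<kappa>_pos[OF y(1)] by (intro ballI mult_left_mono) (auto simp: less_imp_le)
    show "\<exists>b\<in>inc y. \<kappa> y b * out w' b y < \<kappa> y b * out w b y"
      using out[OF a(2) y(2)] \<kappa>_pos[OF y(1) a(2)] a by (intro bexI[of _ a]) auto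
  qed
  have xs: "x \<in> strict_verts \<rho> w'"
    using near[OF xV] xV by (simp add: strict_verts_def)
  show ?thesis
  proof (rule that)
    show "subsolution \<rho> U' w'"
      unfolding subsolution_def
    proof (intro conjI ballI fl')
      fix y assume y: "y \<in> V"
      show "net \<kappa> w' y \<le> \<eta> y * (\<theta> y - \<rho>)"
        using xs le[OF y] sub[OF y] by (cases "y = x") (auto simp: strict_verts_def)
    qed
    show "strict_verts \<rho> w \<subseteq> strict_verts \<rho> w'"
    proof
      fix y assume y: "y \<in> strict_verts \<rho> w"
      then show "y \<in> strict_verts \<rho> w'"
        using xs le[of y] by (cases "y = x") (auto simp: strict_verts_def)
    qed
    fix a assume a: "a \<in> inc x"
    note aE = incD(1)[OF a]
    have "y \<in> strict_verts \<rho> w'" if "y = org a \<or> y = dst a" for y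
    proof (cases "y = x")
      case False
      have y: "y \<in> V" "a \<in> inc y"
        using that org_in_V[OF aE] dst_in_V[OF aE] aE by (auto simp: inc_def)
      show ?thesis
        using less[OF y(1) False a y(2)] sub[OF y(1)] y by (simp add: strict_verts_def)
    qed (use xs in auto)
    then show "org a \<in> strict_verts \<rho> w' \<and> dst a \<in> strict_verts \<rho> w'" by blast
  qed
qed

lemma strict_everywhere_imp_larger:
  assumes w: "subsolution \<rho> U w" and strict: "strict_verts \<rho> w = V"
  shows "\<exists>\<rho>'>\<rho>. \<exists>U w. subsolution \<rho>' U w"
proof -
  have fl: "flow \<rho> U w"
    using w by (simp add: subsolution_def)
  define g where "g = Min ((\<lambda>x. \<eta> x * (\<theta> x - \<rho>) - net \<kappa> w x) ` V)"
  have g_le: "net \<kappa> w x + g \<le> \<eta> x * (\<theta> x - \<rho>)" if "x \<in> V" for x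
  proof -
    have "g \<le> \<eta> x * (\<theta> x - \<rho>) - net \<kappa> w x"
      unfolding g_def using that finite_V by (intro Min_le) auto
    then show ?thesis by simp
  qed
  have "0 < g"
    unfolding g_def using finite_V V_nonempty strict by (subst Min_gr_iff) (auto simp: strict_verts_def)
  then have g: "0 < g / 2" by simp
  obtain h where h: "0 < h" and pert: "\<And>\<rho>' U'. \<bar>\<rho>' - \<rho>\<bar> \<le> h \<Longrightarrow>
      (\<And>y. y \<in> V \<Longrightarrow> \<bar>U' y - U y\<bar> \<le> h) \<Longrightarrow>
      \<exists>w'. flow \<rho>' U' w' \<and> (\<forall>y\<in>V. net \<kappa> w' y < net \<kappa> w y + g / 2)"
    using flow_perturb[OF fl g] by metis
  \<comment> \<open>Raising \<open>\<rho>\<close> by \<open>k\<close> lowers the right-hand sides by at most \<open>k * N\<close>, which is half of the gap.\<close>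
  define N where "N = 1 + (\<Sum>x\<in>V. \<eta> x)"
  have N: "0 < N" "\<And>x. x \<in> V \<Longrightarrow> \<eta> x \<le> N"
    using \<eta>_nonneg finite_V member_le_sum[of _ V \<eta>]
    by (auto simp: N_def sum_nonneg add_pos_nonneg intro: order_trans[of _ "sum \<eta> V"])
  define k where "k = min h (g / 2 / N)"
  have k: "0 < k" "k \<le> h" and "k \<le> g / 2 / N"
    using h g N(1) by (auto simp: k_def)
  then have kN: "k * N \<le> g / 2"
    using N(1) by (simp add: pos_le_divide_eq)
  obtain w' where w': "flow (\<rho> + k) U w'" "\<And>y. y \<in> V \<Longrightarrow> net \<kappa> w' y < net \<kappa> w y + g / 2"
    using pert[of "\<rho> + k" U] k h by auto
  have "subsolution (\<rho> + k) U w'"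
    unfolding subsolution_def
  proof (intro conjI ballI w'(1))
    fix x assume x: "x \<in> V"
    have "\<eta> x * k \<le> N * k"
      using N(2)[OF x] k(1) by (intro mult_right_mono) auto
    then have "\<eta> x * k \<le> g / 2"
      using kN by (simp add: mult.commute)
    then show "net \<kappa> w' x \<le> \<eta> x * (\<theta> x - (\<rho> + k))"
      using w'(2)[OF x] g_le[OF x] by (simp add: algebra_simps)
  qed
  then show ?thesis
    using k(1) by (intro exI[of _ "\<rho> + k"]) auto
qed

text \<open>
  Among the subsolutions for the largest possible \<open>\<rho>\<close>, take one with the largest number of strict
  vertices. By \<open>strictness_spreads\<close> these vertices are closed under passing to neighbours, so they
  are all vertices or none, and the former contradicts the choice of \<open>\<rho>\<close>.
\<close>

lemma solution_exists: "\<exists>\<rho> U w. solution \<rho> U w"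
proof -
  define S where "S = {\<rho>. \<exists>U w. subsolution \<rho> U w}"
  obtain A where A: "\<And>a s. a \<in> E \<Longrightarrow> s \<in> {0..len a} \<Longrightarrow> \<bar>f a s 0\<bar> \<le> m a * A"
    "\<And>x. x \<in> V \<Longrightarrow> \<bar>\<theta> x\<bar> \<le> A"
    by (rule rhs_at_zero_bounded) (rule that; assumption)
  have "\<rho> \<le> A" if "\<rho> \<in> S" for \<rho>
  proof -
    obtain U w where "subsolution \<rho> U w" using \<open>\<rho> \<in> S\<close> by (auto simp: S_def)
    then show ?thesis
      by (rule subsolution_upper_bound) (use A in \<open>auto simp: abs_le_iff minus_le_iff\<close>)
  qed
  then have bdd: "bdd_above S" by (rule bdd_aboveI)
  have "S \<noteq> {}"
    using subsolution_exists by (auto simp: S_def)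
  define \<rho> where "\<rho> = Sup S"
  obtain \<rho>s where "\<And>n. \<rho>s n \<in> S" and lim: "\<rho>s \<longlonglongrightarrow> \<rho>"
    using closure_contains_Sup[OF \<open>S \<noteq> {}\<close> bdd] unfolding closure_sequential \<rho>_def by blast
  then obtain Us ws where "\<And>n. subsolution (\<rho>s n) (Us n) (ws n)"
    unfolding S_def by (simp, metis)
  then have attained: "\<exists>U w. subsolution \<rho> U w"
    using lim by (rule subsolution_limit)
  define P where "P k \<longleftrightarrow> (\<exists>U w. subsolution \<rho> U w \<and> card (strict_verts \<rho> w) = k)" for k
  have sub: "strict_verts \<rho> w \<subseteq> V" for w
    by (auto simp: strict_verts_def)
  have fin: "finite (strict_verts \<rho> w)" and card: "card (strict_verts \<rho> w) \<le> card V" for w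
    by (rule finite_subset[OF sub finite_V], rule card_mono[OF finite_V sub])
  obtain k0 where "P k0" using attained by (auto simp: P_def)
  moreover have "\<And>k. P k \<Longrightarrow> k \<le> card V" using card by (auto simp: P_def)
  ultimately obtain k where "P k" and max: "\<And>j. P j \<Longrightarrow> j \<le> k"
    using Nat.ex_has_greatest_nat[of P k0 "card V"] by blast
  then obtain U w where w: "subsolution \<rho> U w" and k: "card (strict_verts \<rho> w) = k"
    by (auto simp: P_def)
  have "strict_verts \<rho> w = {}"
  proof (rule ccontr)
    assume nonempty: "strict_verts \<rho> w \<noteq> {}"
    have closed: "org a \<in> strict_verts \<rho> w \<and> dst a \<in> strict_verts \<rho> w"
      if x: "x \<in> strict_verts \<rho> w" and a: "a \<in> inc x" for x a
    proof -
      obtain U' w' where w': "subsolution \<rho> U' w'" "strict_verts \<rho> w \<subseteq> strict_verts \<rho> w'"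
        "org a \<in> strict_verts \<rho> w' \<and> dst a \<in> strict_verts \<rho> w'"
        using strictness_spreads[OF w x] a by metis
      have "card (strict_verts \<rho> w') \<le> card (strict_verts \<rho> w)"
        using max w'(1) k by (auto simp: P_def)
      then have "strict_verts \<rho> w = strict_verts \<rho> w'"
        using w'(2) fin by (intro card_seteq)
      with w'(3) show ?thesis by simp
    qed
    have "strict_verts \<rho> w = V"
    proof (rule connected_graph)
      show "strict_verts \<rho> w \<subseteq> V" by (auto simp: strict_verts_def)
      show "strict_verts \<rho> w \<noteq> {}" by (rule nonempty)
      show "org a \<in> strict_verts \<rho> w \<longleftrightarrow> dst a \<in> strict_verts \<rho> w" if "a \<in> E" for a
        using closed[of "org a" a] closed[of "dst a" a] that by (auto simp: inc_def)
    qed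
    with strict_everywhere_imp_larger[OF w] obtain \<rho>' where "\<rho> < \<rho>'" "\<rho>' \<in> S"
      by (auto simp: S_def)
    with cSup_upper[OF _ bdd] show False by (force simp: \<rho>_def)
  qed
  then have "solution \<rho> U w"
    using w by (force simp: solution_def subsolution_def strict_verts_def)
  then show ?thesis by blast
qed

end

section \<open>Networks as metric graphs\<close>

lemma edge_param_0: "edge_param N a 0 = src N a"
  by (simp add: edge_param_def)

lemma edge_param_len: "0 < edge_len N a \<Longrightarrow> edge_param N a (edge_len N a) = tgt N a"
  by (simp add: edge_param_def)

lemma edge_param_in_edge_set:
  assumes "0 < edge_len N a" and "s \<in> {0..edge_len N a}"
  shows "edge_param N a s \<in> edge_set N a"
proof -
  have "edge_param N a s = (1 - s / edge_len N a) *\<^sub>R src N a + (s / edge_len N a) *\<^sub>R tgt N a"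
    by (simp add: edge_param_def algebra_simps divide_inverse)
  moreover have "0 \<le> s / edge_len N a" "s / edge_len N a \<le> 1"
    using assms by auto
  ultimately show ?thesis
    unfolding edge_set_def in_segment by blast
qed

lemma edge_setE:
  assumes "0 < edge_len N a" and "x \<in> edge_set N a"
  obtains s where "s \<in> {0..edge_len N a}" and "x = edge_param N a s"
proof -
  obtain u where u: "0 \<le> u" "u \<le> 1" "x = (1 - u) *\<^sub>R src N a + u *\<^sub>R tgt N a"
    using assms(2) unfolding edge_set_def in_segment by blast
  have "x = edge_param N a (u * edge_len N a)"
    using assms(1) u(3) by (simp add: edge_param_def algebra_simps)
  moreover have "u * edge_len N a \<in> {0..edge_len N a}"
    using u assms(1) by (auto simp: mult_left_le_one_le)
  ultimately show ?thesis using that by blast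
qed

lemma dist_src_edge_param:
  assumes "0 < edge_len N a" and "0 \<le> s"
  shows "dist (src N a) (edge_param N a s) = s"
proof -
  have "dist (src N a) (edge_param N a s) = norm ((s / edge_len N a) *\<^sub>R (tgt N a - src N a))"
    by (simp add: edge_param_def dist_norm divide_inverse)
  also have "\<dots> = (s / edge_len N a) * edge_len N a"
    using assms by (simp add: edge_len_def dist_norm norm_minus_commute)
  also have "\<dots> = s" using assms(1) by simp
  finally show ?thesis .
qed

lemma continuous_on_edge_param: "continuous_on S (edge_param N a)"
  unfolding edge_param_def by (intro continuous_intros)

lemma ends_in_edge_set: "v \<in> edge_ends N a \<Longrightarrow> v \<in> edge_set N a"
  by (auto simp: edge_ends_def edge_set_def)

lemma network_edge:
  assumes "network N" and "a \<in> edges N"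
  shows "src N a \<in> verts N" and "tgt N a \<in> verts N" and "src N a \<noteq> tgt N a" and "0 < edge_len N a"
proof -
  have pair: "(src N a, tgt N a) \<in> pairs N \<or> (tgt N a, src N a) \<in> pairs N"
    and sub: "pairs N \<subseteq> verts N \<times> verts N" and irrefl: "\<And>v. (v, v) \<notin> pairs N"
    using assms by (auto simp: network_def)
  show "src N a \<in> verts N" "tgt N a \<in> verts N"
    using pair sub by blast+
  show "src N a \<noteq> tgt N a"
    using pair irrefl by metis
  then show "0 < edge_len N a" by (simp add: edge_len_def)
qed

lemma network_intersection:
  assumes "network N" and "a \<in> edges N" and "b \<in> edges N" and "a \<noteq> b"
    and "x \<in> edge_set N a" and "x \<in> edge_set N b"
  shows "x \<in> edge_ends N a" and "x \<in> edge_ends N b" and "edge_ends N a \<inter> edge_ends N b = {x}"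
proof -
  have 1: "\<And>v. v \<in> edge_ends N a \<inter> edge_ends N b \<Longrightarrow> edge_set N a \<inter> edge_set N b = {v}"
    and 2: "edge_ends N a \<inter> edge_ends N b = {} \<Longrightarrow> edge_set N a \<inter> edge_set N b = {}"
    using assms(1-4) unfolding network_def by blast+
  obtain v where v: "v \<in> edge_ends N a \<inter> edge_ends N b"
    using 2 assms(5,6) by blast
  have "x = v" using 1[OF v] assms(5,6) by (metis IntI singletonD)
  moreover have "y = x" if "y \<in> edge_ends N a \<inter> edge_ends N b" for y
    using 1[OF that] assms(5,6) by (metis IntI singletonD)
  ultimately show "x \<in> edge_ends N a" "x \<in> edge_ends N b" "edge_ends N a \<inter> edge_ends N b = {x}"
    using v by blast+
qed

lemma vertex_has_edge:
  assumes "network N" and "v \<in> verts N"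
  obtains a where "a \<in> edges N" and "v \<in> edge_ends N a"
proof -
  obtain w where "(v, w) \<in> pairs N \<or> (w, v) \<in> pairs N"
    using assms unfolding network_def by meson
  moreover have "\<forall>(v, w)\<in>pairs N. \<exists>a\<in>edges N. edge_ends N a = {v, w}"
    using assms(1) by (simp add: network_def)
  ultimately show ?thesis using that by fastforce
qed

text \<open>
  A vertex is an end point of some edge, and this edge meets any other edge in common end points
  only. So vertices do not lie in the interior of edges.
\<close>

lemma vertex_in_edge_set_iff:
  assumes N: "network N" and a: "a \<in> edges N" and v: "v \<in> verts N"
  shows "v \<in> edge_set N a \<longleftrightarrow> v \<in> edge_ends N a"
proof
  assume va: "v \<in> edge_set N a"
  obtain b where b: "b \<in> edges N" "v \<in> edge_ends N b"
    using vertex_has_edge[OF N v] .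
  show "v \<in> edge_ends N a"
  proof (cases "a = b")
    case False
    show ?thesis
      by (rule network_intersection(1)[OF N a b(1) False va ends_in_edge_set[OF b(2)]])
  qed (use b in simp)
qed (rule ends_in_edge_set)

lemma edge_param_not_vertex:
  assumes N: "network N" and a: "a \<in> edges N" and s: "s \<in> {0<..<edge_len N a}"
  shows "edge_param N a s \<notin> verts N"
proof
  note L = network_edge(4)[OF N a]
  assume "edge_param N a s \<in> verts N"
  then have "edge_param N a s = src N a \<or> edge_param N a s = tgt N a"
    using vertex_in_edge_set_iff[OF N a, of "edge_param N a s"] edge_param_in_edge_set[OF L, of s] s
    by (auto simp: edge_ends_def)
  then have "dist (src N a) (edge_param N a s) \<in> {0, edge_len N a}"
    by (auto simp: edge_len_def)
  with dist_src_edge_param[OF L, of s] s show False by auto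
qed

text \<open>
  Two edges at a boundary vertex would both end at its unique neighbour, but distinct edges have
  at most one end point in common.
\<close>

lemma bdry_vertex_incident:
  assumes N: "network N" and v: "v \<in> bdry_verts N"
  obtains a where "incident N v = {a}"
proof -
  have vV: "v \<in> verts N" and uniq: "\<exists>!w. w \<in> verts N \<and> ((v, w) \<in> pairs N \<or> (w, v) \<in> pairs N)"
    using v by (auto simp: bdry_verts_def)
  have ends: "\<exists>w. edge_ends N a = {v, w} \<and> v \<noteq> w \<and> w \<in> verts N \<and> ((v, w) \<in> pairs N \<or> (w, v) \<in> pairs N)"
    if "a \<in> incident N v" for a
  proof -
    have a: "a \<in> edges N" "v \<in> edge_ends N a"
      using that vertex_in_edge_set_iff[OF N _ vV] by (auto simp: incident_def)
    have "(src N a, tgt N a) \<in> pairs N \<or> (tgt N a, src N a) \<in> pairs N"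
      using N a(1) by (auto simp: network_def)
    then show ?thesis
      using a(2) network_edge[OF N a(1)]
      by (intro exI[of _ "if v = src N a then tgt N a else src N a"]) (auto simp: edge_ends_def)
  qed
  obtain a where a: "a \<in> edges N" "v \<in> edge_ends N a"
    using vertex_has_edge[OF N vV] .
  then have a_inc: "a \<in> incident N v"
    using ends_in_edge_set by (auto simp: incident_def)
  have "b = a" if b: "b \<in> incident N v" for b
  proof (rule ccontr)
    assume ne: "b \<noteq> a"
    obtain w where w: "edge_ends N a = {v, w}" "v \<noteq> w" "edge_ends N b = {v, w}"
      using ends[OF a_inc] ends[OF b] uniq by blast
    have "edge_ends N b \<inter> edge_ends N a = {v}"
      by (rule network_intersection(3)[OF N _ a(1) ne])
        (use b ends_in_edge_set[OF a(2)] in \<open>auto simp: incident_def\<close>)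
    with w show False by auto
  qed
  with a_inc show ?thesis using that[of a] by blast
qed

text \<open>
  If no edge leaves a set \<open>S\<close> of vertices, then the edges within \<open>S\<close> and the other edges form two
  disjoint closed sets that cover the network.
\<close>

lemma network_vertices_connected:
  assumes N: "network N" and S: "S \<subseteq> verts N" "S \<noteq> {}"
    and closed: "\<And>a. a \<in> edges N \<Longrightarrow> src N a \<in> S \<longleftrightarrow> tgt N a \<in> S"
  shows "S = verts N"
proof (rule ccontr)
  assume "S \<noteq> verts N"
  define A where "A = (\<Union>a\<in>{a \<in> edges N. src N a \<in> S}. edge_set N a)"
  define B where "B = (\<Union>a\<in>{a \<in> edges N. src N a \<notin> S}. edge_set N a)"
  have fin: "finite (edges N)" and conn: "connected (net_set N)"
    using N by (auto simp: network_def)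
  have "closed A" "closed B"
    unfolding A_def B_def edge_set_def using fin by (auto intro!: closed_UN)
  moreover have cover: "net_set N = A \<union> B"
    by (auto simp: net_set_def A_def B_def)
  moreover have "A \<inter> B = {}"
  proof (rule ccontr)
    assume "A \<inter> B \<noteq> {}"
    then obtain x a b where a: "a \<in> edges N" "src N a \<in> S" "x \<in> edge_set N a"
      and b: "b \<in> edges N" "src N b \<notin> S" "x \<in> edge_set N b"
      by (auto simp: A_def B_def)
    have "x \<in> edge_ends N a" "x \<in> edge_ends N b"
      using network_intersection[OF N a(1) b(1) _ a(3) b(3)] a b by blast+
    then show False
      using closed[OF a(1)] closed[OF b(1)] a b by (auto simp: edge_ends_def)
  qed
  moreover have "A \<noteq> {}"
  proof -
    obtain v where v: "v \<in> S" using S by blast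
    obtain a where "a \<in> edges N" "v \<in> edge_ends N a"
      using vertex_has_edge[OF N] v S by blast
    then show ?thesis
      using closed v ends_in_edge_set[of v N a] by (auto simp: A_def edge_ends_def)
  qed
  moreover have "B \<noteq> {}"
  proof -
    obtain v where v: "v \<in> verts N" "v \<notin> S" using S \<open>S \<noteq> verts N\<close> by blast
    obtain a where "a \<in> edges N" "v \<in> edge_ends N a"
      using vertex_has_edge[OF N v(1)] by blast
    then show ?thesis
      using closed v ends_in_edge_set[of v N a] by (auto simp: B_def edge_ends_def)
  qed
  ultimately show False
    using connected_closedD[OF conn, of A B] by auto
qed

lemma network_metric_graph:
  assumes N: "network N"
  shows "metric_graph (verts N) (edges N) (src N) (tgt N) (edge_len N)"
proof
  show "finite (verts N)" "verts N \<noteq> {}" "finite (edges N)"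
    using N by (auto simp: network_def)
  show "\<exists>a\<in>edges N. x = src N a \<or> x = tgt N a" if "x \<in> verts N" for x
    using vertex_has_edge[OF N that] by (auto simp: edge_ends_def)
  show "S = verts N" if "S \<subseteq> verts N" "S \<noteq> {}"
    "\<And>a. a \<in> edges N \<Longrightarrow> (src N a \<in> S) = (tgt N a \<in> S)" for S
    by (rule network_vertices_connected[OF N that])
qed (use network_edge[OF N] in auto)

lemma inc_eq_incident:
  assumes N: "network N" and v: "v \<in> verts N"
  shows "metric_graph.inc (edges N) (src N) (tgt N) v = incident N v"
  using vertex_in_edge_set_iff[OF N _ v]
  by (auto simp: metric_graph.inc_def[OF network_metric_graph[OF N]] incident_def edge_ends_def)

section \<open>Derivatives along an edge\<close>

lemma closure_open_Icc: "0 < L \<Longrightarrow> closure {0<..<L} = {0..L :: real}"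
  by (rule closure_greaterThanLessThan)

lemma deriv_Icc_eq:
  assumes L: "0 < L" and s: "s \<in> {0..L}"
    and g: "(g has_real_derivative d) (at s within {0..L})" and eq: "\<And>t. t \<in> {0..L} \<Longrightarrow> h t = g t"
  shows "deriv_Icc L h s = d"
proof -
  have "(h has_vector_derivative d) (at s within {0..L})"
    by (rule has_vector_derivative_transform[OF s])
      (use eq g in \<open>auto simp: has_real_derivative_iff_has_vector_derivative\<close>)
  then show ?thesis
    unfolding deriv_Icc_def using vector_derivative_within_cbox[of 0 L s h d] L s by simp
qed

lemma deriv_Icc_works:
  assumes "g differentiable_on {0..L}" and "s \<in> {0..L}"
  shows "(g has_real_derivative deriv_Icc L g s) (at s within {0..L})"
  using assms unfolding deriv_Icc_def has_real_derivative_iff_has_vector_derivative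
  by (simp add: differentiable_on_def vector_derivative_works)

lemma has_real_derivative_imp_differentiable_on:
  assumes "\<And>s. s \<in> S \<Longrightarrow> (g has_real_derivative d s) (at s within S)"
  shows "g differentiable_on S"
  using assms by (auto simp: differentiable_on_def real_differentiable_def)

lemma differentiable_on_cong:
  assumes "g differentiable_on S" and "\<And>s. s \<in> S \<Longrightarrow> h s = g s"
  shows "h differentiable_on S"
  using assms differentiable_transform_within[of g _ S 1 h] by (auto simp: differentiable_on_def)

lemma Ck_Icc_2D:
  assumes "Ck_Icc 2 L g" and "s \<in> {0..L}"
  shows "(g has_real_derivative deriv_Icc L g s) (at s within {0..L})"
    and "(deriv_Icc L g has_real_derivative deriv_Icc L (deriv_Icc L g) s) (at s within {0..L})"
    and "continuous_on {0..L} (deriv_Icc L (deriv_Icc L g))"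
proof -
  have d: "(deriv_Icc L ^^ j) g differentiable_on {0..L}" if "j < 2" for j
    using assms(1) that by (simp add: Ck_Icc_def)
  show "(g has_real_derivative deriv_Icc L g s) (at s within {0..L})"
    using deriv_Icc_works[OF _ assms(2)] d[of 0] by simp
  show "(deriv_Icc L g has_real_derivative deriv_Icc L (deriv_Icc L g) s) (at s within {0..L})"
    using deriv_Icc_works[OF _ assms(2)] d[of 1] by simp
  have "continuous_on {0..L} ((deriv_Icc L ^^ 2) g)"
    using assms(1) by (simp add: Ck_Icc_def)
  then show "continuous_on {0..L} (deriv_Icc L (deriv_Icc L g))"
    by (simp add: numeral_2_eq_2)
qed

lemma Ck_Icc_2I:
  assumes L: "0 < L"
    and g: "\<And>s. s \<in> {0..L} \<Longrightarrow> (g has_real_derivative g1 s) (at s within {0..L})"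
    and g1: "\<And>s. s \<in> {0..L} \<Longrightarrow> (g1 has_real_derivative g2 s) (at s within {0..L})"
    and g2: "continuous_on {0..L} g2" and h: "\<And>s. s \<in> {0..L} \<Longrightarrow> h s = g s"
  shows "Ck_Icc 2 L h" and "s \<in> {0..L} \<Longrightarrow> deriv_Icc L h s = g1 s"
    and "s \<in> {0..L} \<Longrightarrow> deriv_Icc L (deriv_Icc L h) s = g2 s"
proof -
  have d1: "deriv_Icc L h s = g1 s" if "s \<in> {0..L}" for s
    by (rule deriv_Icc_eq[OF L that g[OF that] h])
  have d2: "deriv_Icc L (deriv_Icc L h) s = g2 s" if "s \<in> {0..L}" for s
    by (rule deriv_Icc_eq[OF L that g1[OF that] d1])
  show "s \<in> {0..L} \<Longrightarrow> deriv_Icc L h s = g1 s" "s \<in> {0..L} \<Longrightarrow> deriv_Icc L (deriv_Icc L h) s = g2 s"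
    by (rule d1, assumption) (rule d2, assumption)
  have diff: "h differentiable_on {0..L}" "deriv_Icc L h differentiable_on {0..L}"
    using differentiable_on_cong[OF has_real_derivative_imp_differentiable_on[OF g] h]
      differentiable_on_cong[OF has_real_derivative_imp_differentiable_on[OF g1] d1] by auto
  have cont: "continuous_on {0..L} (deriv_Icc L (deriv_Icc L h))"
    using g2 d2 by (metis (no_types, lifting) continuous_on_cong)
  show "Ck_Icc 2 L h"
    unfolding Ck_Icc_def
  proof (intro conjI allI impI)
    fix j :: nat
    assume "j < 2"
    then have "j = 0 \<or> j = 1" by auto
    then show "(deriv_Icc L ^^ j) h differentiable_on {0..L}" using diff by auto
  next
    fix j :: nat
    assume "j \<le> 2"
    then have "j = 0 \<or> j = 1 \<or> j = 2" by auto
    then show "continuous_on {0..L} ((deriv_Icc L ^^ j) h)"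
      using diff[THEN differentiable_imp_continuous_on] cont by (auto simp: numeral_2_eq_2)
  qed
qed

lemma edge_deriv_1: "edge_deriv N 1 u a = deriv_Icc (edge_len N a) (on_edge N u a)"
  by (simp add: edge_deriv_def)

lemma edge_deriv_2:
  "edge_deriv N 2 u a = deriv_Icc (edge_len N a) (deriv_Icc (edge_len N a) (on_edge N u a))"
  by (simp add: edge_deriv_def numeral_2_eq_2)

lemma edge_trace_eq:
  assumes N: "network N" and u: "continuous_on (net_set N) u"
    and a: "a \<in> edges N" and v: "v \<in> edge_ends N a"
  shows "edge_trace N u a v = u v"
proof -
  note L = network_edge(4)[OF N a]
  let ?s = "end_param N a v"
  have s: "?s \<in> {0..edge_len N a}" and pv: "edge_param N a ?s = v"
    using v L by (auto simp: end_param_def edge_ends_def edge_param_0 edge_param_len)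
  have "continuous_on {0..edge_len N a} (on_edge N u a)"
    unfolding on_edge_def
    by (rule continuous_on_compose2[OF u continuous_on_edge_param])
      (use edge_param_in_edge_set[OF L] a in \<open>auto simp: net_set_def\<close>)
  then have "(on_edge N u a \<longlongrightarrow> on_edge N u a ?s) (at ?s within {0..edge_len N a})"
    using s by (simp add: continuous_on_def)
  then have "(on_edge N u a \<longlongrightarrow> on_edge N u a ?s) (at ?s within {0<..<edge_len N a})"
    by (rule tendsto_within_subset) auto
  moreover have "at ?s within {0<..<edge_len N a} \<noteq> bot"
  proof -
    have "?s islimpt {0<..<edge_len N a}"
      using islimpt_greaterThanLessThan1[OF L] islimpt_greaterThanLessThan2[OF L]
      by (simp add: end_param_def)
    then show ?thesis
      by (simp add: trivial_limit_within)
  qed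
  ultimately show ?thesis
    unfolding edge_trace_def edge_lim_def using tendsto_Lim pv by (auto simp: on_edge_def)
qed

lemma hoelder_on_imp_continuous_on:
  assumes "hoelder_on \<sigma> S g" and "0 < \<sigma>"
  shows "continuous_on S g"
proof -
  obtain K where K: "\<And>s t. s \<in> S \<Longrightarrow> t \<in> S \<Longrightarrow> \<bar>g s - g t\<bar> \<le> K * \<bar>s - t\<bar> powr \<sigma>"
    using assms(1) unfolding hoelder_on_def by blast
  show ?thesis
    unfolding continuous_on_def
  proof
    fix t assume t: "t \<in> S"
    have "((\<lambda>s. K * \<bar>s - t\<bar> powr \<sigma>) \<longlongrightarrow> K * \<bar>t - t\<bar> powr \<sigma>) (at t within S)"
      using assms(2) by (intro tendsto_intros) auto
    then have lim: "((\<lambda>s. K * \<bar>s - t\<bar> powr \<sigma>) \<longlongrightarrow> 0) (at t within S)"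
      by simp
    have "((\<lambda>s. g s - g t) \<longlongrightarrow> 0) (at t within S)"
      by (rule Lim_null_comparison[OF _ lim]) (auto simp: eventually_at_filter K t)
    then show "(g \<longlongrightarrow> g t) (at t within S)"
      by (rule LIM_zero_cancel)
  qed
qed

lemma hoelder_on_closed_Icc:
  assumes L: "0 < L" and \<sigma>: "0 < \<sigma>" and cont: "continuous_on {0..L} g"
    and h: "hoelder_on \<sigma> {0<..<L} g"
  shows "hoelder_on \<sigma> {0..L} g"
proof -
  obtain K where K: "\<And>s t. s \<in> {0<..<L} \<Longrightarrow> t \<in> {0<..<L} \<Longrightarrow> \<bar>g s - g t\<bar> \<le> K * \<bar>s - t\<bar> powr \<sigma>"
    using h unfolding hoelder_on_def by blast
  let ?G = "\<lambda>z. \<bar>g (fst z) - g (snd z)\<bar> - K * \<bar>fst z - snd z\<bar> powr \<sigma>"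
  have cl: "closure ({0<..<L} \<times> {0<..<L}) = {0..L} \<times> {0..L}"
    using L by (simp add: closure_Times closure_open_Icc)
  have "continuous_on ({0..L} \<times> {0..L}) ?G"
    using \<sigma> by (intro continuous_intros continuous_on_compose2[OF cont] continuous_on_powr') auto
  then have "?G z \<le> 0" if "z \<in> {0..L} \<times> {0..L}" for z
    using continuous_le_on_closure[of "{0<..<L} \<times> {0<..<L}" ?G z 0] that K cl by auto
  then have "\<forall>s\<in>{0..L}. \<forall>t\<in>{0..L}. \<bar>g s - g t\<bar> \<le> K * \<bar>s - t\<bar> powr \<sigma>"
    by force
  then show ?thesis by (auto simp: hoelder_on_def)
qed

section \<open>The ergodic problem on a network\<close>

text \<open>
  The continuous extensions \<open>edge_ham\<close> and \<open>edge_ext\<close> make the right-hand side of the equation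
  continuous on the closed edge.
\<close>

definition ham_rhs :: "('d::finite, 'e) network \<Rightarrow> ('e \<Rightarrow> real) \<Rightarrow> (real ^ 'd \<Rightarrow> real \<Rightarrow> real) \<Rightarrow>
    (real ^ 'd \<Rightarrow> real) \<Rightarrow> 'e \<Rightarrow> real \<Rightarrow> real \<Rightarrow> real" where
  "ham_rhs N \<mu> H F a s p = (edge_ham N H a (edge_param N a s) p - edge_ext N F a s) / \<mu> a"

text \<open>
  Replacing \<open>\<mu> \<gamma>\<close> by \<open>1\<close> and \<open>\<eta>\<close> by \<open>0\<close> at boundary vertices turns the Kirchhoff condition into the
  Neumann condition, because these vertices have one edge only.
\<close>

definition vertex_weight :: "('d::finite, 'e) network \<Rightarrow> ('e \<Rightarrow> real) \<Rightarrow>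
    (real ^ 'd \<Rightarrow> 'e \<Rightarrow> real) \<Rightarrow> real ^ 'd \<Rightarrow> 'e \<Rightarrow> real" where
  "vertex_weight N \<mu> \<gamma> v a = (if v \<in> bdry_verts N then 1 else \<mu> a * \<gamma> v a)"

definition zero_on_bdry :: "('d::finite, 'e) network \<Rightarrow> (real ^ 'd \<Rightarrow> real) \<Rightarrow> real ^ 'd \<Rightarrow> real" where
  "zero_on_bdry N \<eta> v = (if v \<in> bdry_verts N then 0 else \<eta> v)"

lemma edge_ext_bounded:
  assumes N: "network N" and F: "PC_hoelder_net N \<sigma> F" and \<sigma>: "0 < \<sigma>"
  obtains B where "\<And>a s. a \<in> edges N \<Longrightarrow> s \<in> {0..edge_len N a} \<Longrightarrow> \<bar>edge_ext N F a s\<bar> \<le> B"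
proof -
  have "\<exists>B. \<forall>s\<in>{0..edge_len N a}. \<bar>edge_ext N F a s\<bar> \<le> B" if a: "a \<in> edges N" for a
  proof -
    have "continuous_on {0..edge_len N a} (edge_ext N F a)"
      using hoelder_on_imp_continuous_on[OF _ \<sigma>] F a by (simp add: PC_hoelder_net_def)
    then show ?thesis
      by (rule continuous_on_Icc_bounded) blast
  qed
  then obtain B where B: "\<And>a s. a \<in> edges N \<Longrightarrow> s \<in> {0..edge_len N a} \<Longrightarrow> \<bar>edge_ext N F a s\<bar> \<le> B a"
    by metis
  have fin: "finite (edges N)"
    using N by (simp add: network_def)
  show ?thesis
  proof (rule that[of "\<Sum>a\<in>edges N. \<bar>B a\<bar>"])
    fix a s assume a: "a \<in> edges N" and s: "s \<in> {0..edge_len N a}"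
    have "\<bar>edge_ext N F a s\<bar> \<le> \<bar>B a\<bar>"
      using B[OF a s] by linarith
    also have "\<dots> \<le> (\<Sum>a\<in>edges N. \<bar>B a\<bar>)"
      using a fin by (intro member_le_sum) auto
    finally show "\<bar>edge_ext N F a s\<bar> \<le> (\<Sum>a\<in>edges N. \<bar>B a\<bar>)" .
  qed
qed

locale ergodic_data =
  fixes N :: "('d::finite, 'e) network" and lam :: real and \<mu> :: "'e \<Rightarrow> real"
    and \<gamma> :: "real ^ 'd \<Rightarrow> 'e \<Rightarrow> real" and \<eta> \<theta> :: "real ^ 'd \<Rightarrow> real"
    and H :: "real ^ 'd \<Rightarrow> real \<Rightarrow> real" and CH q :: real and F :: "real ^ 'd \<Rightarrow> real" and \<sigma> :: real
  assumes network: "network N" and coeff: "coeff_assms N lam \<mu> \<gamma> \<eta>" and ham: "ham_assms N H CH q"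
    and \<sigma>: "0 < \<sigma>" "\<sigma> < 1" and F: "PC_hoelder_net N \<sigma> F"
begin

abbreviation len where "len \<equiv> edge_len N"

lemma \<mu>_pos: "a \<in> edges N \<Longrightarrow> 0 < \<mu> a"
  using coeff by (simp add: coeff_assms_def)

lemma CH_pos: "0 < CH" and q_bounds: "1 < q"
  using ham by (auto simp: ham_assms_def)

lemma len_pos: "a \<in> edges N \<Longrightarrow> 0 < len a"
  by (rule network_edge(4)[OF network])

lemma param_in_edge_set: "a \<in> edges N \<Longrightarrow> s \<in> {0..len a} \<Longrightarrow> edge_param N a s \<in> edge_set N a"
  by (rule edge_param_in_edge_set[OF len_pos])

lemma edge_ham_interior:
  assumes "a \<in> edges N" and "s \<in> {0<..<len a}"
  shows "edge_ham N H a (edge_param N a s) p = H (edge_param N a s) p"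
  using edge_param_not_vertex[OF network assms] by (simp add: edge_ham_def)

lemma edge_ext_interior: "s \<in> {0<..<len a} \<Longrightarrow> edge_ext N F a s = F (edge_param N a s)"
  by (simp add: edge_ext_def on_edge_def)

lemma continuous_edge_ext: "a \<in> edges N \<Longrightarrow> continuous_on {0..len a} (edge_ext N F a)"
  using hoelder_on_imp_continuous_on[OF _ \<sigma>(1)] F by (simp add: PC_hoelder_net_def)

lemma continuous_edge_ham:
  assumes "a \<in> edges N"
  shows "continuous_on ({0..len a} \<times> UNIV) (\<lambda>(s, p). edge_ham N H a (edge_param N a s) p)"
proof -
  have c: "continuous_on (edge_set N a \<times> UNIV) (\<lambda>(x, p). edge_ham N H a x p)"
    using ham assms by (simp add: ham_assms_def)
  have "continuous_on ({0..len a} \<times> UNIV) (\<lambda>z. (\<lambda>(x, p). edge_ham N H a x p) (edge_param N a (fst z), snd z))"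
    by (rule continuous_on_compose2[OF c])
      (use param_in_edge_set[OF assms] in
        \<open>auto intro!: continuous_intros continuous_on_compose2[OF continuous_on_edge_param]\<close>)
  then show ?thesis by (simp add: case_prod_beta)
qed

lemma edge_ham_growth:
  assumes "a \<in> edges N" and "s \<in> {0..len a}"
  shows "\<bar>edge_ham N H a (edge_param N a s) p\<bar> \<le> CH * (1 + \<bar>p\<bar> powr q)"
    and "edge_ham N H a (edge_param N a s) p \<ge> (1 / CH) * \<bar>p\<bar> powr q - CH"
proof -
  have "\<forall>x\<in>edge_set N a. \<forall>p. \<bar>edge_ham N H a x p\<bar> \<le> CH * (1 + \<bar>p\<bar> powr q) \<and>
      edge_ham N H a x p \<ge> (1 / CH) * \<bar>p\<bar> powr q - CH"
    using ham assms(1) unfolding ham_assms_def by blast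
  with param_in_edge_set[OF assms]
  show "\<bar>edge_ham N H a (edge_param N a s) p\<bar> \<le> CH * (1 + \<bar>p\<bar> powr q)"
    and "edge_ham N H a (edge_param N a s) p \<ge> (1 / CH) * \<bar>p\<bar> powr q - CH"
    by blast+
qed

text \<open>The bound on \<open>\<partial>\<^sub>p H\<close> is used on the open edge; the estimate reaches the end points by continuity.\<close>

lemma edge_ham_lipschitz:
  assumes a: "a \<in> edges N" and s: "s \<in> {0..len a}" and p: "\<bar>p\<bar> \<le> R" "\<bar>p'\<bar> \<le> R"
  shows "\<bar>edge_ham N H a (edge_param N a s) p - edge_ham N H a (edge_param N a s) p'\<bar>
    \<le> CH * (1 + R powr (q - 1)) * \<bar>p - p'\<bar>"
proof -
  let ?h = "\<lambda>s. edge_ham N H a (edge_param N a s)"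
  obtain dH where dH: "\<And>x p. x \<in> edge_set N a - verts N \<Longrightarrow>
      (edge_ham N H a x has_real_derivative dH x p) (at p)"
    and bound: "\<And>x p. x \<in> edge_set N a \<Longrightarrow> \<bar>dH x p\<bar> \<le> CH * (1 + \<bar>p\<bar> powr (q - 1))"
    using ham a unfolding ham_assms_def by metis
  have interior: "\<bar>?h t p - ?h t p'\<bar> \<le> CH * (1 + R powr (q - 1)) * \<bar>p - p'\<bar>" if t: "t \<in> {0<..<len a}" for t
  proof -
    let ?x = "edge_param N a t"
    have x: "?x \<in> edge_set N a" "?x \<in> edge_set N a - verts N"
      using param_in_edge_set[OF a, of t] edge_param_not_vertex[OF network a t] t by auto
    have "norm (?h t p - ?h t p') \<le> CH * (1 + R powr (q - 1)) * norm (p - p')"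
    proof (rule field_differentiable_bound[where S = "{- R..R}" and f' = "dH ?x"])
      fix y assume y: "y \<in> {- R..R}"
      show "(?h t has_real_derivative dH ?x y) (at y within {- R..R})"
        by (rule has_field_derivative_at_within[OF dH[OF x(2)]])
      have "\<bar>y\<bar> powr (q - 1) \<le> R powr (q - 1)"
        using y q_bounds by (intro powr_mono2) auto
      then have "CH * (1 + \<bar>y\<bar> powr (q - 1)) \<le> CH * (1 + R powr (q - 1))"
        using CH_pos by simp
      with bound[OF x(1), of y] show "norm (dH ?x y) \<le> CH * (1 + R powr (q - 1))"
        by simp
    qed (use p in auto)
    then show ?thesis by simp
  qed
  have "continuous_on (closure {0<..<len a}) (\<lambda>t. \<bar>?h t p - ?h t p'\<bar>)"
    unfolding closure_open_Icc[OF len_pos[OF a]]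
    by (intro continuous_intros continuous_on_curried[OF continuous_edge_ham[OF a]])
  then show ?thesis
    by (rule continuous_le_on_closure) (use interior s closure_open_Icc[OF len_pos[OF a]] in auto)
qed

lemma ham_rhs_regular:
  assumes a: "a \<in> edges N"
  shows "regular_rhs (ham_rhs N \<mu> H F a) (len a)"
  unfolding regular_rhs_def
proof (intro conjI allI)
  have "continuous_on ({0..len a} \<times> (UNIV :: real set)) (\<lambda>z. edge_ext N F a (fst z))"
    by (rule continuous_on_compose2[OF continuous_edge_ext[OF a]]) (auto intro!: continuous_intros)
  then have "continuous_on ({0..len a} \<times> UNIV)
      (\<lambda>z. ((\<lambda>(s, p). edge_ham N H a (edge_param N a s) p) z - edge_ext N F a (fst z)) / \<mu> a)"
    using \<mu>_pos[OF a] by (intro continuous_intros continuous_edge_ham[OF a]) auto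
  then show "continuous_on ({0..len a} \<times> UNIV) (\<lambda>(s, p). ham_rhs N \<mu> H F a s p)"
    by (simp add: ham_rhs_def case_prod_beta)
  fix R :: real
  show "\<exists>K. \<forall>s\<in>{0..len a}. \<forall>p p'. \<bar>p\<bar> \<le> R \<longrightarrow> \<bar>p'\<bar> \<le> R \<longrightarrow>
      \<bar>ham_rhs N \<mu> H F a s p - ham_rhs N \<mu> H F a s p'\<bar> \<le> K * \<bar>p - p'\<bar>"
  proof (intro exI[of _ "CH * (1 + R powr (q - 1)) / \<mu> a"] ballI allI impI)
    fix s p p' :: real
    assume s: "s \<in> {0..len a}" and p: "\<bar>p\<bar> \<le> R" "\<bar>p'\<bar> \<le> R"
    have "\<bar>ham_rhs N \<mu> H F a s p - ham_rhs N \<mu> H F a s p'\<bar>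
        = \<bar>edge_ham N H a (edge_param N a s) p - edge_ham N H a (edge_param N a s) p'\<bar> / \<mu> a"
      using \<mu>_pos[OF a] by (simp add: ham_rhs_def abs_divide flip: diff_divide_distrib)
    also have "\<dots> \<le> CH * (1 + R powr (q - 1)) * \<bar>p - p'\<bar> / \<mu> a"
      using edge_ham_lipschitz[OF a s p] \<mu>_pos[OF a] by (intro divide_right_mono) auto
    finally show "\<bar>ham_rhs N \<mu> H F a s p - ham_rhs N \<mu> H F a s p'\<bar>
        \<le> CH * (1 + R powr (q - 1)) / \<mu> a * \<bar>p - p'\<bar>" by simp
  qed
qed

definition F_bound :: real where
  "F_bound = (SOME B. \<forall>a\<in>edges N. \<forall>s\<in>{0..len a}. \<bar>edge_ext N F a s\<bar> \<le> B)"

lemma F_bound: "a \<in> edges N \<Longrightarrow> s \<in> {0..len a} \<Longrightarrow> \<bar>edge_ext N F a s\<bar> \<le> F_bound"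
proof -
  have "\<exists>B. \<forall>a\<in>edges N. \<forall>s\<in>{0..len a}. \<bar>edge_ext N F a s\<bar> \<le> B"
    using edge_ext_bounded[OF network F \<sigma>(1)] by metis
  then have "\<forall>a\<in>edges N. \<forall>s\<in>{0..len a}. \<bar>edge_ext N F a s\<bar> \<le> F_bound"
    unfolding F_bound_def by (rule someI_ex)
  then show "a \<in> edges N \<Longrightarrow> s \<in> {0..len a} \<Longrightarrow> \<bar>edge_ext N F a s\<bar> \<le> F_bound"
    by blast
qed

lemma ham_rhs_coercive:
  assumes a: "a \<in> edges N" and s: "s \<in> {0..len a}" and B: "\<bar>edge_ext N F a s\<bar> \<le> B"
  shows "1 / (CH * \<mu> a) * \<bar>p\<bar> powr q - (CH + B) / \<mu> a \<le> ham_rhs N \<mu> H F a s p"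
proof -
  have "((1 / CH) * \<bar>p\<bar> powr q - CH - B) / \<mu> a \<le> ham_rhs N \<mu> H F a s p"
    unfolding ham_rhs_def using edge_ham_growth(2)[OF a s, of p] B \<mu>_pos[OF a]
    by (intro divide_right_mono) auto
  then show ?thesis
    by (simp add: diff_divide_distrib add_divide_distrib)
qed

sublocale metric_graph "verts N" "edges N" "src N" "tgt N" len
  by (rule network_metric_graph[OF network])

lemma vertex_weight_pos: "x \<in> verts N \<Longrightarrow> a \<in> inc x \<Longrightarrow> 0 < vertex_weight N \<mu> \<gamma> x a"
  using coeff by (auto simp: vertex_weight_def coeff_assms_def inc_eq_incident[OF network] incident_def)

sublocale kirchhoff_problem "verts N" "edges N" "src N" "tgt N" len "ham_rhs N \<mu> H F" "\<lambda>a. 1 / \<mu> a"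
  "vertex_weight N \<mu> \<gamma>" "zero_on_bdry N \<eta>" "zero_on_bdry N \<theta>"
  "\<lambda>a. 1 / (CH * \<mu> a)" "\<lambda>a. (CH + F_bound) / \<mu> a" q
proof
  show "0 \<le> zero_on_bdry N \<eta> x" if "x \<in> verts N" for x
    using coeff that by (auto simp: zero_on_bdry_def coeff_assms_def)
qed (use vertex_weight_pos \<mu>_pos ham_rhs_regular CH_pos q_bounds ham_rhs_coercive F_bound in auto)

lemma outward_deriv_eq_out: "outward_deriv N u a v = out (edge_deriv N 1 u) a v"
  by (simp add: outward_deriv_def out_def)

lemma inner_net:
  assumes "v \<in> inner_verts N"
  shows "net (vertex_weight N \<mu> \<gamma>) w v = (\<Sum>a\<in>incident N v. \<mu> a * \<gamma> v a * out w a v)"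
  using assms by (simp add: net_def inc_eq_incident[OF network] vertex_weight_def)

lemma ham_rhs_interior:
  assumes "a \<in> edges N" and "s \<in> {0<..<len a}"
  shows "ham_rhs N \<mu> H F a s p = (H (edge_param N a s) p - F (edge_param N a s)) / \<mu> a"
  using edge_ham_interior[OF assms] edge_ext_interior[OF assms(2)] by (simp add: ham_rhs_def)

text \<open>
  The equation extends from the open edges to the closed ones by continuity, which is where the
  continuous extensions of \<open>H\<close> and \<open>F\<close> come in.
\<close>

lemma ergodic_sol_imp_solution:
  assumes u: "Ck_net N 2 u" and sol: "ergodic_sol N \<mu> \<gamma> \<eta> \<theta> H F u \<rho>"
  shows "solution \<rho> u (edge_deriv N 1 u)"
  unfolding solution_def flow_def potential_def
proof (intro conjI ballI)
  fix a assume a: "a \<in> edges N"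
  have C2: "Ck_Icc 2 (len a) (on_edge N u a)"
    using u a by (simp add: Ck_net_def)
  let ?w = "edge_deriv N 1 u a"
  have D: "(?w has_real_derivative edge_deriv N 2 u a s) (at s within {0..len a})" if "s \<in> {0..len a}" for s
    using Ck_Icc_2D(2)[OF C2 that] by (simp only: edge_deriv_1 edge_deriv_2)
  have c2: "continuous_on {0..len a} (edge_deriv N 2 u a)"
    using Ck_Icc_2D(3)[OF C2, of 0] len_pos[OF a] by (simp add: edge_deriv_2)
  have c1: "continuous_on {0..len a} ?w"
    by (rule has_real_derivative_within_imp_continuous_on[OF D])
  let ?g = "\<lambda>s. edge_deriv N 2 u a s - (ham_rhs N \<mu> H F a s (?w s) + 1 / \<mu> a * \<rho>)"
  have "continuous_on {0..len a} (\<lambda>s. ham_rhs N \<mu> H F a s (?w s))"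
    by (rule continuous_on_curried[OF _ c1]) (use ham_rhs_regular[OF a] in \<open>simp add: regular_rhs_def\<close>)
  then have "continuous_on (closure {0<..<len a}) ?g"
    unfolding closure_open_Icc[OF len_pos[OF a]] by (intro continuous_intros c2)
  moreover have "?g s = 0" if s: "s \<in> {0<..<len a}" for s
  proof -
    have "- \<mu> a * edge_deriv N 2 u a s + H (edge_param N a s) (?w s) + \<rho> = F (edge_param N a s)"
      using sol a s by (simp add: ergodic_sol_def)
    then have "edge_deriv N 2 u a s * \<mu> a = H (edge_param N a s) (?w s) + \<rho> - F (edge_param N a s)"
      by (simp add: mult.commute)
    then show ?thesis
      using \<mu>_pos[OF a] by (simp add: ham_rhs_interior[OF a s] field_simps)
  qed
  ultimately have "?g s = 0" if "s \<in> {0..len a}" for s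
    using continuous_constant_on_closure[of "{0<..<len a}" ?g 0 s] that closure_open_Icc[OF len_pos[OF a]]
    by auto
  then show "ode_sol (ham_rhs N \<mu> H F a) (1 / \<mu> a * \<rho>) (len a) ?w"
    unfolding ode_sol_def using D by force
  have "(?w has_integral on_edge N u a (len a) - on_edge N u a 0) {0..len a}"
    by (rule fundamental_theorem_of_calculus)
      (use Ck_Icc_2D(1)[OF C2] len_pos[OF a] in
        \<open>auto simp: edge_deriv_1[unfolded One_nat_def] has_real_derivative_iff_has_vector_derivative[symmetric]\<close>)
  then show "integral {0..len a} ?w = u (tgt N a) - u (src N a)"
    using len_pos[OF a] by (simp add: integral_unique on_edge_def edge_param_0 edge_param_len)
next
  fix v assume v: "v \<in> verts N"
  show "net (vertex_weight N \<mu> \<gamma>) (edge_deriv N 1 u) v = zero_on_bdry N \<eta> v * (zero_on_bdry N \<theta> v - \<rho>)"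
  proof (cases "v \<in> bdry_verts N")
    case True
    then have "\<forall>a\<in>incident N v. out (edge_deriv N 1 u) a v = 0"
      using sol by (simp add: ergodic_sol_def outward_deriv_eq_out)
    then show ?thesis
      using True by (simp add: net_def inc_eq_incident[OF network v] zero_on_bdry_def)
  next
    case False
    then show ?thesis
      using sol v by (simp add: inner_net ergodic_sol_def outward_deriv_eq_out zero_on_bdry_def)
  qed
qed

end

text \<open>
  If \<open>U\<close> is a potential of \<open>w\<close>, the choice of the edge through \<open>x\<close> does not affect the value: two
  edges meet in vertices only, where both formulas give \<open>U\<close>.
\<close>

definition glue :: "('d::finite, 'e) network \<Rightarrow> (real ^ 'd \<Rightarrow> real) \<Rightarrow> ('e \<Rightarrow> real \<Rightarrow> real) \<Rightarrow>
    real ^ 'd \<Rightarrow> real" where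
  "glue N U w x = (let a = SOME a. a \<in> edges N \<and> x \<in> edge_set N a
     in U (src N a) + integral {0..dist (src N a) x} (w a))"

lemma lipschitz_imp_hoelder:
  fixes s t :: real
  assumes "s \<in> {0..L}" and "t \<in> {0..L}" and "\<sigma> \<le> 1"
  shows "\<bar>s - t\<bar> \<le> L powr (1 - \<sigma>) * \<bar>s - t\<bar> powr \<sigma>"
proof (cases "s = t")
  case False
  have "\<bar>s - t\<bar> = \<bar>s - t\<bar> powr (1 - \<sigma>) * \<bar>s - t\<bar> powr \<sigma>"
    using False by (simp flip: powr_add)
  also have "\<dots> \<le> L powr (1 - \<sigma>) * \<bar>s - t\<bar> powr \<sigma>"
    using assms by (intro mult_right_mono powr_mono2) auto
  finally show ?thesis .
qed (use assms in auto)

context ergodic_data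
begin

lemma glue_eq:
  assumes U: "potential U w" and a: "a \<in> edges N" and x: "x \<in> edge_set N a"
  shows "glue N U w x = U (src N a) + integral {0..dist (src N a) x} (w a)"
proof -
  have at_end: "U (src N a) + integral {0..dist (src N a) v} (w a) = U v"
    if "a \<in> edges N" "v \<in> edge_ends N a" for a v
    using U that by (auto simp: potential_def edge_ends_def edge_len_def)
  define b where "b = (SOME a. a \<in> edges N \<and> x \<in> edge_set N a)"
  have b: "b \<in> edges N" "x \<in> edge_set N b"
    unfolding b_def using someI[of "\<lambda>a. a \<in> edges N \<and> x \<in> edge_set N a", OF conjI[OF a x]] by auto
  have "glue N U w x = U (src N b) + integral {0..dist (src N b) x} (w b)"
    by (simp add: glue_def b_def Let_def)
  also have "\<dots> = U (src N a) + integral {0..dist (src N a) x} (w a)"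
  proof (cases "a = b")
    case False
    show ?thesis
      using network_intersection(1,2)[OF network a b(1) False x b(2)] at_end[OF a] at_end[OF b(1)] by simp
  qed simp
  finally show ?thesis .
qed

text \<open>
  The derivative \<open>w\<close> is Lipschitz, because its own derivative is continuous, and \<open>H\<close> is locally
  Lipschitz in \<open>p\<close>. So \<open>s \<mapsto> H(s, w s)\<close> is as regular as \<open>H\<close> is in \<open>x\<close>, which makes \<open>\<partial>\<^sup>2u\<close> Hoelder
  continuous.
\<close>

lemma solution_imp_ergodic_sol:
  assumes sol: "solution \<rho> U w"
  shows "\<exists>u. Ck_net N 2 u \<and> ergodic_sol N \<mu> \<gamma> \<eta> \<theta> H F u \<rho> \<and>
    (ham_hoelder N H \<sigma> \<longrightarrow> Ck_hoelder_net N 2 \<sigma> u)"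
proof -
  define u where "u = glue N U w"
  have fl: "flow \<rho> U w" and net: "\<And>v. v \<in> verts N \<Longrightarrow>
      net (vertex_weight N \<mu> \<gamma>) w v = zero_on_bdry N \<eta> v * (zero_on_bdry N \<theta> v - \<rho>)"
    using sol by (auto simp: solution_def)
  have pot: "potential U w"
    using fl by (simp add: flow_def)
  note ode = flowD(1)[OF fl]
  have cont_w: "continuous_on {0..len a} (w a)" if "a \<in> edges N" for a
    by (rule ode_sol_continuous[OF ode[OF that]])
  define k where "k a s = ham_rhs N \<mu> H F a s (w a s) + 1 / \<mu> a * \<rho>" for a s
  have cont_k: "continuous_on {0..len a} (k a)" if a: "a \<in> edges N" for a
    unfolding k_def
    by (intro continuous_intros continuous_on_curried[OF _ cont_w[OF a]])
      (use ham_rhs_regular[OF a] in \<open>simp add: regular_rhs_def\<close>)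
  have on_edge_u: "on_edge N u a s = U (src N a) + integral {0..s} (w a)"
    if a: "a \<in> edges N" and s: "s \<in> {0..len a}" for a s
    using glue_eq[OF pot a param_in_edge_set[OF a s]] dist_src_edge_param[OF len_pos[OF a], of s] s
    by (simp add: on_edge_def u_def)
  have D0: "((\<lambda>s. U (src N a) + integral {0..s} (w a)) has_real_derivative w a s) (at s within {0..len a})"
    if a: "a \<in> edges N" and s: "s \<in> {0..len a}" for a s
    using DERIV_add[OF DERIV_const integral_has_real_derivative[OF cont_w[OF a] s]] by simp
  have D1: "(w a has_real_derivative k a s) (at s within {0..len a})"
    if a: "a \<in> edges N" and s: "s \<in> {0..len a}" for a s
    using ode_solD[OF ode[OF a] s] by (simp add: k_def)
  note C2 = Ck_Icc_2I[OF len_pos D0 D1 cont_k on_edge_u]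
  have deriv1: "edge_deriv N 1 u a s = w a s" if "a \<in> edges N" "s \<in> {0..len a}" for a s
    unfolding edge_deriv_1 by (rule C2(2)) (use that in auto)
  have deriv2: "edge_deriv N 2 u a s = k a s" if "a \<in> edges N" "s \<in> {0..len a}" for a s
    unfolding edge_deriv_2 by (rule C2(3)) (use that in auto)
  have cont_u: "continuous_on (net_set N) u"
    unfolding net_set_def
  proof (rule continuous_on_closed_Union)
    show "finite (edges N)" by (rule finite_E)
    fix a assume a: "a \<in> edges N"
    show "closed (edge_set N a)" by (simp add: edge_set_def)
    have "continuous_on {0..len a} (\<lambda>s. U (src N a) + integral {0..s} (w a))"
      by (rule has_real_derivative_within_imp_continuous_on[OF D0[OF a]])
    then have "continuous_on (edge_set N a) (\<lambda>x. U (src N a) + integral {0..dist (src N a) x} (w a))"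
    proof (rule continuous_on_compose2)
      show "(\<lambda>x. dist (src N a) x) ` edge_set N a \<subseteq> {0..len a}"
        using dist_src_edge_param[OF len_pos[OF a]] by (force elim: edge_setE[OF len_pos[OF a]])
    qed (intro continuous_intros)
    then show "continuous_on (edge_set N a) u"
      using glue_eq[OF pot a] by (metis (no_types, lifting) continuous_on_cong u_def)
  qed
  have Ck: "Ck_net N 2 u"
    unfolding Ck_net_def using cont_u C2(1) by blast
  have out_eq: "outward_deriv N u a v = out w a v" if a: "a \<in> edges N" for a v
    using deriv1[OF a, of 0] deriv1[OF a, of "len a"] len_pos[OF a]
    by (simp add: outward_deriv_eq_out out_def)
  have "ergodic_sol N \<mu> \<gamma> \<eta> \<theta> H F u \<rho>"
    unfolding ergodic_sol_def
  proof (intro conjI ballI)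
    fix a s assume a: "a \<in> edges N" and s: "s \<in> {0<..<len a}"
    then have s': "s \<in> {0..len a}" by simp
    show "- \<mu> a * edge_deriv N 2 u a s + H (edge_param N a s) (edge_deriv N 1 u a s) + \<rho>
        = F (edge_param N a s)"
      unfolding deriv1[OF a s'] deriv2[OF a s'] k_def ham_rhs_interior[OF a s]
      using \<mu>_pos[OF a] by (simp add: field_simps)
  next
    fix v a b assume v: "v \<in> verts N" and "a \<in> incident N v" "b \<in> incident N v"
    then have "a \<in> edges N" "v \<in> edge_ends N a" "b \<in> edges N" "v \<in> edge_ends N b"
      using vertex_in_edge_set_iff[OF network _ v] by (auto simp: incident_def)
    then show "edge_trace N u a v = edge_trace N u b v"
      by (simp add: edge_trace_eq[OF network cont_u])
  next
    fix v assume v: "v \<in> inner_verts N"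
    have "(\<Sum>a\<in>incident N v. \<mu> a * \<gamma> v a * outward_deriv N u a v)
        = net (vertex_weight N \<mu> \<gamma>) w v"
      unfolding inner_net[OF v] by (rule sum.cong) (auto simp: out_eq incident_def)
    with net[of v] v show "(\<Sum>a\<in>incident N v. \<mu> a * \<gamma> v a * outward_deriv N u a v) = \<eta> v * (\<theta> v - \<rho>)"
      by (simp add: zero_on_bdry_def)
  next
    fix v a assume v: "v \<in> bdry_verts N" and a: "a \<in> incident N v"
    then have vV: "v \<in> verts N" by (simp add: bdry_verts_def)
    obtain b where "incident N v = {b}"
      by (rule bdry_vertex_incident[OF network v])
    with a have "incident N v = {a}" by simp
    with net[OF vV] v have "out w a v = 0"
      by (simp add: net_def inc_eq_incident[OF network vV] vertex_weight_def zero_on_bdry_def)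
    with a show "outward_deriv N u a v = 0"
      by (simp add: out_eq incident_def)
  qed
  moreover have "Ck_hoelder_net N 2 \<sigma> u" if hoelder: "ham_hoelder N H \<sigma>"
    unfolding Ck_hoelder_net_def
  proof (intro conjI Ck ballI)
    fix a assume a: "a \<in> edges N"
    obtain R where R: "\<And>s. s \<in> {0..len a} \<Longrightarrow> \<bar>w a s\<bar> \<le> R"
      using continuous_on_Icc_bounded[OF cont_w[OF a]] by blast
    obtain M where M: "\<And>s. s \<in> {0..len a} \<Longrightarrow> \<bar>k a s\<bar> \<le> M"
      using continuous_on_Icc_bounded[OF cont_k[OF a]] by blast
    obtain K1 where K1: "\<And>p s t. \<bar>p\<bar> \<le> R \<Longrightarrow> s \<in> {0<..<len a} \<Longrightarrow> t \<in> {0<..<len a} \<Longrightarrow>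
        \<bar>H (edge_param N a s) p - H (edge_param N a t) p\<bar> \<le> K1 * \<bar>s - t\<bar> powr \<sigma>"
      using hoelder a unfolding ham_hoelder_def by meson
    obtain K3 where K3: "\<And>s t. s \<in> {0..len a} \<Longrightarrow> t \<in> {0..len a} \<Longrightarrow>
        \<bar>edge_ext N F a s - edge_ext N F a t\<bar> \<le> K3 * \<bar>s - t\<bar> powr \<sigma>"
      using F a unfolding PC_hoelder_net_def hoelder_on_def by meson
    define K2 where "K2 = CH * (1 + R powr (q - 1)) * (M * len a powr (1 - \<sigma>))"
    have "hoelder_on \<sigma> {0<..<len a} (k a)"
      unfolding hoelder_on_def
    proof (intro exI[of _ "(K1 + K2 + K3) / \<mu> a"] ballI)
      fix s t assume s: "s \<in> {0<..<len a}" and t: "t \<in> {0<..<len a}"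
      then have s': "s \<in> {0..len a}" and t': "t \<in> {0..len a}" by auto
      let ?X = "\<bar>s - t\<bar> powr \<sigma>"
      let ?h = "\<lambda>s p. H (edge_param N a s) p"
      have M0: "0 \<le> M" using order_trans[OF abs_ge_zero M[OF s']] .
      have "norm (w a s - w a t) \<le> M * norm (s - t)"
        by (rule field_differentiable_bound[where S = "{0..len a}" and f' = "k a"])
          (use D1[OF a] M s' t' in auto)
      also have "\<dots> \<le> M * (len a powr (1 - \<sigma>) * ?X)"
        using lipschitz_imp_hoelder[OF s' t', of \<sigma>] \<sigma> M0 by (intro mult_left_mono) auto
      finally have w: "\<bar>w a s - w a t\<bar> \<le> M * len a powr (1 - \<sigma>) * ?X" by (simp add: mult.assoc)
      have "\<bar>?h t (w a s) - ?h t (w a t)\<bar> \<le> CH * (1 + R powr (q - 1)) * \<bar>w a s - w a t\<bar>"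
        using edge_ham_lipschitz[OF a t' R[OF s'] R[OF t']] by (simp add: edge_ham_interior[OF a t])
      also have "\<dots> \<le> CH * (1 + R powr (q - 1)) * (M * len a powr (1 - \<sigma>) * ?X)"
        using w CH_pos by (intro mult_left_mono) auto
      finally have 2: "\<bar>?h t (w a s) - ?h t (w a t)\<bar> \<le> K2 * ?X"
        by (simp add: K2_def mult.assoc)
      have 1: "\<bar>?h s (w a s) - ?h t (w a s)\<bar> \<le> K1 * ?X"
        by (rule K1[OF R[OF s'] s t])
      have 3: "\<bar>F (edge_param N a s) - F (edge_param N a t)\<bar> \<le> K3 * ?X"
        using K3[OF s' t'] edge_ext_interior[OF s] edge_ext_interior[OF t] by simp
      have "k a s - k a t = ((?h s (w a s) - ?h t (w a s)) + (?h t (w a s) - ?h t (w a t))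
          - (F (edge_param N a s) - F (edge_param N a t))) / \<mu> a"
        by (simp add: k_def ham_rhs_interior[OF a s] ham_rhs_interior[OF a t] diff_divide_distrib add_divide_distrib)
      also have "\<bar>\<dots>\<bar> \<le> (K1 * ?X + K2 * ?X + K3 * ?X) / \<mu> a"
        unfolding abs_divide abs_of_pos[OF \<mu>_pos[OF a]]
        using 1 2 3 \<mu>_pos[OF a] by (intro divide_right_mono) linarith+
      finally show "\<bar>k a s - k a t\<bar> \<le> (K1 + K2 + K3) / \<mu> a * ?X"
        by (simp add: distrib_right)
    qed
    then have "hoelder_on \<sigma> {0..len a} (k a)"
      by (rule hoelder_on_closed_Icc[OF len_pos[OF a] \<sigma>(1) cont_k[OF a]])
    then show "hoelder_on \<sigma> {0..len a} (edge_deriv N 2 u a)"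
      using deriv2[OF a] by (simp add: hoelder_on_def)
  qed
  ultimately show ?thesis using Ck by blast
qed

lemma ergodic_sol_exists:
  "\<exists>u \<rho>. Ck_net N 2 u \<and> ergodic_sol N \<mu> \<gamma> \<eta> \<theta> H F u \<rho> \<and> (ham_hoelder N H \<sigma> \<longrightarrow> Ck_hoelder_net N 2 \<sigma> u)"
  using solution_exists solution_imp_ergodic_sol by blast

text \<open>
  Equal derivatives make \<open>u' - u\<close> constant on each edge, hence constant on the network, which is
  connected.
\<close>

lemma ergodic_sol_unique:
  assumes u: "Ck_net N 2 u" "ergodic_sol N \<mu> \<gamma> \<eta> \<theta> H F u \<rho>"
    and u': "Ck_net N 2 u'" "ergodic_sol N \<mu> \<gamma> \<eta> \<theta> H F u' \<rho>'"
  shows "\<rho>' = \<rho> \<and> (\<exists>c. \<forall>x\<in>net_set N. u' x = u x + c)"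
proof -
  note sols = ergodic_sol_imp_solution[OF u] ergodic_sol_imp_solution[OF u']
  have eq: "\<rho>' = \<rho>" "\<And>a s. a \<in> edges N \<Longrightarrow> s \<in> {0..len a} \<Longrightarrow> edge_deriv N 1 u' a s = edge_deriv N 1 u a s"
    using solution_unique[OF sols] by auto
  have along: "u' (edge_param N a s) - u (edge_param N a s) = u' (src N a) - u (src N a)"
    if a: "a \<in> edges N" and s: "s \<in> {0..len a}" for a s
  proof -
    have C2: "Ck_Icc 2 (len a) (on_edge N u a)" "Ck_Icc 2 (len a) (on_edge N u' a)"
      using u u' a by (auto simp: Ck_net_def)
    have D: "((\<lambda>s. on_edge N u' a s - on_edge N u a s) has_real_derivative 0) (at t within {0..len a})"
      if "t \<in> {0..len a}" for t
      using DERIV_diff[OF Ck_Icc_2D(1)[OF C2(2) that] Ck_Icc_2D(1)[OF C2(1) that]] eq(2)[OF a that, unfolded edge_deriv_1]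
      by simp
    obtain c where "\<And>t. t \<in> {0..len a} \<Longrightarrow> on_edge N u' a t - on_edge N u a t = c"
      using has_field_derivative_zero_constant[OF convex_real_interval(5) D] by metis
    from this[OF s] this[of 0] show ?thesis
      using s by (simp add: on_edge_def edge_param_0)
  qed
  obtain D where D: "\<And>U M x y. (\<And>a. a \<in> edges N \<Longrightarrow> \<bar>U (tgt N a) - U (src N a)\<bar> \<le> M) \<Longrightarrow>
      x \<in> verts N \<Longrightarrow> y \<in> verts N \<Longrightarrow> \<bar>U x - U y\<bar> \<le> D * (M :: real)"
    using potential_difference_bound by metis
  obtain x0 where x0: "x0 \<in> verts N" using V_nonempty by blast
  have verts: "u' x - u x = u' x0 - u x0" if x: "x \<in> verts N" for x
  proof -
    have "\<bar>(u' (tgt N a) - u (tgt N a)) - (u' (src N a) - u (src N a))\<bar> \<le> 0" if a: "a \<in> edges N" for a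
      using along[OF a, of "len a"] len_pos[OF a] by (simp add: edge_param_len)
    from D[of "\<lambda>x. u' x - u x", OF this x x0] show ?thesis by simp
  qed
  have "u' x = u x + (u' x0 - u x0)" if x: "x \<in> net_set N" for x
  proof -
    obtain a where a: "a \<in> edges N" "x \<in> edge_set N a"
      using x by (auto simp: net_set_def)
    obtain s where "s \<in> {0..len a}" "x = edge_param N a s"
      using edge_setE[OF len_pos[OF a(1)] a(2)] .
    with along[OF a(1)] verts[OF org_in_V[OF a(1)]] show ?thesis by force
  qed
  with eq(1) show ?thesis by blast
qed

end

section \<open>A priori bounds\<close>

text \<open>
  Off a null set, hence everywhere by continuity, \<open>|F|\<close> is bounded by any admissible \<open>M\<close> in the
  definition of the norm. The summand \<open>1\<close> leaves room for an \<open>M\<close> above the infimum.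
\<close>

lemma Linf_norm_bound:
  assumes N: "network N" and F: "PC_hoelder_net N \<sigma> F" and \<sigma>: "0 < \<sigma>"
    and a: "a \<in> edges N" and s: "s \<in> {0<..<edge_len N a}"
  shows "\<bar>F (edge_param N a s)\<bar> \<le> Linf_norm N (on_edge N F) + 1"
proof -
  define S where "S = {M. 0 \<le> M \<and>
      (\<forall>a\<in>edges N. AE s in lborel. s \<in> {0<..<edge_len N a} \<longrightarrow> \<bar>on_edge N F a s\<bar> \<le> M)}"
  obtain B where B: "\<And>a s. a \<in> edges N \<Longrightarrow> s \<in> {0..edge_len N a} \<Longrightarrow> \<bar>edge_ext N F a s\<bar> \<le> B"
    using edge_ext_bounded[OF N F \<sigma>] by blast
  have "\<bar>on_edge N F a s\<bar> \<le> \<bar>B\<bar>" if "a \<in> edges N" "s \<in> {0<..<edge_len N a}" for a s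
    using B[OF that(1), of s] that(2) by (simp add: edge_ext_def)
  then have "\<bar>B\<bar> \<in> S" by (auto simp: S_def)
  then have "S \<noteq> {}" by blast
  moreover have "Inf S < Linf_norm N (on_edge N F) + 1"
    by (simp add: Linf_norm_def S_def)
  ultimately obtain M where M: "M \<in> S" "M < Linf_norm N (on_edge N F) + 1"
    using cInf_lessD by blast
  define T where "T = {t \<in> {0<..<edge_len N a}. M < \<bar>on_edge N F a t\<bar>}"
  have "continuous_on {0<..<edge_len N a} (\<lambda>t. \<bar>on_edge N F a t\<bar>)"
    using F a by (intro continuous_intros) (simp add: PC_hoelder_net_def PC_net_def)
  then have "open ({0<..<edge_len N a} \<inter> (\<lambda>t. \<bar>on_edge N F a t\<bar>) -` {M<..})"
    by (rule continuous_open_preimage) auto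
  moreover have "{0<..<edge_len N a} \<inter> (\<lambda>t. \<bar>on_edge N F a t\<bar>) -` {M<..} = T"
    by (auto simp: T_def)
  ultimately have "open T" by simp
  have "AE t in lborel. t \<notin> T"
  proof -
    have "AE t in lborel. t \<in> {0<..<edge_len N a} \<longrightarrow> \<bar>on_edge N F a t\<bar> \<le> M"
      using M(1) a by (simp add: S_def)
    then show ?thesis
      by (rule eventually_mono) (auto simp: T_def)
  qed
  then have "T \<in> null_sets lborel"
    using \<open>open T\<close> by (subst AE_iff_null_sets) auto
  then have "negligible T"
    by (simp add: negligible_iff_null_sets null_sets_completionI)
  then have "T = {}"
    using open_not_negligible[OF \<open>open T\<close>] by blast
  then have "\<bar>on_edge N F a s\<bar> \<le> M"
    using s by (force simp: T_def)
  with M(2) show ?thesis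
    by (simp add: on_edge_def)
qed

lemma Lq_norm_le:
  assumes q: "0 < q" and len: "\<And>a. a \<in> edges N \<Longrightarrow> 0 < edge_len N a"
    and bound: "\<And>a s. a \<in> edges N \<Longrightarrow> s \<in> {0<..<edge_len N a} \<Longrightarrow> \<bar>g a s\<bar> \<le> B"
  shows "Lq_norm N q g \<le> (\<Sum>a\<in>edges N. edge_len N a * B powr q) powr (1 / q)"
proof -
  have le: "(LINT s:{0<..<edge_len N a}|lborel. \<bar>g a s\<bar> powr q) \<le> edge_len N a * B powr q"
    and nonneg: "0 \<le> (LINT s:{0<..<edge_len N a}|lborel. \<bar>g a s\<bar> powr q)" if a: "a \<in> edges N" for a
  proof -
    have "(LINT s:{0<..<edge_len N a}|lborel. \<bar>g a s\<bar> powr q)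
        \<le> (\<integral>s. indicator {0<..<edge_len N a} s *\<^sub>R (B powr q) \<partial>lborel)"
      unfolding set_lebesgue_integral_def
    proof (rule integral_mono')
      show "integrable lborel (\<lambda>s. indicator {0<..<edge_len N a} s *\<^sub>R (B powr q))"
        using len[OF a] by (intro integrable_scaleR_left integrable_real_indicator) auto
      show "indicator {0<..<edge_len N a} s *\<^sub>R \<bar>g a s\<bar> powr q
          \<le> indicator {0<..<edge_len N a} s *\<^sub>R (B powr q)" for s
        using bound[OF a, of s] q by (auto simp: indicator_def intro!: powr_mono2)
    qed auto
    also have "\<dots> = edge_len N a * B powr q"
      using len[OF a] by simp
    finally show "(LINT s:{0<..<edge_len N a}|lborel. \<bar>g a s\<bar> powr q) \<le> edge_len N a * B powr q" .
    show "0 \<le> (LINT s:{0<..<edge_len N a}|lborel. \<bar>g a s\<bar> powr q)"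
      unfolding set_lebesgue_integral_def by (intro integral_nonneg_AE) auto
  qed
  show ?thesis
    unfolding Lq_norm_def using q le nonneg by (intro powr_mono2 sum_mono sum_nonneg) auto
qed

lemma edge_deriv_diff_const:
  assumes L: "0 < edge_len N a" and C2: "Ck_Icc 2 (edge_len N a) (on_edge N u a)"
    and s: "s \<in> {0..edge_len N a}"
  shows "edge_deriv N 1 (\<lambda>x. u x - c) a s = edge_deriv N 1 u a s"
    and "edge_deriv N 2 (\<lambda>x. u x - c) a s = edge_deriv N 2 u a s"
proof -
  let ?L = "edge_len N a" and ?g = "on_edge N u a"
  have D: "((\<lambda>s. ?g s - c) has_real_derivative deriv_Icc ?L ?g t) (at t within {0..?L})"
    if "t \<in> {0..?L}" for t
    using DERIV_diff[OF Ck_Icc_2D(1)[OF C2 that] DERIV_const] by simp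
  have h: "on_edge N (\<lambda>x. u x - c) a t = ?g t - c" for t
    by (simp add: on_edge_def)
  note * = Ck_Icc_2I[OF L D Ck_Icc_2D(2)[OF C2] Ck_Icc_2D(3)[OF C2 s] h]
  show "edge_deriv N 1 (\<lambda>x. u x - c) a s = edge_deriv N 1 u a s"
    unfolding edge_deriv_1 by (rule *(2)) (use s in auto)
  show "edge_deriv N 2 (\<lambda>x. u x - c) a s = edge_deriv N 2 u a s"
    unfolding edge_deriv_2 by (rule *(3)) (use s in auto)
qed

context ergodic_data
begin

text \<open>The growth condition gives \<open>|H x 0| \<le> CH\<close>.\<close>

lemma ergodic_constant_bound:
  assumes sol: "solution \<rho> U w"
    and B: "\<And>a s. a \<in> edges N \<Longrightarrow> s \<in> {0..len a} \<Longrightarrow> \<bar>edge_ext N F a s\<bar> \<le> B" and B0: "0 \<le> B"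
    and T: "\<And>v. v \<in> inner_verts N \<Longrightarrow> \<bar>\<theta> v\<bar> \<le> T" and T0: "0 \<le> T"
  shows "\<bar>\<rho>\<bar> \<le> CH + B + T"
proof -
  have rhs: "\<bar>ham_rhs N \<mu> H F a s 0\<bar> \<le> 1 / \<mu> a * (CH + B + T)"
    if a: "a \<in> edges N" and s: "s \<in> {0..len a}" for a s
  proof -
    have "\<bar>edge_ham N H a (edge_param N a s) 0\<bar> \<le> CH"
      using edge_ham_growth(1)[OF a s, of 0] q_bounds by simp
    then have "\<bar>edge_ham N H a (edge_param N a s) 0 - edge_ext N F a s\<bar> \<le> CH + B + T"
      using B[OF a s] T0 by linarith
    then show ?thesis
      using \<mu>_pos[OF a] by (simp add: ham_rhs_def abs_divide divide_right_mono)
  qed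
  have \<theta>: "\<bar>zero_on_bdry N \<theta> v\<bar> \<le> CH + B + T" if "v \<in> verts N" for v
    using T[of v] T0 B0 CH_pos that by (auto simp: zero_on_bdry_def)
  have "\<rho> \<le> CH + B + T"
  proof (rule subsolution_upper_bound[OF solution_imp_subsolution[OF sol]])
    show "- (1 / \<mu> a * (CH + B + T)) \<le> ham_rhs N \<mu> H F a s 0" if "a \<in> edges N" "s \<in> {0..len a}" for a s
      using rhs[OF that] by linarith
    show "zero_on_bdry N \<theta> v \<le> CH + B + T" if "v \<in> verts N" for v
      using \<theta>[OF that] by linarith
  qed
  moreover have "- (CH + B + T) \<le> \<rho>"
  proof (rule solution_lower_bound[OF sol])
    show "ham_rhs N \<mu> H F a s 0 \<le> 1 / \<mu> a * (CH + B + T)" if "a \<in> edges N" "s \<in> {0..len a}" for a s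
      using rhs[OF that] by linarith
    show "- (CH + B + T) \<le> zero_on_bdry N \<theta> v" if "v \<in> verts N" for v
      using \<theta>[OF that] by linarith
  qed
  ultimately show ?thesis by (simp add: abs_le_iff)
qed

end

text \<open>
  The constants are fixed before \<open>H\<close>, \<open>F\<close> and \<open>\<theta>\<close>: \<open>A\<close> bounds \<open>|\<rho>|\<close>, then \<open>B\<close> bounds the net fluxes,
  \<open>R\<close> bounds \<open>\<partial>u\<close> by \<open>net_bound_imp_bounded\<close>, \<open>W\<close> bounds \<open>\<partial>\<^sup>2u\<close> by the equation, and \<open>(D + 2) M\<close> bounds
  the oscillation of \<open>u\<close>. On a network of finite length these uniform bounds control the norms.
\<close>

lemma ergodic_sol_apriori_bound:
  fixes N :: "('d::finite, 'e) network"
  assumes N: "network N"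
  obtains C where "0 < C" and "\<And>lam \<theta> H F \<sigma> u \<rho> x0.
    coeff_assms N lam \<mu> \<gamma> \<eta> \<Longrightarrow> ham_assms N H CH q \<Longrightarrow>
    0 < \<sigma> \<Longrightarrow> \<sigma> < 1 \<Longrightarrow> PC_hoelder_net N \<sigma> F \<Longrightarrow> Linf_norm N (on_edge N F) = MF \<Longrightarrow>
    \<forall>v\<in>inner_verts N. \<bar>\<theta> v\<bar> = T v \<Longrightarrow> Ck_net N 2 u \<Longrightarrow> ergodic_sol N \<mu> \<gamma> \<eta> \<theta> H F u \<rho> \<Longrightarrow>
    x0 \<in> net_set N \<Longrightarrow> Lq_norm N q (edge_deriv N 1 u) + W21_norm N (\<lambda>x. u x - u x0) \<le> C"
proof (cases "(\<exists>lam. coeff_assms N lam \<mu> \<gamma> \<eta>) \<and> 0 < CH \<and> 1 < q")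
  case False
  \<comment> \<open>There are no admissible data.\<close>
  then show ?thesis
    by (intro that[of 1]) (auto simp: ham_assms_def)
next
  case True
  then obtain lam0 where coeff0: "coeff_assms N lam0 \<mu> \<gamma> \<eta>" and CH: "0 < CH" and q: "1 < q"
    by blast
  interpret metric_graph "verts N" "edges N" "src N" "tgt N" "edge_len N"
    by (rule network_metric_graph[OF N])
  have \<mu>: "0 < \<mu> a" if "a \<in> edges N" for a
    using coeff0 that by (simp add: coeff_assms_def)
  define FB where "FB = \<bar>MF\<bar> + 1"
  define TB where "TB = (\<Sum>v\<in>inner_verts N. \<bar>T v\<bar>)"
  define A where "A = CH + FB + TB"
  have TB: "0 \<le> TB" and A: "0 < A" and FB: "0 < FB"
    using CH by (auto simp: TB_def A_def FB_def sum_nonneg intro!: add_pos_nonneg)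
  define B where "B = (\<Sum>v\<in>inner_verts N. \<eta> v * (\<bar>T v\<bar> + A))"
  obtain R0 where R0: "\<And>w w' a s.
      coercive_family (\<lambda>a. 1 / (CH * \<mu> a)) q (\<lambda>a. (CH + FB + A) / \<mu> a) w w' \<Longrightarrow>
      \<forall>v\<in>verts N. net (vertex_weight N \<mu> \<gamma>) w v \<le> B \<Longrightarrow>
      a \<in> edges N \<Longrightarrow> s \<in> {0..edge_len N a} \<Longrightarrow> \<bar>w a s\<bar> \<le> R0"
  proof -
    have "\<And>x a. x \<in> verts N \<Longrightarrow> a \<in> inc x \<Longrightarrow> 0 < vertex_weight N \<mu> \<gamma> x a"
      using coeff0 by (auto simp: vertex_weight_def coeff_assms_def inc_eq_incident[OF N] incident_def)
    moreover have "\<And>a. a \<in> edges N \<Longrightarrow> 0 < 1 / (CH * \<mu> a)"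
      using CH \<mu> by simp
    ultimately show ?thesis
      by (rule net_bound_imp_bounded[where \<kappa> = "vertex_weight N \<mu> \<gamma>" and c = "\<lambda>a. 1 / (CH * \<mu> a)"
          and C = "\<lambda>a. (CH + FB + A) / \<mu> a" and B = B and q = q, OF _ _ q]) (assumption | rule that)+
  qed
  define R where "R = \<bar>R0\<bar>"
  obtain D where D: "0 \<le> D" "\<And>U M x y. (\<And>a. a \<in> edges N \<Longrightarrow> \<bar>U (tgt N a) - U (src N a)\<bar> \<le> M) \<Longrightarrow>
      x \<in> verts N \<Longrightarrow> y \<in> verts N \<Longrightarrow> \<bar>U x - U y\<bar> \<le> D * (M :: real)"
    using potential_difference_bound by metis
  define M where "M = (\<Sum>a\<in>edges N. R * edge_len N a)"
  define W where "W = (\<Sum>a\<in>edges N. (CH * (1 + R powr q) + FB + A) / \<mu> a)"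
  let ?X = "\<lambda>r b. (\<Sum>a\<in>edges N. edge_len N a * b powr r) powr (1 / r)"
  let ?C = "?X q R + (?X 1 ((D + 2) * M) + ?X 1 R + ?X 1 W) + 1"
  have "0 < ?C" by (intro add_nonneg_pos add_nonneg_nonneg) auto
  moreover have "Lq_norm N q (edge_deriv N 1 u) + W21_norm N (\<lambda>x. u x - u x0) \<le> ?C"
    if coeff: "coeff_assms N lam \<mu> \<gamma> \<eta>" and ham: "ham_assms N H CH q"
      and \<sigma>: "0 < \<sigma>" "\<sigma> < 1" and F: "PC_hoelder_net N \<sigma> F"
      and MF: "Linf_norm N (on_edge N F) = MF" and \<theta>: "\<forall>v\<in>inner_verts N. \<bar>\<theta> v\<bar> = T v"
      and u: "Ck_net N 2 u" and sol: "ergodic_sol N \<mu> \<gamma> \<eta> \<theta> H F u \<rho>" and x0: "x0 \<in> net_set N"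
    for lam \<theta> H F \<sigma> u \<rho> x0
  proof -
    interpret P: ergodic_data N lam \<mu> \<gamma> \<eta> \<theta> H CH q F \<sigma>
      by unfold_locales (use N coeff ham \<sigma> F in auto)
    let ?w = "edge_deriv N 1 u"
    have psol: "P.solution \<rho> u ?w"
      by (rule P.ergodic_sol_imp_solution[OF u sol])
    have fl: "P.flow \<rho> u ?w"
      using psol by (simp add: P.solution_def)
    have F_le: "\<bar>edge_ext N F a s\<bar> \<le> FB" if a: "a \<in> edges N" and s: "s \<in> {0..edge_len N a}" for a s
    proof (rule continuous_le_on_closure[where f = "\<lambda>s. \<bar>edge_ext N F a s\<bar>"])
      show "continuous_on (closure {0<..<edge_len N a}) (\<lambda>s. \<bar>edge_ext N F a s\<bar>)"
        unfolding closure_open_Icc[OF len_pos[OF a]]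
        by (intro continuous_intros P.continuous_edge_ext[OF a])
      show "s \<in> closure {0<..<edge_len N a}"
        using s closure_open_Icc[OF len_pos[OF a]] by simp
      show "\<bar>edge_ext N F a t\<bar> \<le> FB" if t: "t \<in> {0<..<edge_len N a}" for t
        using Linf_norm_bound[OF N F \<sigma>(1) a t] MF P.edge_ext_interior[OF t] by (simp add: FB_def)
    qed
    have \<theta>_le: "\<bar>\<theta> v\<bar> \<le> TB" if v: "v \<in> inner_verts N" for v
    proof -
      have "\<bar>T v\<bar> \<le> TB"
        unfolding TB_def using v finite_V by (intro member_le_sum) auto
      with \<theta> v show ?thesis by simp
    qed
    have \<rho>: "\<bar>\<rho>\<bar> \<le> A"
      unfolding A_def
      by (rule P.ergodic_constant_bound[OF psol F_le]) (use \<theta>_le TB FB in auto)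
    have D1: "(?w a has_real_derivative ham_rhs N \<mu> H F a s (?w a s) + 1 / \<mu> a * \<rho>)
        (at s within {0..edge_len N a})" if "a \<in> edges N" "s \<in> {0..edge_len N a}" for a s
      by (rule ode_solD[OF P.flowD(1)[OF fl that(1)] that(2)])
    have "\<bar>?w a s\<bar> \<le> R0" if "a \<in> edges N" "s \<in> {0..edge_len N a}" for a s
    proof (rule R0[where w' = "\<lambda>a s. ham_rhs N \<mu> H F a s (?w a s) + 1 / \<mu> a * \<rho>", OF _ _ that];
        (unfold coercive_family_def)?; intro ballI conjI)
      fix a s assume a: "a \<in> edges N" and s: "s \<in> {0..edge_len N a}"
      show "(?w a has_real_derivative ham_rhs N \<mu> H F a s (?w a s) + 1 / \<mu> a * \<rho>)
        (at s within {0..edge_len N a})" by (rule D1[OF a s])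
      have "- A / \<mu> a \<le> 1 / \<mu> a * \<rho>"
        using divide_right_mono[of "- A" \<rho> "\<mu> a"] \<rho> \<mu>[OF a] by (simp add: abs_le_iff)
      then show "1 / (CH * \<mu> a) * \<bar>?w a s\<bar> powr q - (CH + FB + A) / \<mu> a
          \<le> ham_rhs N \<mu> H F a s (?w a s) + 1 / \<mu> a * \<rho>"
        using P.ham_rhs_coercive[OF a s F_le[OF a s], of "?w a s"]
        by (simp add: add_divide_distrib)
    next
      fix v assume v: "v \<in> verts N"
      have \<eta>: "0 \<le> \<eta> v" if "v \<in> inner_verts N" for v
        using coeff that by (simp add: coeff_assms_def)
      have "net (vertex_weight N \<mu> \<gamma>) ?w v = zero_on_bdry N \<eta> v * (zero_on_bdry N \<theta> v - \<rho>)"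
        using psol v by (simp add: P.solution_def)
      also have "\<dots> \<le> B"
      proof (cases "v \<in> bdry_verts N")
        case True
        have "0 \<le> B"
          unfolding B_def using \<eta> A by (intro sum_nonneg mult_nonneg_nonneg) auto
        with True show ?thesis by (simp add: zero_on_bdry_def)
      next
        case False
        with v have v': "v \<in> inner_verts N" by simp
        have "\<eta> v * (\<theta> v - \<rho>) \<le> \<eta> v * (\<bar>T v\<bar> + A)"
        proof (rule mult_left_mono)
          have "\<bar>\<theta> v\<bar> = T v" using \<theta> v' by blast
          then show "\<theta> v - \<rho> \<le> \<bar>T v\<bar> + A" using \<rho> by linarith
        qed (rule \<eta>[OF v'])
        also have "\<dots> \<le> B"
          unfolding B_def using v' finite_V \<eta> A
          by (intro member_le_sum[of v "inner_verts N" "\<lambda>v. \<eta> v * (\<bar>T v\<bar> + A)"] mult_nonneg_nonneg) auto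
        finally show ?thesis using False by (simp add: zero_on_bdry_def)
      qed
      finally show "net (vertex_weight N \<mu> \<gamma>) ?w v \<le> B" .
    qed
    then have w_le: "\<bar>?w a s\<bar> \<le> R" if "a \<in> edges N" "s \<in> {0..edge_len N a}" for a s
      using that unfolding R_def by (meson abs_ge_self order_trans)
    have C2: "Ck_Icc 2 (edge_len N a) (on_edge N u a)" if "a \<in> edges N" for a
      using u that by (simp add: Ck_net_def)
    have w'_le: "\<bar>edge_deriv N 2 u a s\<bar> \<le> W" if a: "a \<in> edges N" and s: "s \<in> {0..edge_len N a}" for a s
    proof -
      have "edge_deriv N 2 u a s = ham_rhs N \<mu> H F a s (?w a s) + 1 / \<mu> a * \<rho>"
        unfolding edge_deriv_2 by (rule deriv_Icc_eq[OF len_pos[OF a] s D1[OF a s]]) (simp add: edge_deriv_1[unfolded One_nat_def])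
      also have "\<dots> = (edge_ham N H a (edge_param N a s) (?w a s) - edge_ext N F a s + \<rho>) / \<mu> a"
        by (simp add: ham_rhs_def add_divide_distrib)
      also have "\<bar>\<dots>\<bar> \<le> (CH * (1 + R powr q) + FB + A) / \<mu> a"
        unfolding abs_divide abs_of_pos[OF \<mu>[OF a]]
      proof (rule divide_right_mono)
        have "CH * (1 + \<bar>?w a s\<bar> powr q) \<le> CH * (1 + R powr q)"
          using CH w_le[OF a s] q by (intro mult_left_mono add_left_mono powr_mono2) auto
        then show "\<bar>edge_ham N H a (edge_param N a s) (?w a s) - edge_ext N F a s + \<rho>\<bar>
            \<le> CH * (1 + R powr q) + FB + A"
          using P.edge_ham_growth(1)[OF a s, of "?w a s"] F_le[OF a s] \<rho> by linarith
      qed (use \<mu>[OF a] in simp)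
      also have "\<dots> \<le> W"
        unfolding W_def using a finite_E CH FB A \<mu>
        by (intro member_le_sum[of a "edges N" "\<lambda>a. (CH * (1 + R powr q) + FB + A) / \<mu> a"])
          (auto intro!: divide_nonneg_pos add_nonneg_nonneg mult_nonneg_nonneg)
      finally show ?thesis .
    qed
    have along: "\<bar>u (edge_param N a s) - u (src N a)\<bar> \<le> M"
      if a: "a \<in> edges N" and s: "s \<in> {0..edge_len N a}" for a s
    proof -
      have R: "0 \<le> R" by (simp add: R_def)
      have "norm (on_edge N u a s - on_edge N u a 0) \<le> R * norm (s - 0)"
        by (rule field_differentiable_bound[where S = "{0..edge_len N a}" and f' = "?w a"])
          (use Ck_Icc_2D(1)[OF C2[OF a]] w_le[OF a] s in \<open>auto simp: edge_deriv_1[unfolded One_nat_def]\<close>)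
      then have "\<bar>u (edge_param N a s) - u (src N a)\<bar> \<le> R * s"
        using s by (simp add: on_edge_def edge_param_0)
      also have "\<dots> \<le> R * edge_len N a"
        using s R by (intro mult_left_mono) auto
      also have "\<dots> \<le> M"
        unfolding M_def using a finite_E R len_pos
        by (intro member_le_sum[of a "edges N" "\<lambda>a. R * edge_len N a"]) (auto simp: less_imp_le)
      finally show ?thesis .
    qed
    have near: "\<exists>v\<in>verts N. \<bar>u x - u v\<bar> \<le> M" if x: "x \<in> net_set N" for x
    proof -
      obtain a where a: "a \<in> edges N" "x \<in> edge_set N a"
        using x by (auto simp: net_set_def)
      obtain s where "s \<in> {0..edge_len N a}" "x = edge_param N a s"
        using edge_setE[OF len_pos[OF a(1)] a(2)] .
      with along[OF a(1)] org_in_V[OF a(1)] show ?thesis by blast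
    qed
    have osc: "\<bar>u x - u x0\<bar> \<le> (D + 2) * M" if x: "x \<in> net_set N" for x
    proof -
      obtain v v0 where v: "v \<in> verts N" "\<bar>u x - u v\<bar> \<le> M" and v0: "v0 \<in> verts N" "\<bar>u x0 - u v0\<bar> \<le> M"
        using near[OF x] near[OF x0] by blast
      have "\<bar>u (tgt N a) - u (src N a)\<bar> \<le> M" if a: "a \<in> edges N" for a
        using along[OF a, of "edge_len N a"] len_pos[OF a] by (simp add: edge_param_len)
      from D(2)[OF this v(1) v0(1)] v(2) v0(2) show ?thesis
        by (simp add: distrib_right)
    qed
    have sub: "s \<in> {0..edge_len N a}" if "s \<in> {0<..<edge_len N a}" for s a
      using that by simp
    let ?u = "\<lambda>x. u x - u x0"
    have "Lq_norm N q ?w \<le> ?X q R"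
      by (rule Lq_norm_le[OF _ len_pos w_le[OF _ sub]]) (use q in auto)
    moreover have "Lq_norm N 1 (on_edge N ?u) \<le> ?X 1 ((D + 2) * M)"
    proof (rule Lq_norm_le[OF _ len_pos])
      fix a s assume a: "a \<in> edges N" and s: "s \<in> {0<..<edge_len N a}"
      have "edge_param N a s \<in> net_set N"
        using P.param_in_edge_set[OF a sub[OF s]] a by (auto simp: net_set_def)
      then show "\<bar>on_edge N ?u a s\<bar> \<le> (D + 2) * M"
        using osc by (simp add: on_edge_def)
    qed auto
    moreover have "Lq_norm N 1 (edge_deriv N 1 ?u) \<le> ?X 1 R"
    proof (rule Lq_norm_le[OF _ len_pos])
      fix a s assume a: "a \<in> edges N" and s: "s \<in> {0<..<edge_len N a}"
      show "\<bar>edge_deriv N 1 ?u a s\<bar> \<le> R"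
        unfolding edge_deriv_diff_const(1)[OF len_pos[OF a] C2[OF a] sub[OF s]]
        by (rule w_le[OF a sub[OF s]])
    qed auto
    moreover have "Lq_norm N 1 (edge_deriv N 2 ?u) \<le> ?X 1 W"
    proof (rule Lq_norm_le[OF _ len_pos])
      fix a s assume a: "a \<in> edges N" and s: "s \<in> {0<..<edge_len N a}"
      show "\<bar>edge_deriv N 2 ?u a s\<bar> \<le> W"
        unfolding edge_deriv_diff_const(2)[OF len_pos[OF a] C2[OF a] sub[OF s]]
        by (rule w'_le[OF a sub[OF s]])
    qed auto
    ultimately show ?thesis
      unfolding W21_norm_def by linarith
  qed
  ultimately show ?thesis by (rule that)
qed

theorem theorem4p6:
  fixes N :: "('d::finite, 'e) network"
  assumes "network N"
  shows
    "(\<forall>lam \<mu> \<gamma> \<eta> \<theta> H CH q F \<sigma>.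
        coeff_assms N lam \<mu> \<gamma> \<eta> \<and> ham_assms N H CH q \<and>
        0 < \<sigma> \<and> \<sigma> < 1 \<and> PC_hoelder_net N \<sigma> F \<longrightarrow>
        (\<exists>u \<rho>. Ck_net N 2 u \<and> ergodic_sol N \<mu> \<gamma> \<eta> \<theta> H F u \<rho> \<and>
           (ham_hoelder N H \<sigma> \<longrightarrow> Ck_hoelder_net N 2 \<sigma> u)) \<and>
        (\<forall>u \<rho> u' \<rho>'.
           Ck_net N 2 u \<and> ergodic_sol N \<mu> \<gamma> \<eta> \<theta> H F u \<rho> \<and>
           Ck_net N 2 u' \<and> ergodic_sol N \<mu> \<gamma> \<eta> \<theta> H F u' \<rho>' \<longrightarrow>
           \<rho>' = \<rho> \<and> (\<exists>c. \<forall>x\<in>net_set N. u' x = u x + c)))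
     \<and>
     (\<forall>\<mu> \<gamma> \<eta> CH q MF MH T. \<exists>C>0. \<forall>lam \<theta> H F \<sigma> u \<rho>.
        coeff_assms N lam \<mu> \<gamma> \<eta> \<and> ham_assms N H CH q \<and>
        0 < \<sigma> \<and> \<sigma> < 1 \<and> PC_hoelder_net N \<sigma> F \<and>
        Linf_norm N (on_edge N F) = MF \<and>
        Linf_norm N (on_edge N (\<lambda>x. H x 0)) = MH \<and>
        (\<forall>v\<in>inner_verts N. \<bar>\<theta> v\<bar> = T v) \<and>
        Ck_net N 2 u \<and> ergodic_sol N \<mu> \<gamma> \<eta> \<theta> H F u \<rho> \<longrightarrow>
        (\<forall>x0\<in>net_set N.
           Lq_norm N q (edge_deriv N 1 u) + W21_norm N (\<lambda>x. u x - u x0) \<le> C))"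
proof (intro conjI allI impI, goal_cases)
  case (1 lam \<mu> \<gamma> \<eta> \<theta> H CH q F \<sigma>)
  then interpret ergodic_data N lam \<mu> \<gamma> \<eta> \<theta> H CH q F \<sigma>
    by unfold_locales (use assms in auto)
  show ?case by (rule ergodic_sol_exists)
next
  case (2 lam \<mu> \<gamma> \<eta> \<theta> H CH q F \<sigma> u \<rho> u' \<rho>')
  then interpret ergodic_data N lam \<mu> \<gamma> \<eta> \<theta> H CH q F \<sigma>
    by unfold_locales (use assms in auto)
  show ?case using ergodic_sol_unique 2(2) by blast
next
  case (3 lam \<mu> \<gamma> \<eta> \<theta> H CH q F \<sigma> u \<rho> u' \<rho>')
  then interpret ergodic_data N lam \<mu> \<gamma> \<eta> \<theta> H CH q F \<sigma>
    by unfold_locales (use assms in auto)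
  show ?case using ergodic_sol_unique 3(2) by blast
next
  case (4 \<mu> \<gamma> \<eta> CH q MF MH T)
  obtain C where C: "0 < C" "\<And>lam \<theta> H F \<sigma> u \<rho> x0.
    coeff_assms N lam \<mu> \<gamma> \<eta> \<Longrightarrow> ham_assms N H CH q \<Longrightarrow>
    0 < \<sigma> \<Longrightarrow> \<sigma> < 1 \<Longrightarrow> PC_hoelder_net N \<sigma> F \<Longrightarrow> Linf_norm N (on_edge N F) = MF \<Longrightarrow>
    \<forall>v\<in>inner_verts N. \<bar>\<theta> v\<bar> = T v \<Longrightarrow> Ck_net N 2 u \<Longrightarrow> ergodic_sol N \<mu> \<gamma> \<eta> \<theta> H F u \<rho> \<Longrightarrow>
    x0 \<in> net_set N \<Longrightarrow> Lq_norm N q (edge_deriv N 1 u) + W21_norm N (\<lambda>x. u x - u x0) \<le> C"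
    by (rule ergodic_sol_apriori_bound[OF assms]) (rule that)
  show ?case
    by (intro exI[of _ C] conjI C(1) allI impI ballI, elim conjE, rule C(2))
qed

end
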